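(* Let $(M,\omega)$ be a presymplectic manifold with characteristic foliation $\mathcal{I}$. If the reduced symplectic manifold $(Q=M/\mathcal{I},\omega')$ of $(M,\omega)$ exists, then any $\mathcal{I}$-projectable presymplectic connection $\nabla$ on $M$ induces a symplectic connection $\nabla'$ on $Q$.
   Context: Everything is $C^\infty$; $\Gamma$ denotes spaces of cross sections. A presymplectic manifold is a $(2n+p)$-dimensional manifold $M$ with a closed $2$-form $\omega$ of constant rank $2n$. The $p$-dimensional distribution $I=\{X\in TM : i(X)\omega=0\}$ is integrable; the corresponding foliation $\mathcal{I}$, with $T\mathcal{I}=I$, is the characteristic foliation. The reduced symplectic manifold exists if the space of leaves $Q=M/\mathcal{I}$ is a Hausdorff manifold (with the natural projection $\pi:M\to Q$ a submersion); then $\omega'$ is the symplectic form on $Q$ with $\pi^*\omega'=\omega$. A presymplectic connection on $(M,\omega)$ is a linear connection $\nabla$ on $M$ such that $\nabla\omega=0$ and its torsion takes values in $I$. A symplectic connection on a symplectic manifold $(Q,\omega')$ is a torsionless linear connection $\nabla'$ with $\nabla'\omega'=0$. For a foliation $\mathcal{F}$ on a manifold $V$, a vector field $Y$ is projectable, $Y\in\Gamma_{pr}TV$, if its flow preserves $\mathcal{F}$, equivalently $[Z,Y]\in\Gamma T\mathcal{F}$ for all $Z\in\Gamma T\mathcal{F}$. A linear connection $\nabla$ on $V$ is $\mathcal{F}$-adapted if $\nabla_XY\in\Gamma T\mathcal{F}$ for all $X\in\Gamma T\mathcal{F}$ and $Y\in\Gamma_{pr}TV$. It is $\mathcal{F}$-projectable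 if, moreover, $\nabla_XY\in\Gamma_{pr}TV$ for all $X,Y\in\Gamma_{pr}TV$. "$\nabla$ induces $\nabla'$ on $Q$" means that the formula $\nabla'_{\mathcal{X}}\mathcal{Y}=\pi_*(\nabla_XY)$, where $\mathcal{X},\mathcal{Y}$ are vector fields on $Q$ and $X,Y\in\Gamma_{pr}TM$ are any vector fields projecting by $\pi$ to $\mathcal{X},\mathcal{Y}$, is well defined and gives the connection $\nabla'$. *)

theory Defs
  imports "HOL-Analysis.Analysis" "HOL-Library.Function_Algebras"
begin

section \<open>Smooth maps between Euclidean spaces\<close>

text \<open>
  Derivatives are taken within \<open>S\<close>.  The sets that occur below are open, or contained in \<open>{0}\<close>,
  where every map is smooth.
\<close>

primrec Ck_on :: "nat \<Rightarrow> 'e::euclidean_space set \<Rightarrow> ('e \<Rightarrow> 'f::real_normed_vector) \<Rightarrow> bool" where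
  "Ck_on 0 S f \<longleftrightarrow> continuous_on S f"
| "Ck_on (Suc k) S f \<longleftrightarrow>
     f differentiable_on S \<and> (\<forall>v. Ck_on k S (\<lambda>x. frechet_derivative f (at x within S) v))"

definition smooth_on :: "'e::euclidean_space set \<Rightarrow> ('e \<Rightarrow> 'f::real_normed_vector) \<Rightarrow> bool" where
  "smooth_on S f \<longleftrightarrow> (\<forall>k. Ck_on k S f)"

section \<open>Smooth manifolds\<close>

type_synonym ('a, 'e) chart = "'a set \<times> ('a \<Rightarrow> 'e)"

record ('a, 'e) mfd =
  mtop :: "'a topology"
  mdim :: nat
  atlas :: "('a, 'e) chart set"

abbreviation points :: "('a, 'e) mfd \<Rightarrow> 'a set" where
  "points M \<equiv> topspace (mtop M)"

text \<open>
  Types of class \<open>euclidean_space\<close> have positive dimension.  To cover manifolds of dimension \<open>0\<close>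
  as well, the model of dimension \<open>0\<close> is the subspace \<open>{0}\<close>; in dimension \<open>d > 0\<close> the model is
  the whole type, which must then have dimension \<open>d\<close> (see \<open>smooth_manifold\<close>).
\<close>

definition model_space :: "nat \<Rightarrow> 'e::euclidean_space set" where
  "model_space d = (if d = 0 then {0} else UNIV)"

text \<open>All charts compatible with the given atlas, i.e. the maximal atlas.\<close>

definition charts :: "('a, 'e::euclidean_space) mfd \<Rightarrow> ('a, 'e) chart set" where
  "charts M = {(U, \<phi>).
     openin (mtop M) U \<and>
     openin (top_of_set (model_space (mdim M))) (\<phi> ` U) \<and>
     homeomorphic_map (subtopology (mtop M) U) (top_of_set (\<phi> ` U)) \<phi> \<and>
     (\<forall>(V, \<psi>) \<in> atlas M.
        smooth_on (\<phi> ` (U \<inter> V)) (\<psi> \<circ> inv_into U \<phi>) \<and>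
        smooth_on (\<psi> ` (U \<inter> V)) (\<phi> \<circ> inv_into V \<psi>))}"

definition smooth_manifold :: "('a, 'e::euclidean_space) mfd \<Rightarrow> bool" where
  "smooth_manifold M \<longleftrightarrow>
     Hausdorff_space (mtop M) \<and> second_countable (mtop M) \<and>
     dim (model_space (mdim M) :: 'e set) = mdim M \<and>
     atlas M \<subseteq> charts M \<and>
     (\<Union>(U, \<phi>) \<in> atlas M. U) = points M"

definition smooth_map ::
  "('a, 'e::euclidean_space) mfd \<Rightarrow> ('b, 'f::euclidean_space) mfd \<Rightarrow> ('a \<Rightarrow> 'b) \<Rightarrow> bool" where
  "smooth_map M N F \<longleftrightarrow>
     continuous_map (mtop M) (mtop N) F \<and>
     (\<forall>(U, \<phi>) \<in> atlas M. \<forall>(V, \<psi>) \<in> atlas N.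
        smooth_on (\<phi> ` (U \<inter> F -` V)) (\<psi> \<circ> F \<circ> inv_into U \<phi>))"

text \<open>The values of a function outside \<open>points M\<close> are irrelevant.\<close>

definition smooth_functions :: "('a, 'e::euclidean_space) mfd \<Rightarrow> ('a \<Rightarrow> real) set" where
  "smooth_functions M = {f. \<forall>(U, \<phi>) \<in> atlas M. smooth_on (\<phi> ` U) (f \<circ> inv_into U \<phi>)}"

section \<open>Tangent vectors and vector fields\<close>

text \<open>
  Tangent vectors at \<open>x\<close> are the derivations at \<open>x\<close> of the algebra of smooth functions; to make
  them unique as HOL functions, they are \<open>0\<close> on nonsmooth arguments.  Likewise vector fields
  vanish outside \<open>points M\<close>.  Sums, differences and zero are the pointwise ones of
  \<open>Function_Algebras\<close>.
\<close>

type_synonym 'a tvec = "('a \<Rightarrow> real) \<Rightarrow> real"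
type_synonym 'a vfield = "'a \<Rightarrow> 'a tvec"

definition tscale :: "real \<Rightarrow> ('b \<Rightarrow> real) \<Rightarrow> ('b \<Rightarrow> real)" where
  "tscale c v = (\<lambda>f. c * v f)"

lemma vector_space_tscale: "vector_space (tscale :: real \<Rightarrow> ('b \<Rightarrow> real) \<Rightarrow> _)"
  by unfold_locales (auto simp: tscale_def fun_eq_iff algebra_simps)

definition tangent_space :: "('a, 'e::euclidean_space) mfd \<Rightarrow> 'a \<Rightarrow> 'a tvec set" where
  "tangent_space M x = {v.
     (\<forall>f. f \<notin> smooth_functions M \<longrightarrow> v f = 0) \<and>
     (\<forall>f\<in>smooth_functions M. \<forall>g\<in>smooth_functions M.
        v (\<lambda>y. f y + g y) = v f + v g \<and>
        v (\<lambda>y. f y * g y) = f x * v g + g x * v f) \<and>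
     (\<forall>c. \<forall>f\<in>smooth_functions M. v (\<lambda>y. c * f y) = c * v f)}"

definition vector_fields :: "('a, 'e::euclidean_space) mfd \<Rightarrow> 'a vfield set" where
  "vector_fields M = {X.
     (\<forall>x\<in>points M. X x \<in> tangent_space M x) \<and>
     (\<forall>x. x \<notin> points M \<longrightarrow> X x = 0) \<and>
     (\<forall>f\<in>smooth_functions M. (\<lambda>x. X x f) \<in> smooth_functions M)}"

definition vf_apply :: "'a vfield \<Rightarrow> ('a \<Rightarrow> real) \<Rightarrow> ('a \<Rightarrow> real)" where
  "vf_apply X f = (\<lambda>x. X x f)"

definition vf_scale :: "('a \<Rightarrow> real) \<Rightarrow> 'a vfield \<Rightarrow> 'a vfield" where
  "vf_scale f X = (\<lambda>x. tscale (f x) (X x))"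

definition lie_bracket :: "'a vfield \<Rightarrow> 'a vfield \<Rightarrow> 'a vfield" where
  "lie_bracket X Y = (\<lambda>x f. X x (vf_apply Y f) - Y x (vf_apply X f))"

definition pushforward ::
  "('b, 'f::euclidean_space) mfd \<Rightarrow> ('a \<Rightarrow> 'b) \<Rightarrow> 'a tvec \<Rightarrow> 'b tvec" where
  "pushforward N F v = (\<lambda>f. if f \<in> smooth_functions N then v (f \<circ> F) else 0)"

definition submersion ::
  "('a, 'e::euclidean_space) mfd \<Rightarrow> ('b, 'f::euclidean_space) mfd \<Rightarrow> ('a \<Rightarrow> 'b) \<Rightarrow> bool" where
  "submersion M N F \<longleftrightarrow> smooth_map M N F \<and>
     (\<forall>x\<in>points M. pushforward N F ` tangent_space M x = tangent_space N (F x))"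

definition vf_projects_to ::
  "('a, 'e::euclidean_space) mfd \<Rightarrow> ('b, 'f::euclidean_space) mfd \<Rightarrow> ('a \<Rightarrow> 'b) \<Rightarrow>
   'a vfield \<Rightarrow> 'b vfield \<Rightarrow> bool" where
  "vf_projects_to M N F X X' \<longleftrightarrow> (\<forall>x\<in>points M. pushforward N F (X x) = X' (F x))"

text \<open>The tangent vector at \<open>x\<close> with coordinate vector \<open>e\<close> in the chart \<open>(U, \<phi>)\<close>.\<close>

definition chart_vector ::
  "('a, 'e::euclidean_space) mfd \<Rightarrow> ('a, 'e) chart \<Rightarrow> 'a \<Rightarrow> 'e \<Rightarrow> 'a tvec" where
  "chart_vector M = (\<lambda>(U, \<phi>) x e f.
     if f \<in> smooth_functions M
     then frechet_derivative (f \<circ> inv_into U \<phi>) (at (\<phi> x) within \<phi> ` U) e else 0)"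

section \<open>Foliations\<close>

text \<open>
  A foliation is given by an atlas of foliated charts \<open>(U, \<phi>, B)\<close>: the coordinates in the
  directions \<open>B\<close> run along the leaves, the remaining ones are transverse.  Since \<open>\<phi> ` U\<close> is
  convex, the sets of points of \<open>U\<close> with fixed transverse coordinates (the plaques) are connected.
  The last condition says that transition maps locally have the form
  \<open>(s, t) \<mapsto> (h\<^sub>1 (s, t), h\<^sub>2 t)\<close>, with \<open>t\<close> the transverse coordinates.
\<close>

type_synonym ('a, 'e) fchart = "'a set \<times> ('a \<Rightarrow> 'e) \<times> 'e set"

definition same_transverse :: "('a \<Rightarrow> 'e::euclidean_space) \<Rightarrow> 'e set \<Rightarrow> 'a \<Rightarrow> 'a \<Rightarrow> bool" where
  "same_transverse \<phi> B x y \<longleftrightarrow> (\<forall>b\<in>Basis - B. \<phi> x \<bullet> b = \<phi> y \<bullet> b)"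

definition foliation ::
  "('a, 'e::euclidean_space) mfd \<Rightarrow> nat \<Rightarrow> ('a, 'e) fchart set \<Rightarrow> bool" where
  "foliation M k \<F> \<longleftrightarrow>
     (\<forall>(U, \<phi>, B) \<in> \<F>.
        (U, \<phi>) \<in> charts M \<and> convex (\<phi> ` U) \<and> B \<subseteq> Basis \<and> card B = k) \<and>
     (\<Union>(U, \<phi>, B) \<in> \<F>. U) = points M \<and>
     (\<forall>(U, \<phi>, B) \<in> \<F>. \<forall>(V, \<psi>, C) \<in> \<F>. \<forall>x \<in> U \<inter> V.
        \<exists>W. openin (mtop M) W \<and> x \<in> W \<and> W \<subseteq> U \<inter> V \<and>
          (\<forall>y\<in>W. \<forall>z\<in>W. same_transverse \<phi> B y z \<longrightarrow> same_transverse \<psi> C y z))"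

definition same_plaque :: "('a, 'e::euclidean_space) fchart set \<Rightarrow> 'a \<Rightarrow> 'a \<Rightarrow> bool" where
  "same_plaque \<F> x y \<longleftrightarrow>
     (\<exists>(U, \<phi>, B) \<in> \<F>. x \<in> U \<and> y \<in> U \<and> same_transverse \<phi> B x y)"

definition leaf :: "('a, 'e::euclidean_space) fchart set \<Rightarrow> 'a \<Rightarrow> 'a set" where
  "leaf \<F> x = {y. (same_plaque \<F>)\<^sup>*\<^sup>* x y}"

definition leaves :: "('a, 'e::euclidean_space) mfd \<Rightarrow> ('a, 'e) fchart set \<Rightarrow> 'a set set" where
  "leaves M \<F> = leaf \<F> ` points M"

definition leaf_tangent_space ::
  "('a, 'e::euclidean_space) mfd \<Rightarrow> ('a, 'e) fchart set \<Rightarrow> 'a \<Rightarrow> 'a tvec set" where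
  "leaf_tangent_space M \<F> x =
     {chart_vector M (U, \<phi>) x e | U \<phi> B e. (U, \<phi>, B) \<in> \<F> \<and> x \<in> U \<and> e \<in> span B}"

definition tangential_fields ::
  "('a, 'e::euclidean_space) mfd \<Rightarrow> ('a, 'e) fchart set \<Rightarrow> 'a vfield set" where
  "tangential_fields M \<F> =
     {X \<in> vector_fields M. \<forall>x\<in>points M. X x \<in> leaf_tangent_space M \<F> x}"

definition projectable_fields ::
  "('a, 'e::euclidean_space) mfd \<Rightarrow> ('a, 'e) fchart set \<Rightarrow> 'a vfield set" where
  "projectable_fields M \<F> =
     {Y \<in> vector_fields M. \<forall>Z\<in>tangential_fields M \<F>. lie_bracket Z Y \<in> tangential_fields M \<F>}"

section \<open>Differential 2-forms\<close>

type_synonym 'a form2 = "'a \<Rightarrow> 'a tvec \<Rightarrow> 'a tvec \<Rightarrow> real"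

definition form2_apply :: "'a form2 \<Rightarrow> 'a vfield \<Rightarrow> 'a vfield \<Rightarrow> ('a \<Rightarrow> real)" where
  "form2_apply \<omega> X Y = (\<lambda>x. \<omega> x (X x) (Y x))"

definition smooth_form2 :: "('a, 'e::euclidean_space) mfd \<Rightarrow> 'a form2 \<Rightarrow> bool" where
  "smooth_form2 M \<omega> \<longleftrightarrow>
     (\<forall>x\<in>points M. \<forall>u\<in>tangent_space M x. \<forall>v\<in>tangent_space M x. \<forall>w\<in>tangent_space M x. \<forall>c.
        \<omega> x (u + v) w = \<omega> x u w + \<omega> x v w \<and>
        \<omega> x (tscale c u) w = c * \<omega> x u w \<and>
        \<omega> x u v = - \<omega> x v u) \<and>
     (\<forall>X\<in>vector_fields M. \<forall>Y\<in>vector_fields M. form2_apply \<omega> X Y \<in> smooth_functions M)"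

definition ext_deriv2 ::
  "'a form2 \<Rightarrow> 'a vfield \<Rightarrow> 'a vfield \<Rightarrow> 'a vfield \<Rightarrow> 'a \<Rightarrow> real" where
  "ext_deriv2 \<omega> X Y Z x =
     X x (form2_apply \<omega> Y Z) - Y x (form2_apply \<omega> X Z) + Z x (form2_apply \<omega> X Y)
     - form2_apply \<omega> (lie_bracket X Y) Z x
     + form2_apply \<omega> (lie_bracket X Z) Y x
     - form2_apply \<omega> (lie_bracket Y Z) X x"

definition closed_form2 :: "('a, 'e::euclidean_space) mfd \<Rightarrow> 'a form2 \<Rightarrow> bool" where
  "closed_form2 M \<omega> \<longleftrightarrow>
     (\<forall>X\<in>vector_fields M. \<forall>Y\<in>vector_fields M. \<forall>Z\<in>vector_fields M. \<forall>x\<in>points M.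
        ext_deriv2 \<omega> X Y Z x = 0)"

definition form2_kernel :: "('a, 'e::euclidean_space) mfd \<Rightarrow> 'a form2 \<Rightarrow> 'a \<Rightarrow> 'a tvec set" where
  "form2_kernel M \<omega> x = {u \<in> tangent_space M x. \<forall>v\<in>tangent_space M x. \<omega> x u v = 0}"

text \<open>
  The rank of \<open>\<omega>\<close> at \<open>x\<close> is the dimension of the image of the map \<open>u \<mapsto> i(u)\<omega>\<close> from the tangent
  space to its dual, whose elements are extended by \<open>0\<close>.
\<close>

definition form2_rank :: "('a, 'e::euclidean_space) mfd \<Rightarrow> 'a form2 \<Rightarrow> 'a \<Rightarrow> nat" where
  "form2_rank M \<omega> x = vector_space.dim tscale
     ((\<lambda>u v. if v \<in> tangent_space M x then \<omega> x u v else 0) ` tangent_space M x)"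

definition presymplectic_manifold ::
  "('a, 'e::euclidean_space) mfd \<Rightarrow> 'a form2 \<Rightarrow> nat \<Rightarrow> nat \<Rightarrow> bool" where
  "presymplectic_manifold M \<omega> n p \<longleftrightarrow>
     smooth_manifold M \<and> mdim M = 2 * n + p \<and>
     smooth_form2 M \<omega> \<and> closed_form2 M \<omega> \<and> (\<forall>x\<in>points M. form2_rank M \<omega> x = 2 * n)"

definition symplectic_manifold :: "('a, 'e::euclidean_space) mfd \<Rightarrow> 'a form2 \<Rightarrow> bool" where
  "symplectic_manifold M \<omega> \<longleftrightarrow>
     smooth_manifold M \<and> smooth_form2 M \<omega> \<and> closed_form2 M \<omega> \<and>
     (\<forall>x\<in>points M. form2_kernel M \<omega> x = {0})"

definition characteristic_foliation ::
  "('a, 'e::euclidean_space) mfd \<Rightarrow> 'a form2 \<Rightarrow> nat \<Rightarrow> ('a, 'e) fchart set \<Rightarrow> bool" where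
  "characteristic_foliation M \<omega> p \<I> \<longleftrightarrow>
     foliation M p \<I> \<and> (\<forall>x\<in>points M. leaf_tangent_space M \<I> x = form2_kernel M \<omega> x)"

text \<open>The points of \<open>Q\<close> are the leaves, and the natural projection is \<open>leaf \<I>\<close>.\<close>

definition reduced_symplectic_manifold ::
  "('a, 'e::euclidean_space) mfd \<Rightarrow> 'a form2 \<Rightarrow> ('a, 'e) fchart set \<Rightarrow>
   ('a set, 'f::euclidean_space) mfd \<Rightarrow> 'a set form2 \<Rightarrow> bool" where
  "reduced_symplectic_manifold M \<omega> \<I> Q \<omega>' \<longleftrightarrow>
     points Q = leaves M \<I> \<and>
     quotient_map (mtop M) (mtop Q) (leaf \<I>) \<and>
     submersion M Q (leaf \<I>) \<and>
     symplectic_manifold Q \<omega>' \<and>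
     (\<forall>x\<in>points M. \<forall>u\<in>tangent_space M x. \<forall>v\<in>tangent_space M x.
        \<omega>' (leaf \<I> x) (pushforward Q (leaf \<I>) u) (pushforward Q (leaf \<I>) v) = \<omega> x u v)"

section \<open>Linear connections\<close>

type_synonym 'a connection = "'a vfield \<Rightarrow> 'a vfield \<Rightarrow> 'a vfield"

definition linear_connection :: "('a, 'e::euclidean_space) mfd \<Rightarrow> 'a connection \<Rightarrow> bool" where
  "linear_connection M nab \<longleftrightarrow>
     (\<forall>X\<in>vector_fields M. \<forall>Y\<in>vector_fields M. nab X Y \<in> vector_fields M) \<and>
     (\<forall>X\<in>vector_fields M. \<forall>Y\<in>vector_fields M. \<forall>Z\<in>vector_fields M.
        nab (X + Y) Z = nab X Z + nab Y Z \<and> nab X (Y + Z) = nab X Y + nab X Z) \<and>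
     (\<forall>X\<in>vector_fields M. \<forall>Y\<in>vector_fields M. \<forall>f\<in>smooth_functions M.
        nab (vf_scale f X) Y = vf_scale f (nab X Y) \<and>
        nab X (vf_scale f Y) = vf_scale (vf_apply X f) Y + vf_scale f (nab X Y))"

definition torsion :: "'a connection \<Rightarrow> 'a vfield \<Rightarrow> 'a vfield \<Rightarrow> 'a vfield" where
  "torsion nab X Y = nab X Y - nab Y X - lie_bracket X Y"

definition cov_deriv_form2 ::
  "'a connection \<Rightarrow> 'a form2 \<Rightarrow> 'a vfield \<Rightarrow> 'a vfield \<Rightarrow> 'a vfield \<Rightarrow> 'a \<Rightarrow> real" where
  "cov_deriv_form2 nab \<omega> X Y Z x =
     X x (form2_apply \<omega> Y Z) - form2_apply \<omega> (nab X Y) Z x - form2_apply \<omega> Y (nab X Z) x"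

definition parallel_form2 ::
  "('a, 'e::euclidean_space) mfd \<Rightarrow> 'a connection \<Rightarrow> 'a form2 \<Rightarrow> bool" where
  "parallel_form2 M nab \<omega> \<longleftrightarrow>
     (\<forall>X\<in>vector_fields M. \<forall>Y\<in>vector_fields M. \<forall>Z\<in>vector_fields M. \<forall>x\<in>points M.
        cov_deriv_form2 nab \<omega> X Y Z x = 0)"

definition presymplectic_connection ::
  "('a, 'e::euclidean_space) mfd \<Rightarrow> 'a form2 \<Rightarrow> 'a connection \<Rightarrow> bool" where
  "presymplectic_connection M \<omega> nab \<longleftrightarrow>
     linear_connection M nab \<and> parallel_form2 M nab \<omega> \<and>
     (\<forall>X\<in>vector_fields M. \<forall>Y\<in>vector_fields M. \<forall>x\<in>points M.
        torsion nab X Y x \<in> form2_kernel M \<omega> x)"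

definition symplectic_connection ::
  "('a, 'e::euclidean_space) mfd \<Rightarrow> 'a form2 \<Rightarrow> 'a connection \<Rightarrow> bool" where
  "symplectic_connection M \<omega> nab \<longleftrightarrow>
     linear_connection M nab \<and> parallel_form2 M nab \<omega> \<and>
     (\<forall>X\<in>vector_fields M. \<forall>Y\<in>vector_fields M. torsion nab X Y = 0)"

definition adapted_connection ::
  "('a, 'e::euclidean_space) mfd \<Rightarrow> ('a, 'e) fchart set \<Rightarrow> 'a connection \<Rightarrow> bool" where
  "adapted_connection M \<F> nab \<longleftrightarrow>
     linear_connection M nab \<and>
     (\<forall>X\<in>tangential_fields M \<F>. \<forall>Y\<in>projectable_fields M \<F>. nab X Y \<in> tangential_fields M \<F>)"

definition projectable_connection ::
  "('a, 'e::euclidean_space) mfd \<Rightarrow> ('a, 'e) fchart set \<Rightarrow> 'a connection \<Rightarrow> bool" where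
  "projectable_connection M \<F> nab \<longleftrightarrow>
     adapted_connection M \<F> nab \<and>
     (\<forall>X\<in>projectable_fields M \<F>. \<forall>Y\<in>projectable_fields M \<F>. nab X Y \<in> projectable_fields M \<F>)"

text \<open>
  The formula \<open>\<nabla>'\<^bsub>X'\<^esub> Y' = \<pi>\<^sub>*(\<nabla>\<^bsub>X\<^esub> Y)\<close> is well defined and gives \<open>\<nabla>'\<close>: every vector field on \<open>Q\<close>
  has a projectable lift, and for all choices of projectable lifts \<open>X, Y\<close> the field \<open>\<nabla>\<^bsub>X\<^esub> Y\<close>
  projects to the same vector field \<open>\<nabla>'\<^bsub>X'\<^esub> Y'\<close>.
\<close>

definition induces_connection ::
  "('a, 'e::euclidean_space) mfd \<Rightarrow> ('a, 'e) fchart set \<Rightarrow>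
   ('b, 'f::euclidean_space) mfd \<Rightarrow> ('a \<Rightarrow> 'b) \<Rightarrow> 'a connection \<Rightarrow> 'b connection \<Rightarrow> bool" where
  "induces_connection M \<F> Q \<pi> nab nab' \<longleftrightarrow>
     linear_connection Q nab' \<and>
     (\<forall>X'\<in>vector_fields Q. \<exists>X\<in>projectable_fields M \<F>. vf_projects_to M Q \<pi> X X') \<and>
     (\<forall>X'\<in>vector_fields Q. \<forall>Y'\<in>vector_fields Q.
        \<forall>X\<in>projectable_fields M \<F>. \<forall>Y\<in>projectable_fields M \<F>.
          vf_projects_to M Q \<pi> X X' \<and> vf_projects_to M Q \<pi> Y Y' \<longrightarrow>
          vf_projects_to M Q \<pi> (nab X Y) (nab' X' Y'))"

end

(* Vector fields on Q have global lifts to M: locally by Gauss-Jordan elimination on a frame whose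
   projection is dual to coordinate functions at one point, globally by gluing with bump functions.
   Since omega' is nondegenerate, the vectors killed by the projection are those tangent to the
   leaves, so all lifts are projectable.  Conversely, a smooth function on M that is annihilated by
   the tangential fields is constant on plaques, hence on leaves, and descends to a smooth function on
   Q: it is differentiable by the inverse function theorem, and its derivative along a coordinate
   field is the descent of the derivative along a lift, so one can iterate.  Hence projectable fields
   descend as well.  The connection on Q is obtained by lifting both arguments; independence of the
   lift of the second argument uses that the torsion is tangential. *)

theory Submission
  imports Defs
begin

section \<open>Calculus of smooth maps\<close>

text \<open>Tangent vectors are derivations of the algebra of globally defined smooth functions, so
  nothing local is available at the outset. Bump functions show that a derivation depends only on
  germs, and Hadamard's lemma that it is a directional derivative in a chart; all computations in
  coordinates rest on these two facts. The Hausdorff axiom enters where a compact coordinate ball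
  must be closed in \<open>M\<close>, so that a bump function can be extended by 0; second
  countability enters where countably many local lifts are glued.

  No chart adapted to both the leaves and the projection is constructed. The inverse function
  theorem therefore serves only for the first derivative of a descended function, one point at a
  time; higher derivatives come from the fact that derivatives along lifts are again constant on
  leaves.

  Dimension 0 is a case of its own: chart images lie in \<open>{0}\<close>, where derivatives are
  not unique, while all tangent spaces vanish.\<close>

lemma Ck_on_cong:
  assumes "Ck_on k S f" "\<And>x. x \<in> S \<Longrightarrow> f x = g x"
  shows "Ck_on k S g"
  using assms
proof (induction k arbitrary: f g)
  case 0
  then show ?case by (simp cong: continuous_on_cong)
next
  case (Suc k)
  have iff: "(f has_derivative f') (at x within S) \<longleftrightarrow> (g has_derivative f') (at x within S)"
    if "x \<in> S" for x f'
    using Suc.prems(2) that by (metis has_derivative_transform)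
  \<comment> \<open>\<open>frechet_derivative\<close> is a choice over the predicate
    \<open>has_derivative\<close>. The predicate is the same for \<open>f\<close> and
    \<open>g\<close>, so the choices agree even where \<open>S\<close> does not determine a
    derivative.\<close>
  have "frechet_derivative f (at x within S) = frechet_derivative g (at x within S)"
    if "x \<in> S" for x
    unfolding frechet_derivative_def using iff[OF that] by simp
  then have D: "Ck_on k S (\<lambda>x. frechet_derivative g (at x within S) v)" for v
    using Suc.IH[of "\<lambda>x. frechet_derivative f (at x within S) v"] Suc.prems(1) by simp
  have "g differentiable_on S"
    using Suc.prems(1) iff unfolding differentiable_on_def differentiable_def Ck_on.simps by blast
  with D show ?case by simp
qed

text \<open>On open sets the derivative within \<open>S\<close> is unique, so any explicit
  derivative may replace the chosen one. With the converse \<open>Ck_on_SucD\<close> this reduces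
  each closure property below to a differentiation rule and an induction.\<close>

lemma Ck_on_SucI:
  assumes "open S" "\<And>x. x \<in> S \<Longrightarrow> (f has_derivative f' x) (at x)"
    and "\<And>v. Ck_on k S (\<lambda>x. f' x v)"
  shows "Ck_on (Suc k) S f"
proof -
  have "f differentiable_on S"
    unfolding differentiable_on_def using assms(2) differentiableI differentiable_at_withinI by blast
  moreover
  have "f' x = frechet_derivative f (at x within S)" if "x \<in> S" for x
    unfolding at_within_open[OF that assms(1)] by (rule frechet_derivative_at[OF assms(2)[OF that]])
  then have "Ck_on k S (\<lambda>x. frechet_derivative f (at x within S) v)" for v
    by (intro Ck_on_cong[OF assms(3)[of v]]) simp
  ultimately show ?thesis by simp
qed

lemma Ck_on_SucD:
  assumes "open S" "Ck_on (Suc k) S f"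
  shows "x \<in> S \<Longrightarrow> (f has_derivative frechet_derivative f (at x)) (at x)"
    and "Ck_on k S (\<lambda>x. frechet_derivative f (at x) v)"
proof -
  show "(f has_derivative frechet_derivative f (at x)) (at x)" if "x \<in> S"
    using assms(2) that at_within_open[OF that assms(1)]
    by (auto simp: differentiable_on_def frechet_derivative_works[symmetric])
  have "Ck_on k S (\<lambda>x. frechet_derivative f (at x within S) v)"
    using assms(2) by simp
  then show "Ck_on k S (\<lambda>x. frechet_derivative f (at x) v)"
    by (rule Ck_on_cong) (metis assms(1) at_within_open)
qed

lemma Ck_on_imp_continuous_on:
  assumes "Ck_on k S f"
  shows "continuous_on S f"
  using assms by (cases k) (auto simp: differentiable_imp_continuous_on)

lemma Ck_on_Suc_imp:
  assumes "open S" "Ck_on (Suc k) S f"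
  shows "Ck_on k S f"
  using assms(2)
proof (induction k arbitrary: f)
  case 0
  then show ?case by (auto simp: differentiable_imp_continuous_on)
next
  case (Suc k)
  show ?case
    by (rule Ck_on_SucI[OF assms(1) Ck_on_SucD(1)[OF assms(1) Suc.prems]])
      (auto intro: Suc.IH Ck_on_SucD(2)[OF assms(1) Suc.prems])
qed

lemma Ck_on_subset:
  assumes "Ck_on k S f" "open S" "open T" "T \<subseteq> S"
  shows "Ck_on k T f"
  using assms(1)
proof (induction k arbitrary: f)
  case 0
  then show ?case using assms(4) continuous_on_subset by auto
next
  case (Suc k)
  show ?case
    by (rule Ck_on_SucI[OF assms(3) Ck_on_SucD(1)[OF assms(2) Suc.prems]])
      (use assms(4) in \<open>auto intro: Suc.IH Ck_on_SucD(2)[OF assms(2) Suc.prems]\<close>)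
qed

lemma Ck_on_local:
  assumes "open S" "\<And>x. x \<in> S \<Longrightarrow> \<exists>T. open T \<and> x \<in> T \<and> Ck_on k T f"
  shows "Ck_on k S f"
  using assms(2)
proof (induction k arbitrary: f)
  case 0
  have "isCont f x" if "x \<in> S" for x
    using 0[OF that] continuous_on_eq_continuous_at by auto
  then show ?case
    by (simp add: continuous_at_imp_continuous_on)
next
  case (Suc k)
  show ?case
  proof (rule Ck_on_SucI[OF assms(1)])
    show "(f has_derivative frechet_derivative f (at x)) (at x)" if "x \<in> S" for x
      using Suc.prems[OF that] Ck_on_SucD(1) by blast
    show "Ck_on k S (\<lambda>x. frechet_derivative f (at x) v)" for v
    proof (rule Suc.IH)
      show "\<exists>T. open T \<and> x \<in> T \<and> Ck_on k T (\<lambda>x. frechet_derivative f (at x) v)"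
        if "x \<in> S" for x
        using Suc.prems[OF that] Ck_on_SucD(2) by blast
    qed
  qed
qed

lemma Ck_on_const:
  assumes "open S"
  shows "Ck_on k S (\<lambda>_. c)"
proof (induction k arbitrary: c)
  case (Suc k)
  show ?case
    by (rule Ck_on_SucI[OF assms has_derivative_const]) (rule Suc.IH)
qed simp

lemma Ck_on_bounded_linear:
  assumes "open S" "bounded_linear L" "Ck_on k S f"
  shows "Ck_on k S (\<lambda>x. L (f x))"
  using assms(3)
proof (induction k arbitrary: f)
  case 0
  then show ?case using assms(2) by (auto intro: bounded_linear.continuous_on)
next
  case (Suc k)
  show ?case
    by (rule Ck_on_SucI[OF assms(1) bounded_linear.has_derivative[OF assms(2)
          Ck_on_SucD(1)[OF assms(1) Suc.prems]]])
      (auto intro: Suc.IH Ck_on_SucD(2)[OF assms(1) Suc.prems])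
qed

lemma Ck_on_id:
  assumes "open S"
  shows "Ck_on k S (\<lambda>x. x)"
proof (cases k)
  case (Suc j)
  show ?thesis
    unfolding Suc by (rule Ck_on_SucI[OF assms has_derivative_ident]) (rule Ck_on_const[OF assms])
qed simp

lemma Ck_on_add:
  assumes "open S" "Ck_on k S f" "Ck_on k S g"
  shows "Ck_on k S (\<lambda>x. f x + g x)"
  using assms(2,3)
proof (induction k arbitrary: f g)
  case 0
  then show ?case by (auto intro: continuous_intros)
next
  case (Suc k)
  show ?case
    by (rule Ck_on_SucI[OF assms(1) has_derivative_add[OF
          Ck_on_SucD(1)[OF assms(1) Suc.prems(1)] Ck_on_SucD(1)[OF assms(1) Suc.prems(2)]]])
      (assumption | intro Suc.IH Ck_on_SucD(2)[OF assms(1) Suc.prems(1)]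
        Ck_on_SucD(2)[OF assms(1) Suc.prems(2)])+
qed

lemma Ck_on_sum:
  assumes "open S" "\<And>i. i \<in> I \<Longrightarrow> Ck_on k S (f i)"
  shows "Ck_on k S (\<lambda>x. \<Sum>i\<in>I. f i x)"
  using assms(2)
  by (induction I rule: infinite_finite_induct) (auto intro: Ck_on_const Ck_on_add assms(1))

text \<open>The product rule pairs the derivative of one factor with the other factor itself, hence
  the appeal to \<open>Ck_on_Suc_imp\<close>. The vector-valued second factor is what the chain rule
  in \<open>Ck_on_compose\<close> requires.\<close>

lemma Ck_on_scaleR:
  fixes f :: "'e::euclidean_space \<Rightarrow> real"
  assumes "open S" "Ck_on k S f" "Ck_on k S g"
  shows "Ck_on k S (\<lambda>x. f x *\<^sub>R g x)"
  using assms(2,3)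
proof (induction k arbitrary: f g)
  case 0
  then show ?case by (auto intro: continuous_intros)
next
  case (Suc k)
  show ?case
    by (rule Ck_on_SucI[OF assms(1) has_derivative_scaleR[OF
          Ck_on_SucD(1)[OF assms(1) Suc.prems(1)] Ck_on_SucD(1)[OF assms(1) Suc.prems(2)]]])
      (assumption | intro Ck_on_add assms(1) Suc.IH Ck_on_SucD(2)[OF assms(1) Suc.prems(1)]
        Ck_on_SucD(2)[OF assms(1) Suc.prems(2)] Ck_on_Suc_imp[OF assms(1) Suc.prems(1)]
        Ck_on_Suc_imp[OF assms(1) Suc.prems(2)])+
qed

lemma Ck_on_mult:
  fixes f g :: "'e::euclidean_space \<Rightarrow> real"
  assumes "open S" "Ck_on k S f" "Ck_on k S g"
  shows "Ck_on k S (\<lambda>x. f x * g x)"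
  using Ck_on_scaleR[OF assms] by simp

text \<open>The derivative of \<open>g \<circ> f\<close> along \<open>v\<close> is a sum of products of derivatives of \<open>f\<close> with
  derivatives of \<open>g\<close> along basis vectors composed with \<open>f\<close>, so the induction closes.\<close>

lemma Ck_on_compose:
  fixes f :: "'e::euclidean_space \<Rightarrow> 'f::euclidean_space"
  assumes "open S" "open T" "Ck_on k S f" "Ck_on k T g" "\<And>x. x \<in> S \<Longrightarrow> f x \<in> T"
  shows "Ck_on k S (\<lambda>x. g (f x))"
  using assms(3,4)
proof (induction k arbitrary: g)
  case 0
  then show ?case using assms(5) by (auto intro: continuous_on_compose2)
next
  case (Suc k)
  let ?Df = "\<lambda>x. frechet_derivative f (at x)" and ?Dg = "\<lambda>y. frechet_derivative g (at y)"
  note f = Ck_on_SucD[OF assms(1) Suc.prems(1)]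
  note g = Ck_on_SucD[OF assms(2) Suc.prems(2)]
  have lin: "linear (?Dg (f x))" if "x \<in> S" for x
    using g(1)[OF assms(5)[OF that]] has_derivative_linear by blast
  show ?case
  proof (rule Ck_on_SucI[OF assms(1)])
    show "((\<lambda>x. g (f x)) has_derivative (\<lambda>v. ?Dg (f x) (?Df x v))) (at x)" if "x \<in> S" for x
      using has_derivative_compose[OF f(1)[OF that] g(1)[OF assms(5)[OF that]]] .
    have "Ck_on k S (\<lambda>x. \<Sum>b\<in>Basis. (?Df x v \<bullet> b) *\<^sub>R ?Dg (f x) b)" for v
      by (intro Ck_on_sum Ck_on_scaleR assms(1) Suc.IH g(2) Ck_on_Suc_imp[OF assms(1) Suc.prems(1)]
          Ck_on_bounded_linear[OF assms(1) bounded_linear_inner_left] f(2))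
    then show "Ck_on k S (\<lambda>x. ?Dg (f x) (?Df x v))" for v
    proof (rule Ck_on_cong)
      fix x assume "x \<in> S"
      have "?Dg (f x) (?Df x v) = ?Dg (f x) (\<Sum>b\<in>Basis. (?Df x v \<bullet> b) *\<^sub>R b)"
        by (simp add: euclidean_representation)
      also have "\<dots> = (\<Sum>b\<in>Basis. (?Df x v \<bullet> b) *\<^sub>R ?Dg (f x) b)"
        using lin[OF \<open>x \<in> S\<close>] by (simp add: linear_sum linear_cmul o_def)
      finally show "(\<Sum>b\<in>Basis. (?Df x v \<bullet> b) *\<^sub>R ?Dg (f x) b) = ?Dg (f x) (?Df x v)" ..
    qed
  qed
qed

text \<open>The derivative of \<open>inverse\<close> is a product of copies of
  \<open>inverse\<close> and a constant, so the product rule alone carries the induction.\<close>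

lemma Ck_on_inverse: "Ck_on k (- {0::real}) inverse"
proof (induction k)
  case 0
  show ?case by (auto intro!: continuous_intros)
next
  case (Suc k)
  have op: "open (- {0::real})" by auto
  have "Ck_on k (- {0::real}) (\<lambda>x. - (inverse x * v * inverse x))" for v
    using Ck_on_bounded_linear[OF op bounded_linear_mult_left[of "- v"] Ck_on_mult[OF op Suc Suc]]
    by (simp add: algebra_simps)
  then show ?case
    by (rule Ck_on_SucI[OF op has_derivative_inverse', rotated]) simp
qed

subsection \<open>Smooth functions\<close>

lemma smooth_on_cong:
  "smooth_on S f \<Longrightarrow> (\<And>x. x \<in> S \<Longrightarrow> f x = g x) \<Longrightarrow> smooth_on S g"
  unfolding smooth_on_def by (blast intro: Ck_on_cong)

lemma smooth_on_subset:
  "smooth_on S f \<Longrightarrow> open S \<Longrightarrow> open T \<Longrightarrow> T \<subseteq> S \<Longrightarrow> smooth_on T f"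
  unfolding smooth_on_def by (blast intro: Ck_on_subset)

lemma smooth_on_local:
  assumes "open S" "\<And>x. x \<in> S \<Longrightarrow> \<exists>T. open T \<and> x \<in> T \<and> smooth_on T f"
  shows "smooth_on S f"
  unfolding smooth_on_def
proof
  fix k
  show "Ck_on k S f"
    by (rule Ck_on_local[OF assms(1)]) (use assms(2) smooth_on_def in blast)
qed

lemma smooth_on_const: "open S \<Longrightarrow> smooth_on S (\<lambda>_. c)"
  unfolding smooth_on_def by (blast intro: Ck_on_const)

lemma smooth_on_id: "open S \<Longrightarrow> smooth_on S (\<lambda>x. x)"
  unfolding smooth_on_def by (blast intro: Ck_on_id)

lemma smooth_on_bounded_linear:
  "open S \<Longrightarrow> bounded_linear L \<Longrightarrow> smooth_on S f \<Longrightarrow> smooth_on S (\<lambda>x. L (f x))"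
  unfolding smooth_on_def by (blast intro: Ck_on_bounded_linear)

lemma smooth_on_add:
  "open S \<Longrightarrow> smooth_on S f \<Longrightarrow> smooth_on S g \<Longrightarrow> smooth_on S (\<lambda>x. f x + g x)"
  unfolding smooth_on_def by (blast intro: Ck_on_add)

lemma smooth_on_sum:
  "open S \<Longrightarrow> (\<And>i. i \<in> I \<Longrightarrow> smooth_on S (f i)) \<Longrightarrow> smooth_on S (\<lambda>x. \<Sum>i\<in>I. f i x)"
  unfolding smooth_on_def by (blast intro: Ck_on_sum)

lemma smooth_on_mult:
  fixes f g :: "'e::euclidean_space \<Rightarrow> real"
  shows "open S \<Longrightarrow> smooth_on S f \<Longrightarrow> smooth_on S g \<Longrightarrow> smooth_on S (\<lambda>x. f x * g x)"
  unfolding smooth_on_def by (blast intro: Ck_on_mult)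

lemma smooth_on_compose:
  fixes f :: "'e::euclidean_space \<Rightarrow> 'f::euclidean_space"
  shows "open S \<Longrightarrow> open T \<Longrightarrow> smooth_on S f \<Longrightarrow> smooth_on T g \<Longrightarrow> (\<And>x. x \<in> S \<Longrightarrow> f x \<in> T) \<Longrightarrow>
    smooth_on S (\<lambda>x. g (f x))"
  unfolding smooth_on_def by (blast intro: Ck_on_compose)

lemma smooth_on_inverse:
  fixes f :: "'e::euclidean_space \<Rightarrow> real"
  assumes "open S" "smooth_on S f" "\<And>x. x \<in> S \<Longrightarrow> f x \<noteq> 0"
  shows "smooth_on S (\<lambda>x. inverse (f x))"
proof (rule smooth_on_compose[OF assms(1) _ assms(2)])
  show "smooth_on (- {0::real}) inverse"
    unfolding smooth_on_def by (blast intro: Ck_on_inverse)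
qed (use assms(3) in auto)

lemma smooth_on_has_derivative:
  "open S \<Longrightarrow> smooth_on S f \<Longrightarrow> x \<in> S \<Longrightarrow> (f has_derivative frechet_derivative f (at x)) (at x)"
  unfolding smooth_on_def by (blast intro: Ck_on_SucD(1))

lemma smooth_on_frechet_derivative:
  "open S \<Longrightarrow> smooth_on S f \<Longrightarrow> smooth_on S (\<lambda>x. frechet_derivative f (at x) v)"
  unfolding smooth_on_def by (blast intro: Ck_on_SucD(2))

lemma smooth_on_imp_continuous_on: "smooth_on S f \<Longrightarrow> continuous_on S f"
  unfolding smooth_on_def by (blast intro: Ck_on_imp_continuous_on)

text \<open>Differentiation under the integral and the inverse function theorem need continuity in
  the operator norm; in finite dimension it follows from continuity on each basis vector.\<close>

lemma continuous_on_frechet_derivative_blinfun: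
  fixes f :: "'e::euclidean_space \<Rightarrow> 'f::euclidean_space"
  assumes "open S" "smooth_on S f"
  shows "continuous_on S (\<lambda>x. Blinfun (frechet_derivative f (at x)))"
proof (rule continuous_on_blinfun_componentwise)
  fix i :: 'e
  have "continuous_on S (\<lambda>x. frechet_derivative f (at x) i)"
    using assms by (intro smooth_on_imp_continuous_on smooth_on_frechet_derivative)
  moreover have "bounded_linear (frechet_derivative f (at x))" if "x \<in> S" for x
    using smooth_on_has_derivative[OF assms that] has_derivative_bounded_linear by blast
  ultimately show "continuous_on S (\<lambda>x. blinfun_apply (Blinfun (frechet_derivative f (at x))) i)"
    by (simp add: bounded_linear_Blinfun_apply cong: continuous_on_cong)
qed

subsection \<open>Bump functions\<close>

text \<open>The classical flat function exp(-1/t) is \<open>flat 0\<close>. The extra powers of 1/t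
  make the family closed under differentiation up to linear combinations, so smoothness is proved
  for all members in one induction.\<close>

definition flat :: "nat \<Rightarrow> real \<Rightarrow> real" where
  "flat n t = (if t > 0 then exp (- inverse t) * inverse t ^ n else 0)"

lemma flat_tendsto: "(flat n \<longlongrightarrow> 0) (at_right 0)"
proof -
  have "((\<lambda>u. u ^ n / exp u) \<longlongrightarrow> 0) (at_top :: real filter)"
    by (rule tendsto_power_div_exp_0)
  then have "((\<lambda>t. inverse t ^ n / exp (inverse t)) \<longlongrightarrow> 0) (at_right (0::real))"
    by (rule filterlim_compose) (rule filterlim_inverse_at_top_right)
  moreover have "\<forall>\<^sub>F t in at_right 0. inverse t ^ n / exp (inverse t) = flat n t"
    by (rule eventually_at_rightI[of 0 1]) (auto simp: flat_def exp_minus field_simps)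
  ultimately show ?thesis by (rule Lim_transform_eventually)
qed

lemma flat_has_derivative:
  "(flat n has_real_derivative (flat (n + 2) t - n * flat (n + 1) t)) (at t)"
proof -
  consider "t > 0" | "t < 0" | "t = 0" by linarith
  then show ?thesis
  proof cases
    case 1
    have "((\<lambda>t. exp (- inverse t) * inverse t ^ n) has_real_derivative
        (flat (n + 2) t - n * flat (n + 1) t)) (at t)"
    proof (cases n)
      case 0
      then show ?thesis
        using 1 by (auto intro!: derivative_eq_intros simp: flat_def power2_eq_square)
    next
      case (Suc m)
      then show ?thesis
        using 1 by (auto intro!: derivative_eq_intros simp: flat_def algebra_simps) (cases m; simp)
    qed
    then show ?thesis
      by (rule has_field_derivative_transform_within_open[of _ _ _ "{0<..}"])
        (use 1 in \<open>auto simp: flat_def\<close>)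
  next
    case 2
    have "((\<lambda>t. 0) has_real_derivative (flat (n + 2) t - n * flat (n + 1) t)) (at t)"
      using 2 by (auto simp: flat_def)
    then show ?thesis
      by (rule has_field_derivative_transform_within_open[of _ _ _ "{..<0}"])
        (use 2 in \<open>auto simp: flat_def\<close>)
  next
    case 3
    \<comment> \<open>The difference quotient at 0 is again a member of the family, so the
      derivative at 0 is the limit from \<open>flat_tendsto\<close>. Division by zero makes the
      identity hold at \<open>h = 0\<close> as well.\<close>
    have eq: "(flat n (0 + h) - flat n 0) / h = flat (n + 1) h" for h
      by (auto simp: flat_def field_simps)
    have left: "(flat (n + 1) \<longlongrightarrow> 0) (at_left 0)"
      by (rule Lim_transform_eventually[OF tendsto_const])
        (rule eventually_at_leftI[of "-1"], auto simp: flat_def)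
    have "(flat (n + 1) \<longlongrightarrow> 0) (at 0)"
      using left flat_tendsto by (rule filterlim_split_at)
    then show ?thesis
      unfolding 3 DERIV_def eq by (simp add: flat_def[of _ 0])
  qed
qed

lemma Ck_on_flat: "Ck_on k UNIV (flat n)"
proof (induction k arbitrary: n)
  case 0
  show ?case
    using flat_has_derivative[of n] by (auto intro!: DERIV_continuous_on)
next
  case (Suc k)
  show ?case
  proof (rule Ck_on_SucI)
    show "(flat n has_derivative (\<lambda>v. (flat (n + 2) t - n * flat (n + 1) t) * v)) (at t)" for t
      using flat_has_derivative[of n t] by (simp add: has_field_derivative_def)
    have "Ck_on k UNIV (\<lambda>t. (flat (n + 2) t + (- real n) * flat (n + 1) t) * v)" for v
      by (intro Ck_on_mult Ck_on_add Ck_on_const Suc.IH) auto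
    then show "Ck_on k UNIV (\<lambda>t. (flat (n + 2) t - n * flat (n + 1) t) * v)" for v
      by simp
  qed simp
qed

text \<open>With \<open>s\<close> the squared distance to \<open>c\<close>, \<open>a\<close> is
  positive exactly inside radius \<open>2 * r\<close> and \<open>b\<close> exactly outside radius
  \<open>r\<close>. They have no common zero, so a/(a + b) is smooth; it is 1 where \<open>b\<close>
  vanishes and 0 where \<open>a\<close> does.\<close>

lemma smooth_bump_exists:
  fixes c :: "'e::euclidean_space"
  assumes "r > 0"
  obtains \<rho> :: "'e \<Rightarrow> real"
  where "smooth_on UNIV \<rho>" "\<And>y. y \<in> ball c r \<Longrightarrow> \<rho> y = 1" "\<And>y. y \<notin> cball c (2 * r) \<Longrightarrow> \<rho> y = 0"
proof -
  define s where "s y = (y - c) \<bullet> (y - c)" for y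
  define a where "a y = flat 0 (4 * r\<^sup>2 - s y)" for y
  define b where "b y = flat 0 (s y - r\<^sup>2)" for y
  have "smooth_on UNIV (\<lambda>y. \<Sum>i\<in>Basis. (y \<bullet> i + - (c \<bullet> i)) * (y \<bullet> i + - (c \<bullet> i)))"
    by (intro smooth_on_sum smooth_on_mult smooth_on_add smooth_on_const
        smooth_on_bounded_linear[OF _ bounded_linear_inner_left smooth_on_id]) auto
  then have s: "smooth_on UNIV s"
    by (rule smooth_on_cong) (unfold s_def, subst (3) euclidean_inner, simp add: inner_diff_left)
  have flat: "smooth_on UNIV (flat 0)"
    by (simp add: smooth_on_def Ck_on_flat)
  have "smooth_on UNIV (\<lambda>y. flat 0 (4 * r\<^sup>2 + (-1) * s y))" "smooth_on UNIV (\<lambda>y. flat 0 (s y + (- r\<^sup>2)))"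
    by (intro smooth_on_compose[OF _ _ _ flat] smooth_on_add smooth_on_mult smooth_on_const s;
        simp)+
  then have a: "smooth_on UNIV a" and b: "smooth_on UNIV b"
    by (auto simp: a_def[abs_def] b_def[abs_def])
  have flat_pos: "flat 0 t > 0 \<longleftrightarrow> t > 0" "flat 0 t \<ge> 0" for t
    by (auto simp: flat_def)
  have "a y + b y \<noteq> 0" for y
  proof -
    have "4 * r\<^sup>2 - s y > 0 \<or> s y - r\<^sup>2 > 0"
      using assms zero_less_power[OF assms, of 2] by linarith
    then show ?thesis
      unfolding a_def b_def using flat_pos by (metis add_pos_nonneg add_nonneg_pos less_irrefl)
  qed
  then have smooth: "smooth_on UNIV (\<lambda>y. a y * inverse (a y + b y))"
    by (intro smooth_on_mult smooth_on_inverse smooth_on_add a b) auto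
  have s_norm: "s y = (dist c y)\<^sup>2" for y
    by (simp add: s_def dist_norm power2_norm_eq_inner norm_minus_commute[of c y])
  show ?thesis
  proof
    show "a y * inverse (a y + b y) = 1" if "y \<in> ball c r" for y
    proof -
      have "s y < r\<^sup>2"
        using that unfolding s_norm by (simp add: power_strict_mono)
      moreover have "s y < 4 * r\<^sup>2"
        using calculation zero_le_power2[of r] by linarith
      ultimately have "b y = 0" "a y > 0"
        by (auto simp: a_def b_def flat_def)
      then show ?thesis by simp
    qed
    show "a y * inverse (a y + b y) = 0" if "y \<notin> cball c (2 * r)" for y
    proof -
      have "(2 * r)\<^sup>2 < (dist c y)\<^sup>2"
        using that assms by (intro power_strict_mono) auto
      then have "a y = 0"
        by (simp add: a_def flat_def s_norm power_mult_distrib)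
      then show ?thesis by simp
    qed
  qed (rule smooth)
qed

subsection \<open>Hadamard's lemma\<close>

text \<open>Differentiating under the integral produces, by the chain rule, one more factor
  \<open>t\<close> and a derivative of \<open>f\<close>. The weight \<open>t ^ m\<close> with
  arbitrary \<open>m\<close> absorbs this factor, so the induction runs over \<open>m\<close> and
  \<open>f\<close> together.\<close>

lemma Ck_on_integral_ray:
  fixes f :: "'e::euclidean_space \<Rightarrow> real"
  assumes "open S" "convex S" "c \<in> S" "smooth_on S f"
  shows "Ck_on k S (\<lambda>y. integral {0..1} (\<lambda>t. t ^ m * f (c + t *\<^sub>R (y - c))))"
  using assms(4)
proof (induction k arbitrary: m f)
  have ray: "c + t *\<^sub>R (y - c) \<in> S" if "y \<in> S" "t \<in> {0..1}" for y t
    using that convexD_alt[OF assms(2,3) that(1), of t]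
    by (simp add: algebra_simps)
  \<comment> \<open>The codomain is arbitrary because this is applied both to \<open>f\<close> and
    to its derivative as a map into bounded operators.\<close>
  have cont: "continuous_on (S \<times> {0..1}) (\<lambda>(y, t). g (c + t *\<^sub>R (y - c)))"
    if "continuous_on S g" for g :: "'e \<Rightarrow> 'z::topological_space"
    unfolding split_beta
    by (rule continuous_on_compose2[OF that]) (use ray in \<open>auto intro!: continuous_intros\<close>)
  {
    case 0
    have "continuous_on (S \<times> {0..1}) (\<lambda>(y, t). t ^ m * f (c + t *\<^sub>R (y - c)))"
      using cont[OF smooth_on_imp_continuous_on[OF 0]] unfolding split_beta
      by (intro continuous_intros) auto
    then show ?case
      using integral_continuous_on_param[of S 0 1 "\<lambda>y t. t ^ m * f (c + t *\<^sub>R (y - c))"]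
      by simp
  next
    case (Suc k)
    define D where "D y = Blinfun (frechet_derivative f (at y))" for y
    have D: "blinfun_apply (D y) = frechet_derivative f (at y)" if "y \<in> S" for y
      unfolding D_def
      by (rule bounded_linear_Blinfun_apply[OF has_derivative_bounded_linear[OF
              smooth_on_has_derivative[OF assms(1) Suc.prems that]]])
    have contD: "continuous_on S D"
      unfolding D_def by (rule continuous_on_frechet_derivative_blinfun[OF assms(1) Suc.prems])
    define fx where "fx y t = t ^ Suc m *\<^sub>R D (c + t *\<^sub>R (y - c))" for y t
    have int: "((\<lambda>y. integral {0..1} (\<lambda>t. t ^ m * f (c + t *\<^sub>R (y - c)))) has_derivative
        blinfun_apply (integral {0..1} (fx y))) (at y)" if "y \<in> S" for y
    proof -
      have "((\<lambda>y. integral (cbox 0 1) (\<lambda>t. t ^ m * f (c + t *\<^sub>R (y - c)))) has_derivative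
          blinfun_apply (integral (cbox 0 1) (fx y))) (at y within S)"
      proof (rule leibniz_rule)
        fix y and t :: real assume "y \<in> S" "t \<in> cbox 0 1"
        then have z: "c + t *\<^sub>R (y - c) \<in> S" using ray by simp
        have lin: "linear (D (c + t *\<^sub>R (y - c)))"
          using bounded_linear.linear blinfun.bounded_linear_right by blast
        have "((\<lambda>y. t ^ m * f (c + t *\<^sub>R (y - c))) has_derivative
            (\<lambda>v. t ^ m * D (c + t *\<^sub>R (y - c)) (t *\<^sub>R v))) (at y)"
          unfolding D[OF z]
          by (rule has_derivative_mult_right, rule has_derivative_compose[of "\<lambda>y. c + t *\<^sub>R (y - c)"])
            (auto intro!: derivative_eq_intros smooth_on_has_derivative[OF assms(1) Suc.prems z])
        then show "((\<lambda>y. t ^ m * f (c + t *\<^sub>R (y - c))) has_derivative fx y t) (at y within S)"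
          using lin by (auto intro!: has_derivative_at_withinI
              simp: fx_def scaleR_blinfun.rep_eq linear_cmul algebra_simps)
      next
        fix y assume "y \<in> S"
        have "continuous_on {0..1} (\<lambda>t. f (c + t *\<^sub>R (y - c)))"
          by (rule continuous_on_compose2[OF smooth_on_imp_continuous_on[OF Suc.prems]])
            (use ray \<open>y \<in> S\<close> in \<open>auto intro!: continuous_intros\<close>)
        then show "(\<lambda>t. t ^ m * f (c + t *\<^sub>R (y - c))) integrable_on cbox 0 1"
          by (auto intro!: integrable_continuous_interval continuous_intros)
      next
        show "continuous_on (S \<times> cbox 0 1) (\<lambda>(y, t). fx y t)"
          using cont[OF contD] unfolding fx_def split_beta cbox_interval
          by (intro continuous_intros) auto
      qed (use that assms(2) in auto)
      then show ?thesis
        by (simp add: at_within_open[OF that assms(1)])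
    qed
    show ?case
    proof (rule Ck_on_SucI[OF assms(1) int])
      fix v
      show "Ck_on k S (\<lambda>y. blinfun_apply (integral {0..1} (fx y)) v)"
      proof (rule Ck_on_cong[OF Suc.IH[OF smooth_on_frechet_derivative[OF assms(1) Suc.prems]]])
        fix y assume "y \<in> S"
        have "continuous_on {0..1} (\<lambda>t. D (c + t *\<^sub>R (y - c)))"
          by (rule continuous_on_compose2[OF contD])
            (use ray \<open>y \<in> S\<close> in \<open>auto intro!: continuous_intros\<close>)
        then have "fx y integrable_on {0..1}"
          unfolding fx_def by (intro integrable_continuous_interval continuous_intros)
        then have "blinfun_apply (integral {0..1} (fx y)) v = integral {0..1} (\<lambda>t. fx y t v)"
          using integral_linear[of "fx y" "{0..1}" "\<lambda>L. blinfun_apply L v"]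
          by (simp add: o_def blinfun.bounded_linear_left)
        also have "\<dots> = integral {0..1}
            (\<lambda>t. t ^ Suc m * frechet_derivative f (at (c + t *\<^sub>R (y - c))) v)"
          using ray[OF \<open>y \<in> S\<close>]
          by (intro integral_cong) (simp add: fx_def D scaleR_blinfun.rep_eq del: power_Suc)
        finally show "integral {0..1} (\<lambda>t. t ^ Suc m * frechet_derivative f (at (c + t *\<^sub>R (y - c))) v)
            = blinfun_apply (integral {0..1} (fx y)) v" ..
      qed
    qed
  }
qed

text \<open>The fundamental theorem of calculus along the segment from \<open>c\<close> to
  \<open>y\<close> writes \<open>f y - f c\<close> as an integral of derivatives in direction
  \<open>y - c\<close>. Expanding this direction in the basis leaves \<open>g b\<close> as the mean
  of a partial derivative over the segment.\<close>

lemma hadamard: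
  fixes f :: "'e::euclidean_space \<Rightarrow> real"
  assumes "open S" "convex S" "c \<in> S" "smooth_on S f"
  obtains g where "\<And>b. smooth_on S (g b)" "\<And>b. g b c = frechet_derivative f (at c) b"
    "\<And>y. y \<in> S \<Longrightarrow> f y = f c + (\<Sum>b\<in>Basis. ((y - c) \<bullet> b) * g b y)"
proof
  \<comment> \<open>The factor \<open>t ^ 0\<close> only brings the integrand into the shape of
    \<open>Ck_on_integral_ray\<close>.\<close>
  define g where "g b y = integral {0..1} (\<lambda>t. t ^ 0 * frechet_derivative f (at (c + t *\<^sub>R (y - c))) b)"
    for b y
  show "smooth_on S (g b)" for b
    unfolding smooth_on_def g_def
    using Ck_on_integral_ray[OF assms(1-3) smooth_on_frechet_derivative[OF assms(1,4)]] by blast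
  show "g b c = frechet_derivative f (at c) b" for b
    by (simp add: g_def)
  fix y assume "y \<in> S"
  have ray: "c + t *\<^sub>R (y - c) \<in> S" if "t \<in> {0..1}" for t
    using that convexD_alt[OF assms(2,3) \<open>y \<in> S\<close>, of t] by (simp add: algebra_simps)
  let ?D = "\<lambda>t. frechet_derivative f (at (c + t *\<^sub>R (y - c)))"
  have "((\<lambda>t. f (c + t *\<^sub>R (y - c))) has_vector_derivative ?D t (y - c)) (at t within {0..1})"
    if "t \<in> {0..1}" for t
  proof -
    note d = smooth_on_has_derivative[OF assms(1,4) ray[OF that]]
    have "linear (?D t)" using d has_derivative_linear by blast
    moreover have "((\<lambda>t. f (c + t *\<^sub>R (y - c))) has_derivative (\<lambda>h. ?D t (h *\<^sub>R (y - c)))) (at t)"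
      by (rule has_derivative_compose[of "\<lambda>t. c + t *\<^sub>R (y - c)"])
        (auto intro!: derivative_eq_intros d)
    ultimately show ?thesis
      unfolding has_vector_derivative_def by (auto intro!: has_derivative_at_withinI simp: linear_cmul)
  qed
  then have "((\<lambda>t. ?D t (y - c)) has_integral (f (c + 1 *\<^sub>R (y - c)) - f (c + 0 *\<^sub>R (y - c)))) {0..1}"
    by (intro fundamental_theorem_of_calculus) auto
  then have "f y - f c = integral {0..1} (\<lambda>t. ?D t (y - c))"
    by (simp add: integral_unique)
  also have "\<dots> = integral {0..1} (\<lambda>t. \<Sum>b\<in>Basis. ((y - c) \<bullet> b) * ?D t b)"
  proof (rule integral_cong)
    fix t :: real assume "t \<in> {0..1}"
    then have lin: "linear (?D t)"
      using smooth_on_has_derivative[OF assms(1,4) ray] has_derivative_linear by blast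
    have "?D t (y - c) = ?D t (\<Sum>b\<in>Basis. ((y - c) \<bullet> b) *\<^sub>R b)"
      by (simp add: euclidean_representation)
    also have "\<dots> = (\<Sum>b\<in>Basis. ((y - c) \<bullet> b) * ?D t b)"
      using lin by (simp add: linear_sum linear_cmul)
    finally show "?D t (y - c) = (\<Sum>b\<in>Basis. ((y - c) \<bullet> b) * ?D t b)" .
  qed
  also have "\<dots> = (\<Sum>b\<in>Basis. integral {0..1} (\<lambda>t. ((y - c) \<bullet> b) * ?D t b))"
  proof (rule integral_sum)
    fix b :: 'e
    have "continuous_on {0..1} (\<lambda>t. ?D t b)"
      by (rule continuous_on_compose2[OF smooth_on_imp_continuous_on[OF
            smooth_on_frechet_derivative[OF assms(1,4)]]])
        (use ray in \<open>auto intro!: continuous_intros\<close>)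
    then show "(\<lambda>t. ((y - c) \<bullet> b) * ?D t b) integrable_on {0..1}"
      by (intro integrable_continuous_interval continuous_intros)
  qed simp
  also have "\<dots> = (\<Sum>b\<in>Basis. ((y - c) \<bullet> b) * g b y)"
    by (simp add: g_def)
  finally show "f y = f c + (\<Sum>b\<in>Basis. ((y - c) \<bullet> b) * g b y)" by simp
qed

section \<open>Smooth manifolds of positive dimension\<close>

text \<open>Nonzero dimension makes \<open>model_space\<close> the whole type, so chart images are
  open and derivatives within them are ordinary derivatives.\<close>

locale pos_manifold =
  fixes M :: "('a, 'e::euclidean_space) mfd"
  assumes smooth_manifold: "smooth_manifold M"
    and dim_pos: "mdim M \<noteq> 0"
begin

lemma atlas_charts: "c \<in> atlas M \<Longrightarrow> c \<in> charts M"
  using smooth_manifold by (auto simp: smooth_manifold_def)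

lemma atlas_cover: "x \<in> points M \<Longrightarrow> \<exists>U \<phi>. (U, \<phi>) \<in> atlas M \<and> x \<in> U"
  using smooth_manifold unfolding smooth_manifold_def by blast

lemma chartD:
  assumes "(U, \<phi>) \<in> charts M"
  shows chart_openin: "openin (mtop M) U"
    and chart_open_image: "open (\<phi> ` U)"
    and chart_homeo: "homeomorphic_map (subtopology (mtop M) U) (top_of_set (\<phi> ` U)) \<phi>"
    and chart_inj: "inj_on \<phi> U"
    and chart_subset: "U \<subseteq> points M"
proof -
  show op: "openin (mtop M) U"
    and h: "homeomorphic_map (subtopology (mtop M) U) (top_of_set (\<phi> ` U)) \<phi>"
    and "open (\<phi> ` U)"
    using assms dim_pos by (auto simp: charts_def model_space_def)
  show U: "U \<subseteq> points M" using op openin_subset by blast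
  show "inj_on \<phi> U"
    using homeomorphic_imp_injective_map[OF h] U by (simp add: inf_absorb2)
qed

lemma chart_inv: "(U, \<phi>) \<in> charts M \<Longrightarrow> x \<in> U \<Longrightarrow> inv_into U \<phi> (\<phi> x) = x"
  using chart_inj inv_into_f_f by metis

lemma chart_open_map:
  assumes "(U, \<phi>) \<in> charts M" "openin (mtop M) W" "W \<subseteq> U"
  shows "open (\<phi> ` W)"
proof -
  have "openin (top_of_set (\<phi> ` U)) (\<phi> ` W)"
    using homeomorphic_imp_open_map[OF chart_homeo[OF assms(1)]] assms(2,3)
    unfolding open_map_def openin_subtopology by (metis inf.absorb_iff1)
  then show ?thesis
    using chart_open_image[OF assms(1)] openin_open_trans by blast
qed

lemma chart_open_vimage:
  assumes "(U, \<phi>) \<in> charts M" "open T"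
  shows "openin (mtop M) {x \<in> U. \<phi> x \<in> T}"
proof -
  have "continuous_map (subtopology (mtop M) U) (top_of_set (\<phi> ` U)) \<phi>"
    using chart_homeo[OF assms(1)] homeomorphic_imp_continuous_map by blast
  moreover have "openin (top_of_set (\<phi> ` U)) (\<phi> ` U \<inter> T)"
    using assms(2) by (simp add: openin_open_Int)
  ultimately have "openin (subtopology (mtop M) U)
      {x \<in> topspace (subtopology (mtop M) U). \<phi> x \<in> \<phi> ` U \<inter> T}"
    by (rule openin_continuous_map_preimage)
  moreover have "{x \<in> topspace (subtopology (mtop M) U). \<phi> x \<in> \<phi> ` U \<inter> T} = {x \<in> U. \<phi> x \<in> T}"
    using chart_subset[OF assms(1)] by auto
  ultimately show ?thesis
    using chart_openin[OF assms(1)] openin_trans_full by metis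
qed

text \<open>Membership in \<open>charts\<close> only asserts compatibility with the given atlas, so
  near each point the transition is factored through an atlas chart.\<close>

lemma transition_smooth:
  assumes "(U, \<phi>) \<in> charts M" "(V, \<psi>) \<in> charts M"
  shows "smooth_on (\<phi> ` (U \<inter> V)) (\<psi> \<circ> inv_into U \<phi>)"
proof (rule smooth_on_local)
  show "open (\<phi> ` (U \<inter> V))"
    by (rule chart_open_map[OF assms(1) openin_Int]) (use assms chart_openin in auto)
  fix y assume "y \<in> \<phi> ` (U \<inter> V)"
  then obtain x where x: "x \<in> U" "x \<in> V" "y = \<phi> x" by auto
  obtain A \<eta> where A: "(A, \<eta>) \<in> atlas M" "x \<in> A"
    using atlas_cover chart_subset[OF assms(1)] x(1) by blast
  note A' = atlas_charts[OF A(1)]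
  let ?W = "U \<inter> V \<inter> A"
  have W: "openin (mtop M) ?W"
    using chart_openin[OF assms(1)] chart_openin[OF assms(2)] chart_openin[OF A'] by blast
  have op: "open (\<phi> ` ?W)" "open (\<eta> ` ?W)"
    by (auto intro!: chart_open_map[OF assms(1) W] chart_open_map[OF A' W])
  have "smooth_on (\<phi> ` (U \<inter> A)) (\<eta> \<circ> inv_into U \<phi>)" "smooth_on (\<eta> ` (V \<inter> A)) (\<psi> \<circ> inv_into A \<eta>)"
    using assms A(1) unfolding charts_def by auto
  then have s: "smooth_on (\<phi> ` ?W) (\<eta> \<circ> inv_into U \<phi>)" "smooth_on (\<eta> ` ?W) (\<psi> \<circ> inv_into A \<eta>)"
    by (auto elim!: smooth_on_subset intro!: op chart_open_map[OF assms(1)] chart_open_map[OF A']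
        openin_Int chart_openin[OF assms(1)] chart_openin[OF assms(2)] chart_openin[OF A'])
  have "smooth_on (\<phi> ` ?W) (\<lambda>y. (\<psi> \<circ> inv_into A \<eta>) ((\<eta> \<circ> inv_into U \<phi>) y))"
    by (rule smooth_on_compose[OF op s]) (auto simp: chart_inv[OF assms(1)])
  then have "smooth_on (\<phi> ` ?W) (\<psi> \<circ> inv_into U \<phi>)"
    by (rule smooth_on_cong) (auto simp: chart_inv[OF assms(1)] chart_inv[OF A'])
  then show "\<exists>T. open T \<and> y \<in> T \<and> smooth_on T (\<psi> \<circ> inv_into U \<phi>)"
    using op(1) x A(2) by blast
qed

text \<open>One chart of the maximal atlas and one neighbourhood suffice, so smoothness can be
  checked in whatever chart is at hand; \<open>smooth_at_chart\<close> transfers it to any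
  other.\<close>

definition smooth_at :: "('a \<Rightarrow> real) \<Rightarrow> 'a \<Rightarrow> bool" where
  "smooth_at f x \<longleftrightarrow> (\<exists>U \<phi> W. (U, \<phi>) \<in> charts M \<and> openin (mtop M) W \<and> x \<in> W \<and> W \<subseteq> U \<and>
     smooth_on (\<phi> ` W) (f \<circ> inv_into U \<phi>))"

lemma smooth_at_chart:
  assumes "smooth_at f x" "(V, \<psi>) \<in> charts M" "x \<in> V"
  obtains W where "openin (mtop M) W" "x \<in> W" "W \<subseteq> V" "smooth_on (\<psi> ` W) (f \<circ> inv_into V \<psi>)"
proof -
  obtain U \<phi> W where U: "(U, \<phi>) \<in> charts M" and W: "openin (mtop M) W" "x \<in> W" "W \<subseteq> U"
    and f: "smooth_on (\<phi> ` W) (f \<circ> inv_into U \<phi>)"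
    using assms(1) smooth_at_def by blast
  let ?W = "V \<inter> W"
  have W': "openin (mtop M) ?W" using W(1) chart_openin[OF assms(2)] by blast
  have op: "open (\<psi> ` ?W)" "open (\<phi> ` W)" "open (\<psi> ` (V \<inter> U))"
    using W U by (auto intro!: chart_open_map[OF assms(2) W'] chart_open_map[OF U W(1)]
        chart_open_map[OF assms(2)] chart_openin[OF U] chart_openin[OF assms(2)])
  have "smooth_on (\<psi> ` ?W) (\<phi> \<circ> inv_into V \<psi>)"
    using transition_smooth[OF assms(2) U] op(3,1) by (rule smooth_on_subset) (use W(3) in auto)
  then have "smooth_on (\<psi> ` ?W) (\<lambda>y. (f \<circ> inv_into U \<phi>) ((\<phi> \<circ> inv_into V \<psi>) y))"
    by (rule smooth_on_compose[OF op(1,2) _ f]) (auto simp: chart_inv[OF assms(2)])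
  then have "smooth_on (\<psi> ` ?W) (f \<circ> inv_into V \<psi>)"
    by (rule smooth_on_cong) (use W(3) in \<open>auto simp: chart_inv[OF assms(2)] chart_inv[OF U]\<close>)
  then show ?thesis using that W' W(2) assms(3) by blast
qed

lemma smooth_at_cong:
  assumes "smooth_at f x" "openin (mtop M) W" "x \<in> W" "\<And>y. y \<in> W \<Longrightarrow> f y = g y"
  shows "smooth_at g x"
proof -
  obtain U \<phi> W' where U: "(U, \<phi>) \<in> charts M" and W: "openin (mtop M) W'" "x \<in> W'" "W' \<subseteq> U"
    and f: "smooth_on (\<phi> ` W') (f \<circ> inv_into U \<phi>)"
    using assms(1) smooth_at_def by blast
  have op: "openin (mtop M) (W \<inter> W')" using W assms by blast
  have "smooth_on (\<phi> ` (W \<inter> W')) (f \<circ> inv_into U \<phi>)"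
    using f chart_open_map[OF U W(1,3)] chart_open_map[OF U op]
    by (rule smooth_on_subset) (use W in auto)
  then have "smooth_on (\<phi> ` (W \<inter> W')) (g \<circ> inv_into U \<phi>)"
    by (rule smooth_on_cong) (use W(3) assms(4) in \<open>auto simp: chart_inv[OF U] subset_iff\<close>)
  then show ?thesis
    unfolding smooth_at_def using U op W assms(3) by blast
qed

lemma smooth_functionsI:
  assumes "\<And>x. x \<in> points M \<Longrightarrow> smooth_at f x"
  shows "f \<in> smooth_functions M"
  unfolding smooth_functions_def
proof (clarify)
  fix U \<phi> assume "(U, \<phi>) \<in> atlas M"
  note U = atlas_charts[OF this]
  show "smooth_on (\<phi> ` U) (f \<circ> inv_into U \<phi>)"
  proof (rule smooth_on_local[OF chart_open_image[OF U]])
    fix y assume "y \<in> \<phi> ` U"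
    then obtain x where x: "x \<in> U" "y = \<phi> x" by auto
    then obtain W where "openin (mtop M) W" "x \<in> W" "W \<subseteq> U" "smooth_on (\<phi> ` W) (f \<circ> inv_into U \<phi>)"
      using smooth_at_chart[OF assms U x(1)] chart_subset[OF U] by blast
    then show "\<exists>T. open T \<and> y \<in> T \<and> smooth_on T (f \<circ> inv_into U \<phi>)"
      using chart_open_map[OF U] x(2) by blast
  qed
qed

lemma smooth_functions_smooth_at:
  assumes "f \<in> smooth_functions M" "x \<in> points M"
  shows "smooth_at f x"
proof -
  obtain U \<phi> where U: "(U, \<phi>) \<in> atlas M" "x \<in> U" using atlas_cover[OF assms(2)] by blast
  then have "smooth_on (\<phi> ` U) (f \<circ> inv_into U \<phi>)"
    using assms(1) by (auto simp: smooth_functions_def)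
  then show ?thesis
    unfolding smooth_at_def using U atlas_charts chart_openin by blast
qed

lemma smooth_functions_chart:
  assumes "f \<in> smooth_functions M" "(U, \<phi>) \<in> charts M"
  shows "smooth_on (\<phi> ` U) (f \<circ> inv_into U \<phi>)"
proof (rule smooth_on_local[OF chart_open_image[OF assms(2)]])
  fix y assume "y \<in> \<phi> ` U"
  then obtain x where x: "x \<in> U" "y = \<phi> x" by auto
  then have "smooth_at f x"
    using smooth_functions_smooth_at[OF assms(1)] chart_subset[OF assms(2)] by blast
  then obtain W where "openin (mtop M) W" "x \<in> W" "W \<subseteq> U" "smooth_on (\<phi> ` W) (f \<circ> inv_into U \<phi>)"
    using smooth_at_chart[OF _ assms(2) x(1)] by blast
  then show "\<exists>T. open T \<and> y \<in> T \<and> smooth_on T (f \<circ> inv_into U \<phi>)"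
    using chart_open_map[OF assms(2)] x(2) by blast
qed

lemma smooth_functionsI_local:
  assumes "\<And>x. x \<in> points M \<Longrightarrow>
    \<exists>g\<in>smooth_functions M. \<exists>W. openin (mtop M) W \<and> x \<in> W \<and> (\<forall>y\<in>W. f y = g y)"
  shows "f \<in> smooth_functions M"
proof (rule smooth_functionsI)
  fix x assume x: "x \<in> points M"
  then obtain g W where "g \<in> smooth_functions M" "openin (mtop M) W" "x \<in> W" "\<forall>y\<in>W. f y = g y"
    using assms by blast
  then show "smooth_at f x"
    using smooth_at_cong[of g x W f] smooth_functions_smooth_at x by simp
qed

lemma smooth_functions_cong:
  assumes "f \<in> smooth_functions M" "\<And>x. x \<in> points M \<Longrightarrow> f x = g x"
  shows "g \<in> smooth_functions M"
proof (rule smooth_functionsI_local)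
  fix x assume "x \<in> points M"
  then show "\<exists>f\<in>smooth_functions M. \<exists>W. openin (mtop M) W \<and> x \<in> W \<and> (\<forall>y\<in>W. g y = f y)"
    using assms openin_topspace by (intro bexI[OF _ assms(1)] exI[of _ "points M"]) auto
qed

lemma atlas_open_image: "(U, \<phi>) \<in> atlas M \<Longrightarrow> open (\<phi> ` U)"
  using atlas_charts chart_open_image by blast

lemma smooth_functions_const: "(\<lambda>_. c) \<in> smooth_functions M"
  by (auto simp: smooth_functions_def o_def intro!: smooth_on_const atlas_open_image)

lemma smooth_functions_add:
  "f \<in> smooth_functions M \<Longrightarrow> g \<in> smooth_functions M \<Longrightarrow> (\<lambda>x. f x + g x) \<in> smooth_functions M"
  unfolding smooth_functions_def o_def by (fast intro: smooth_on_add atlas_open_image)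

lemma smooth_functions_mult:
  "f \<in> smooth_functions M \<Longrightarrow> g \<in> smooth_functions M \<Longrightarrow> (\<lambda>x. f x * g x) \<in> smooth_functions M"
  unfolding smooth_functions_def o_def by (fast intro: smooth_on_mult atlas_open_image)

lemma smooth_functions_cmult: "f \<in> smooth_functions M \<Longrightarrow> (\<lambda>x. c * f x) \<in> smooth_functions M"
  using smooth_functions_mult[OF smooth_functions_const] .

lemma smooth_functions_diff:
  "f \<in> smooth_functions M \<Longrightarrow> g \<in> smooth_functions M \<Longrightarrow> (\<lambda>x. f x - g x) \<in> smooth_functions M"
  using smooth_functions_add[OF _ smooth_functions_cmult[of g "-1"], of f] by simp

lemma smooth_functions_sum:
  "(\<And>i. i \<in> I \<Longrightarrow> f i \<in> smooth_functions M) \<Longrightarrow> (\<lambda>x. \<Sum>i\<in>I. f i x) \<in> smooth_functions M"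
  by (induction I rule: infinite_finite_induct)
    (auto intro: smooth_functions_const smooth_functions_add)

text \<open>Adding a flat function to \<open>f\<^sup>2\<close> that is positive where \<open>f = 0\<close> and vanishes near \<open>x\<close>
  makes \<open>f / f\<^sup>2\<close> globally smooth.\<close>

lemma smooth_functions_local_inverse:
  assumes f: "f \<in> smooth_functions M" and x: "x \<in> points M" "f x \<noteq> 0"
  obtains g W where "g \<in> smooth_functions M" "openin (mtop M) W" "x \<in> W"
    "\<And>y. y \<in> W \<Longrightarrow> g y * f y = 1"
proof -
  \<comment> \<open>Half of the square of \<open>f x\<close>: the flat correction vanishes wherever
    the square of \<open>f\<close> exceeds this value, an open condition that holds at
    \<open>x\<close>.\<close>
  define \<epsilon> where "\<epsilon> = f x * f x / 2"
  have \<epsilon>: "\<epsilon> > 0" using x(2) by (auto simp: \<epsilon>_def zero_less_mult_iff)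
  define d where "d y = f y * f y + flat 0 (\<epsilon> - f y * f y)" for y
  have flat_nonneg: "flat 0 t \<ge> 0" for t by (simp add: flat_def)
  have d_pos: "d y \<noteq> 0" for y
  proof (cases "f y = 0")
    case True
    then show ?thesis using \<epsilon> by (simp add: d_def flat_def)
  next
    case False
    then have "f y * f y > 0" by (auto simp: zero_less_mult_iff)
    then show ?thesis
      unfolding d_def using flat_nonneg by (metis add_pos_nonneg less_irrefl)
  qed
  have flat: "smooth_on UNIV (flat 0)"
    by (simp add: smooth_on_def Ck_on_flat)
  have "(\<lambda>y. f y * inverse (d y)) \<in> smooth_functions M"
    unfolding smooth_functions_def
  proof clarify
    fix U \<phi> assume U: "(U, \<phi>) \<in> atlas M"
    note op = atlas_open_image[OF U]
    let ?f = "f \<circ> inv_into U \<phi>"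
    have sf: "smooth_on (\<phi> ` U) ?f" using f U by (auto simp: smooth_functions_def)
    have nz: "?f z * ?f z + flat 0 (\<epsilon> + (-1) * (?f z * ?f z)) \<noteq> 0" for z
      using d_pos[of "inv_into U \<phi> z"] by (simp add: d_def)
    have "smooth_on (\<phi> ` U) (\<lambda>z. \<epsilon> + (-1) * (?f z * ?f z))"
      by (intro smooth_on_add smooth_on_mult smooth_on_const op sf)
    then have "smooth_on (\<phi> ` U) (\<lambda>z. flat 0 (\<epsilon> + (-1) * (?f z * ?f z)))"
      by (rule smooth_on_compose[OF op open_UNIV _ flat]) simp
    then have "smooth_on (\<phi> ` U) (\<lambda>z. ?f z * ?f z + flat 0 (\<epsilon> + (-1) * (?f z * ?f z)))"
      by (intro smooth_on_add smooth_on_mult op sf)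
    then have "smooth_on (\<phi> ` U) (\<lambda>z. ?f z * inverse (?f z * ?f z + flat 0 (\<epsilon> + (-1) * (?f z * ?f z))))"
      by (intro smooth_on_mult smooth_on_inverse op sf nz)
    then show "smooth_on (\<phi> ` U) ((\<lambda>y. f y * inverse (d y)) \<circ> inv_into U \<phi>)"
      by (simp add: o_def d_def)
  qed
  moreover
  obtain U \<phi> where U: "(U, \<phi>) \<in> charts M" "x \<in> U"
    using atlas_cover[OF x(1)] atlas_charts by blast
  let ?h = "\<lambda>z. (f \<circ> inv_into U \<phi>) z * (f \<circ> inv_into U \<phi>) z"
  define T where "T = \<phi> ` U \<inter> ?h -` {\<epsilon><..}"
  have "continuous_on (\<phi> ` U) ?h"
    by (intro continuous_intros smooth_on_imp_continuous_on smooth_functions_chart[OF f U(1)])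
  then have "open T"
    unfolding T_def by (rule continuous_open_preimage[OF _ chart_open_image[OF U(1)] open_greaterThan])
  then have "openin (mtop M) {y \<in> U. \<phi> y \<in> T}"
    by (rule chart_open_vimage[OF U(1)])
  moreover have "x \<in> {y \<in> U. \<phi> y \<in> T}"
    using U(2) \<epsilon> by (auto simp: T_def chart_inv[OF U(1)]) (auto simp: \<epsilon>_def)
  moreover have "f y * inverse (d y) * f y = 1" if "y \<in> {y \<in> U. \<phi> y \<in> T}" for y
  proof -
    have "f y * f y > \<epsilon>" using that chart_inv[OF U(1), of y] by (simp add: T_def)
    then have "d y = f y * f y" "f y \<noteq> 0" using \<epsilon> by (auto simp: d_def flat_def)
    then show ?thesis by (simp add: field_simps)
  qed
  ultimately show ?thesis by (rule that)
qed

text \<open>The function is transplanted from a chart and extended by 0. The closed set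
  \<open>C\<close> is recorded because its complement is then open, and there every product with the
  bump function is locally 0.\<close>

lemma bump_exists:
  assumes W: "openin (mtop M) W" "x \<in> W"
  obtains \<rho> W' C where "\<rho> \<in> smooth_functions M" "openin (mtop M) W'" "x \<in> W'" "W' \<subseteq> C"
    "\<And>y. y \<in> W' \<Longrightarrow> \<rho> y = 1" "closedin (mtop M) C" "C \<subseteq> W" "\<And>y. y \<notin> C \<Longrightarrow> \<rho> y = 0"
proof -
  have "x \<in> points M" using W openin_subset by blast
  then obtain U \<phi> where "(U, \<phi>) \<in> atlas M" and xU: "x \<in> U"
    using atlas_cover by blast
  note U = atlas_charts[OF this(1)]
  have op: "openin (mtop M) (W \<inter> U)" using W chart_openin[OF U] by blast
  have "open (\<phi> ` (W \<inter> U))" by (rule chart_open_map[OF U op]) simp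
  moreover have "\<phi> x \<in> \<phi> ` (W \<inter> U)" using W xU by blast
  ultimately obtain s where s: "s > 0" "cball (\<phi> x) s \<subseteq> \<phi> ` (W \<inter> U)"
    using open_contains_cball by metis
  \<comment> \<open>The bump function of radius \<open>r\<close> lives on the ball of radius
    \<open>2 * r\<close>, which must fit into the chart image of \<open>W\<close>.\<close>
  define r where "r = s / 2"
  have r: "r > 0" "cball (\<phi> x) (2 * r) \<subseteq> \<phi> ` (W \<inter> U)" using s by (auto simp: r_def)
  obtain \<beta> :: "'e \<Rightarrow> real" where \<beta>: "smooth_on UNIV \<beta>" "\<And>y. y \<in> ball (\<phi> x) r \<Longrightarrow> \<beta> y = 1"
    "\<And>y. y \<notin> cball (\<phi> x) (2 * r) \<Longrightarrow> \<beta> y = 0"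
    using smooth_bump_exists[OF r(1)] by metis
  define C where "C = {y \<in> U. \<phi> y \<in> cball (\<phi> x) (2 * r)}"
  define W' where "W' = {y \<in> U. \<phi> y \<in> ball (\<phi> x) r}"
  define \<rho> where "\<rho> y = (if y \<in> U then \<beta> (\<phi> y) else 0)" for y
  have CW: "C \<subseteq> W"
    unfolding C_def using r(2) chart_inj[OF U] by (auto dest: inj_onD)
  have C: "closedin (mtop M) C"
  proof -
    obtain \<psi> where \<psi>: "homeomorphic_maps (subtopology (mtop M) U) (top_of_set (\<phi> ` U)) \<phi> \<psi>"
      using chart_homeo[OF U] homeomorphic_map_maps by blast
    then have cont: "continuous_map (top_of_set (\<phi> ` U)) (subtopology (mtop M) U) \<psi>"
      and inv: "\<And>y. y \<in> U \<Longrightarrow> \<psi> (\<phi> y) = y"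
      using chart_subset[OF U] by (auto simp: homeomorphic_maps_def)
    have sub: "cball (\<phi> x) (2 * r) \<subseteq> \<phi> ` U" using r(2) by auto
    then have "compactin (top_of_set (\<phi> ` U)) (cball (\<phi> x) (2 * r))"
      by (simp add: compactin_subtopology)
    then have "compactin (subtopology (mtop M) U) (\<psi> ` cball (\<phi> x) (2 * r))"
      using cont image_compactin by blast
    moreover have "\<psi> ` cball (\<phi> x) (2 * r) = C"
    proof
      show "\<psi> ` cball (\<phi> x) (2 * r) \<subseteq> C"
      proof
        fix y assume "y \<in> \<psi> ` cball (\<phi> x) (2 * r)"
        then obtain z where z: "z \<in> cball (\<phi> x) (2 * r)" "y = \<psi> z" by blast
        moreover obtain u where "u \<in> U" "z = \<phi> u" using sub z(1) by blast
        ultimately show "y \<in> C" using inv unfolding C_def by simp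
      qed
      show "C \<subseteq> \<psi> ` cball (\<phi> x) (2 * r)"
      proof
        fix y assume "y \<in> C"
        then have "\<phi> y \<in> cball (\<phi> x) (2 * r)" "y = \<psi> (\<phi> y)"
          using inv unfolding C_def by simp_all
        then show "y \<in> \<psi> ` cball (\<phi> x) (2 * r)" by blast
      qed
    qed
    \<comment> \<open>\<open>C\<close> is a compact ball carried over by the inverse chart; compact
      sets are closed because \<open>M\<close> is Hausdorff.\<close>
    ultimately have "compactin (mtop M) C"
      by (simp add: compactin_subtopology)
    then show ?thesis
      using smooth_manifold by (simp add: smooth_manifold_def compactin_imp_closedin)
  qed
  have \<rho>0: "\<rho> y = 0" if "y \<notin> C" for y
    using that \<beta>(3) by (auto simp: \<rho>_def C_def)
  have "\<rho> \<in> smooth_functions M"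
  proof (rule smooth_functionsI)
    fix y assume y: "y \<in> points M"
    show "smooth_at \<rho> y"
    proof (cases "y \<in> U")
      case True
      have "smooth_on (\<phi> ` U) \<beta>"
        using \<beta>(1) chart_open_image[OF U] by (auto intro: smooth_on_subset)
      then have "smooth_on (\<phi> ` U) (\<rho> \<circ> inv_into U \<phi>)"
        by (rule smooth_on_cong) (auto simp: \<rho>_def chart_inv[OF U])
      then show ?thesis
        unfolding smooth_at_def using U True chart_openin by blast
    next
      case False
      then have "y \<in> points M - C" using y C_def by blast
      then show ?thesis
        using smooth_at_cong[OF smooth_functions_smooth_at[OF smooth_functions_const[of 0] y],
            of "points M - C" \<rho>] \<rho>0 C by auto
    qed
  qed
  moreover have "openin (mtop M) W'" "x \<in> W'"
    unfolding W'_def using chart_open_vimage[OF U open_ball] xU r(1) by auto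
  moreover have "W' \<subseteq> C" unfolding W'_def C_def using r(1) by auto
  moreover have "\<rho> y = 1" if "y \<in> W'" for y using that \<beta>(2) by (simp add: \<rho>_def W'_def)
  ultimately show ?thesis using that C CW \<rho>0 by blast
qed

text \<open>\<open>W\<close> and the complement of \<open>C\<close> are open and cover
  \<open>M\<close>; on the former the function is a product of smooth functions, on the latter it is
  0. This is the way from functions of local coordinates to arguments for derivations.\<close>

lemma smooth_functions_extend:
  assumes U: "(U, \<phi>) \<in> charts M" and W: "openin (mtop M) W" "W \<subseteq> U"
    and g: "smooth_on (\<phi> ` W) g"
    and \<rho>: "\<rho> \<in> smooth_functions M" "closedin (mtop M) C" "C \<subseteq> W" "\<And>y. y \<notin> C \<Longrightarrow> \<rho> y = 0"
  shows "(\<lambda>y. if y \<in> W then \<rho> y * g (\<phi> y) else 0) \<in> smooth_functions M" (is "?f \<in> _")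
proof (rule smooth_functionsI)
  fix y assume y: "y \<in> points M"
  show "smooth_at ?f y"
  proof (cases "y \<in> W")
    case True
    have op: "open (\<phi> ` W)" by (rule chart_open_map[OF U W])
    have "smooth_on (\<phi> ` W) (\<rho> \<circ> inv_into U \<phi>)"
      by (rule smooth_on_subset[OF smooth_functions_chart[OF \<rho>(1) U] chart_open_image[OF U] op])
        (use W(2) in blast)
    then have "smooth_on (\<phi> ` W) (\<lambda>z. (\<rho> \<circ> inv_into U \<phi>) z * g z)"
      by (intro smooth_on_mult op g)
    then have "smooth_on (\<phi> ` W) (?f \<circ> inv_into U \<phi>)"
      by (rule smooth_on_cong) (use W(2) in \<open>auto simp: chart_inv[OF U] subset_iff\<close>)
    then show ?thesis
      unfolding smooth_at_def using U True W by blast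
  next
    case False
    then have "y \<in> points M - C" using y \<rho>(3) by blast
    moreover have "openin (mtop M) (points M - C)" using \<rho>(2) by blast
    ultimately show ?thesis
      using smooth_at_cong[OF smooth_functions_smooth_at[OF smooth_functions_const[of 0] y],
          of "points M - C" ?f] \<rho>(4) by auto
  qed
qed

end

section \<open>Tangent vectors and vector fields\<close>

lemma tangent_space_outside: "v \<in> tangent_space M x \<Longrightarrow> f \<notin> smooth_functions M \<Longrightarrow> v f = 0"
  by (simp add: tangent_space_def)

lemma tangent_space_add:
  "v \<in> tangent_space M x \<Longrightarrow> f \<in> smooth_functions M \<Longrightarrow> g \<in> smooth_functions M \<Longrightarrow>
    v (\<lambda>y. f y + g y) = v f + v g"
  by (simp add: tangent_space_def)

lemma tangent_space_mult:
  "v \<in> tangent_space M x \<Longrightarrow> f \<in> smooth_functions M \<Longrightarrow> g \<in> smooth_functions M \<Longrightarrow>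
    v (\<lambda>y. f y * g y) = f x * v g + g x * v f"
  by (simp add: tangent_space_def)

lemma tangent_space_cmult:
  "v \<in> tangent_space M x \<Longrightarrow> f \<in> smooth_functions M \<Longrightarrow> v (\<lambda>y. c * f y) = c * v f"
  by (simp add: tangent_space_def)

lemma tangent_space_eqI:
  assumes "v \<in> tangent_space M x" "w \<in> tangent_space M x"
    "\<And>f. f \<in> smooth_functions M \<Longrightarrow> v f = w f"
  shows "v = w"
proof
  show "v f = w f" for f
    using assms tangent_space_outside[of v M x f] tangent_space_outside[of w M x f] by fastforce
qed

lemma tangent_space_zero: "0 \<in> tangent_space M x"
  by (simp add: tangent_space_def)

lemma tangent_space_plus:
  "v \<in> tangent_space M x \<Longrightarrow> w \<in> tangent_space M x \<Longrightarrow> v + w \<in> tangent_space M x"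
  by (simp add: tangent_space_def algebra_simps)

lemma tangent_space_scale: "v \<in> tangent_space M x \<Longrightarrow> tscale c v \<in> tangent_space M x"
  by (simp add: tangent_space_def tscale_def algebra_simps)

lemma tangent_space_minus:
  "v \<in> tangent_space M x \<Longrightarrow> w \<in> tangent_space M x \<Longrightarrow> v - w \<in> tangent_space M x"
  by (simp add: tangent_space_def algebra_simps)

lemma vector_fieldsD:
  assumes "X \<in> vector_fields M"
  shows "x \<in> points M \<Longrightarrow> X x \<in> tangent_space M x"
    and "x \<notin> points M \<Longrightarrow> X x = 0"
    and "f \<in> smooth_functions M \<Longrightarrow> vf_apply X f \<in> smooth_functions M"
  using assms by (auto simp: vector_fields_def vf_apply_def)

lemma vector_fields_outside:
  assumes "X \<in> vector_fields M" "f \<notin> smooth_functions M"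
  shows "X x f = 0"
  using assms vector_fieldsD[OF assms(1)] tangent_space_outside
  by (cases "x \<in> points M") fastforce+

lemma vector_fields_eqI:
  assumes "X \<in> vector_fields M" "Y \<in> vector_fields M" "\<And>x. x \<in> points M \<Longrightarrow> X x = Y x"
  shows "X = Y"
proof
  show "X x = Y x" for x
    using assms vector_fieldsD(2)[OF assms(1)] vector_fieldsD(2)[OF assms(2)]
    by (cases "x \<in> points M") auto
qed

context pos_manifold
begin

lemma tangent_const:
  assumes "v \<in> tangent_space M x"
  shows "v (\<lambda>_. c) = 0"
proof -
  have "v (\<lambda>_. 1) = 0"
    using tangent_space_mult[OF assms smooth_functions_const[of 1] smooth_functions_const[of 1]]
    by simp
  then show ?thesis
    using tangent_space_cmult[OF assms smooth_functions_const[of 1], of c] by simp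
qed

lemma tangent_diff:
  assumes "v \<in> tangent_space M x" "f \<in> smooth_functions M" "g \<in> smooth_functions M"
  shows "v (\<lambda>y. f y - g y) = v f - v g"
  using tangent_space_add[OF assms(1,2) smooth_functions_cmult[OF assms(3), of "-1"]]
    tangent_space_cmult[OF assms(1,3), of "-1"] by simp

lemma tangent_sum:
  assumes "v \<in> tangent_space M x" "\<And>i. i \<in> I \<Longrightarrow> f i \<in> smooth_functions M"
  shows "v (\<lambda>y. \<Sum>i\<in>I. f i y) = (\<Sum>i\<in>I. v (f i))"
  using assms(2)
proof (induction I rule: infinite_finite_induct)
  case (insert i I)
  then show ?case
    using tangent_space_add[OF assms(1), of "f i" "\<lambda>y. \<Sum>i\<in>I. f i y"]
    by (simp add: smooth_functions_sum)
qed (simp_all add: tangent_const[OF assms(1)])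

text \<open>A bump function that is 1 near \<open>x\<close> and vanishes outside \<open>W\<close>
  kills \<open>f - g\<close> identically. The Leibniz rule at \<open>x\<close>, where
  \<open>f - g\<close> vanishes and the bump function is 1, then leaves just \<open>v\<close> of the
  difference.\<close>

lemma tangent_local:
  assumes "v \<in> tangent_space M x" "f \<in> smooth_functions M" "g \<in> smooth_functions M"
    and W: "openin (mtop M) W" "x \<in> W" "\<And>y. y \<in> W \<Longrightarrow> f y = g y"
  shows "v f = v g"
proof -
  obtain \<rho> W' C where \<rho>: "\<rho> \<in> smooth_functions M" "x \<in> W'" "\<And>y. y \<in> W' \<Longrightarrow> \<rho> y = 1"
    "C \<subseteq> W" "\<And>y. y \<notin> C \<Longrightarrow> \<rho> y = (0::real)"
    using bump_exists[OF W(1,2)] by metis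
  let ?d = "\<lambda>y. f y - g y"
  have d: "?d \<in> smooth_functions M" by (rule smooth_functions_diff[OF assms(2,3)])
  have "(\<lambda>y. \<rho> y * ?d y) = (\<lambda>_. 0)"
    using \<rho>(4,5) W(3) by fastforce
  then have "v (\<lambda>y. \<rho> y * ?d y) = 0" using tangent_const[OF assms(1)] by simp
  then have "v ?d = 0"
    using tangent_space_mult[OF assms(1) \<rho>(1) d] \<rho>(2,3) W(2,3) by simp
  then show ?thesis using tangent_diff[OF assms(1-3)] by simp
qed

text \<open>Functions are defined on the whole type, so identities such as those between pullbacks
  often hold on \<open>points M\<close> only; a derivation does not see the rest.\<close>

lemma tangent_cong:
  assumes "v \<in> tangent_space M x" "x \<in> points M" "f \<in> smooth_functions M"
    "\<And>y. y \<in> points M \<Longrightarrow> f y = g y"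
  shows "v f = v g"
  using tangent_local[OF assms(1,3) smooth_functions_cong[OF assms(3,4)] openin_topspace assms(2,4)]
  by simp

section \<open>Tangent vectors as directional derivatives in charts\<close>

lemma chart_has_derivative:
  assumes "(U, \<phi>) \<in> charts M" "x \<in> U" "f \<in> smooth_functions M"
  shows "((f \<circ> inv_into U \<phi>) has_derivative D) (at (\<phi> x)) \<longleftrightarrow>
    D = (\<lambda>e. chart_vector M (U, \<phi>) x e f)"
proof -
  have "((f \<circ> inv_into U \<phi>) has_derivative frechet_derivative (f \<circ> inv_into U \<phi>) (at (\<phi> x))) (at (\<phi> x))"
    using smooth_on_has_derivative[OF chart_open_image[OF assms(1)]
        smooth_functions_chart[OF assms(3,1)]] assms(2) by blast
  moreover have "(\<lambda>e. chart_vector M (U, \<phi>) x e f) = frechet_derivative (f \<circ> inv_into U \<phi>) (at (\<phi> x))"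
    using assms(3) at_within_open[OF _ chart_open_image[OF assms(1)], of "\<phi> x"] assms(2)
    by (simp add: chart_vector_def)
  ultimately show ?thesis using has_derivative_unique by auto
qed

lemma chart_vector_eqI:
  assumes "(U, \<phi>) \<in> charts M" "x \<in> U" "f \<in> smooth_functions M"
    "((f \<circ> inv_into U \<phi>) has_derivative D) (at (\<phi> x))"
  shows "chart_vector M (U, \<phi>) x e f = D e"
  using chart_has_derivative[OF assms(1-3)] assms(4) by simp

lemma chart_vector_derivative:
  assumes "(U, \<phi>) \<in> charts M" "x \<in> U" "f \<in> smooth_functions M"
  shows "((f \<circ> inv_into U \<phi>) has_derivative (\<lambda>e. chart_vector M (U, \<phi>) x e f)) (at (\<phi> x))"
  using chart_has_derivative[OF assms] by simp

lemma chart_vector_tangent: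
  assumes U: "(U, \<phi>) \<in> charts M" "x \<in> U"
  shows "chart_vector M (U, \<phi>) x e \<in> tangent_space M x"
proof -
  note D = chart_vector_derivative[OF U]
  have "chart_vector M (U, \<phi>) x e (\<lambda>y. f y + g y)
      = chart_vector M (U, \<phi>) x e f + chart_vector M (U, \<phi>) x e g"
    "chart_vector M (U, \<phi>) x e (\<lambda>y. f y * g y)
      = f x * chart_vector M (U, \<phi>) x e g + g x * chart_vector M (U, \<phi>) x e f"
    if fg: "f \<in> smooth_functions M" "g \<in> smooth_functions M" for f g
  proof -
    show "chart_vector M (U, \<phi>) x e (\<lambda>y. f y + g y)
      = chart_vector M (U, \<phi>) x e f + chart_vector M (U, \<phi>) x e g"
      using has_derivative_add[OF D[OF fg(1)] D[OF fg(2)]]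
      by (intro chart_vector_eqI[OF U smooth_functions_add[OF fg]]) (simp add: o_def)
    show "chart_vector M (U, \<phi>) x e (\<lambda>y. f y * g y)
      = f x * chart_vector M (U, \<phi>) x e g + g x * chart_vector M (U, \<phi>) x e f"
      using has_derivative_mult[OF D[OF fg(1)] D[OF fg(2)]]
        chart_vector_eqI[OF U smooth_functions_mult[OF fg],
          of "\<lambda>h. f x * chart_vector M (U, \<phi>) x h g + chart_vector M (U, \<phi>) x h f * g x" e]
      by (simp add: o_def chart_inv[OF U])
  qed
  moreover have "chart_vector M (U, \<phi>) x e (\<lambda>y. c * f y) = c * chart_vector M (U, \<phi>) x e f"
    if f: "f \<in> smooth_functions M" for f c
    using has_derivative_mult_right[OF D[OF f], of c]
      chart_vector_eqI[OF U smooth_functions_cmult[OF f, of c],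
          of "\<lambda>h. c * chart_vector M (U, \<phi>) x h f" e]
    by (simp add: o_def)
  ultimately show ?thesis
    unfolding tangent_space_def by (auto simp: chart_vector_def)
qed

lemma chart_vector_linear:
  assumes "(U, \<phi>) \<in> charts M" "x \<in> U"
  shows "chart_vector M (U, \<phi>) x (c *\<^sub>R e) = tscale c (chart_vector M (U, \<phi>) x e)"
    and "chart_vector M (U, \<phi>) x 0 = 0"
proof -
  have lin: "linear (\<lambda>e. chart_vector M (U, \<phi>) x e f)" if "f \<in> smooth_functions M" for f
    using chart_vector_derivative[OF assms that] has_derivative_linear by blast
  have out: "chart_vector M (U, \<phi>) x e f = 0" if "f \<notin> smooth_functions M" for f e
    using that by (simp add: chart_vector_def)
  show "chart_vector M (U, \<phi>) x (c *\<^sub>R e) = tscale c (chart_vector M (U, \<phi>) x e)"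
  proof
    show "chart_vector M (U, \<phi>) x (c *\<^sub>R e) f = tscale c (chart_vector M (U, \<phi>) x e) f" for f
      using linear_cmul[OF lin, of f c e] out
      by (cases "f \<in> smooth_functions M") (simp_all add: tscale_def)
  qed
  show "chart_vector M (U, \<phi>) x 0 = 0"
  proof
    show "chart_vector M (U, \<phi>) x 0 f = 0 f" for f
      using linear_0[OF lin, of f] out by (cases "f \<in> smooth_functions M") simp_all
  qed
qed

text \<open>Derivations accept only global functions, so the coordinates are cut off by a bump
  function and keep their meaning on a smaller neighbourhood.\<close>

lemma coordinate_functions:
  assumes "(U, \<phi>) \<in> charts M" "x \<in> U"
  obtains W y where "openin (mtop M) W" "x \<in> W" "W \<subseteq> U"
    "\<And>b. y b \<in> smooth_functions M" "\<And>b z. z \<in> W \<Longrightarrow> y b z = \<phi> z \<bullet> b"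
proof -
  obtain \<rho> W C where \<rho>: "\<rho> \<in> smooth_functions M" "openin (mtop M) W" "x \<in> W" "W \<subseteq> C"
    "\<And>y. y \<in> W \<Longrightarrow> \<rho> y = 1" "closedin (mtop M) C" "C \<subseteq> U" "\<And>y. y \<notin> C \<Longrightarrow> \<rho> y = (0::real)"
    using bump_exists[OF chart_openin[OF assms(1)] assms(2)] by metis
  show ?thesis
  proof (rule that[OF \<rho>(2,3)])
    show "W \<subseteq> U" using \<rho> by blast
    show "(\<lambda>z. if z \<in> U then \<rho> z * (\<phi> z \<bullet> b) else 0) \<in> smooth_functions M" for b
      by (rule smooth_functions_extend[OF assms(1) chart_openin[OF assms(1)] order_refl _ \<rho>(1,6,7,8)])
        (rule smooth_on_bounded_linear[OF chart_open_image[OF assms(1)] bounded_linear_inner_left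
            smooth_on_id[OF chart_open_image[OF assms(1)]]])
    show "(if z \<in> U then \<rho> z * (\<phi> z \<bullet> b) else 0) = \<phi> z \<bullet> b" if "z \<in> W" for z b
      using that \<rho> by auto
  qed
qed

lemma chart_vector_coordinate:
  assumes "(U, \<phi>) \<in> charts M" "z \<in> W" "openin (mtop M) W" "W \<subseteq> U" "y \<in> smooth_functions M"
    "\<And>z. z \<in> W \<Longrightarrow> y z = \<phi> z \<bullet> b"
  shows "chart_vector M (U, \<phi>) z e y = e \<bullet> b"
proof (rule chart_vector_eqI[OF assms(1) _ assms(5)])
  show "z \<in> U" using assms(2,4) by blast
  have "((\<lambda>u. u \<bullet> b) has_derivative (\<lambda>u. u \<bullet> b)) (at (\<phi> z))"
    by (auto intro!: derivative_eq_intros)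
  then show "((y \<circ> inv_into U \<phi>) has_derivative (\<lambda>u. u \<bullet> b)) (at (\<phi> z))"
  proof (rule has_derivative_transform_within_open)
    show "open (\<phi> ` W)" by (rule chart_open_map[OF assms(1,3,4)])
    show "\<phi> z \<in> \<phi> ` W" using assms(2) by blast
    show "u \<bullet> b = (y \<circ> inv_into U \<phi>) u" if "u \<in> \<phi> ` W" for u
      using that assms(4,6) by (auto simp: chart_inv[OF assms(1)] subset_iff)
  qed
qed

text \<open>Every derivation is a directional derivative in a chart: apply it to the decomposition of
  Hadamard's lemma.\<close>

lemma tangent_eq_chart_vector:
  assumes U: "(U, \<phi>) \<in> charts M" "x \<in> U" and v: "v \<in> tangent_space M x"
  obtains e where "v = chart_vector M (U, \<phi>) x e"
proof -
  obtain W y where W: "openin (mtop M) W" "x \<in> W" "W \<subseteq> U"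
    and y: "\<And>b. y b \<in> smooth_functions M" "\<And>b z. z \<in> W \<Longrightarrow> y b z = \<phi> z \<bullet> b"
    using coordinate_functions[OF U] by blast
  \<comment> \<open>A directional derivative along \<open>e\<close> sends the coordinate function of
    \<open>b\<close> to the \<open>b\<close>-component of \<open>e\<close>, which forces this
    choice.\<close>
  define e where "e = (\<Sum>b\<in>Basis. v (y b) *\<^sub>R b)"
  have op: "open (\<phi> ` W)" by (rule chart_open_map[OF U(1) W(1,3)])
  then obtain r where r: "r > 0" "ball (\<phi> x) r \<subseteq> \<phi> ` W"
    using W(2) open_contains_ball by (metis imageI)
  \<comment> \<open>Hadamard's lemma needs a convex domain, hence the preimage of a ball.\<close>
  define B where "B = {z \<in> U. \<phi> z \<in> ball (\<phi> x) r}"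
  have B: "openin (mtop M) B" "x \<in> B"
    unfolding B_def using chart_open_vimage[OF U(1) open_ball] U(2) r(1) by auto
  have BW: "B \<subseteq> W"
  proof
    fix z assume "z \<in> B"
    then obtain w where "w \<in> W" "\<phi> z = \<phi> w" "z \<in> U" using r(2) unfolding B_def by blast
    then show "z \<in> W" using chart_inj[OF U(1)] W(3) by (metis inj_onD subsetD)
  qed
  have imB: "\<phi> ` B = ball (\<phi> x) r"
    unfolding B_def using r(2) W(3) by blast
  obtain \<rho> W' C where \<rho>: "\<rho> \<in> smooth_functions M" "openin (mtop M) W'" "x \<in> W'" "W' \<subseteq> C"
    "\<And>y. y \<in> W' \<Longrightarrow> \<rho> y = 1" "closedin (mtop M) C" "C \<subseteq> B" "\<And>y. y \<notin> C \<Longrightarrow> \<rho> y = (0::real)"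
    using bump_exists[OF B] by metis
  have "v f = chart_vector M (U, \<phi>) x e f" if f: "f \<in> smooth_functions M" for f
  proof -
    let ?f = "f \<circ> inv_into U \<phi>"
    have sub: "ball (\<phi> x) r \<subseteq> \<phi> ` U" using r(2) W(3) by blast
    have "smooth_on (ball (\<phi> x) r) ?f"
      by (rule smooth_on_subset[OF smooth_functions_chart[OF f U(1)] chart_open_image[OF U(1)]
            open_ball sub])
    moreover have "\<phi> x \<in> ball (\<phi> x) r" using r(1) by simp
    ultimately obtain g where g: "\<And>b. smooth_on (ball (\<phi> x) r) (g b)"
      "\<And>b. g b (\<phi> x) = frechet_derivative ?f (at (\<phi> x)) b"
      "\<And>z. z \<in> ball (\<phi> x) r \<Longrightarrow> ?f z = ?f (\<phi> x) + (\<Sum>b\<in>Basis. ((z - \<phi> x) \<bullet> b) * g b z)"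
      using hadamard[OF open_ball convex_ball] by blast
    define G where "G b z = (if z \<in> B then \<rho> z * g b (\<phi> z) else 0)" for b z
    have G: "G b \<in> smooth_functions M" for b
      unfolding G_def using BW W(3) g(1)
      by (intro smooth_functions_extend[OF U(1) B(1) _ _ \<rho>(1,6,7,8)]) (auto simp: imB)
    let ?F = "\<lambda>b z. (y b z - \<phi> x \<bullet> b) * G b z"
    have D: "(\<lambda>z. y b z - \<phi> x \<bullet> b) \<in> smooth_functions M" for b
      by (rule smooth_functions_diff[OF y(1) smooth_functions_const])
    have F: "?F b \<in> smooth_functions M" for b
      by (rule smooth_functions_mult[OF D G])
    have S: "(\<lambda>z. \<Sum>b\<in>Basis. ?F b z) \<in> smooth_functions M"
      by (rule smooth_functions_sum[OF F])
    have W'B: "W' \<subseteq> B" using \<rho>(4,7) by blast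
    have "v f = v (\<lambda>z. f x + (\<Sum>b\<in>Basis. ?F b z))"
    proof (rule tangent_local[OF v f _ \<rho>(2,3)])
      show "(\<lambda>z. f x + (\<Sum>b\<in>Basis. ?F b z)) \<in> smooth_functions M"
        by (rule smooth_functions_add[OF smooth_functions_const S])
      fix z assume z: "z \<in> W'"
      then have "z \<in> U" "z \<in> B" "z \<in> W" using W'B BW W(3) by auto
      then show "f z = f x + (\<Sum>b\<in>Basis. ?F b z)"
        using g(3)[of "\<phi> z"] imageI[of z B \<phi>] \<rho>(5)[OF z] y(2)[of z] U(2)
        by (simp add: imB chart_inv[OF U(1)] G_def inner_diff_left del: mem_ball)
    qed
    also have "\<dots> = (\<Sum>b\<in>Basis. v (?F b))"
      using tangent_space_add[OF v smooth_functions_const S] tangent_const[OF v] tangent_sum[OF v F]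
      by simp
    also have "\<dots> = (\<Sum>b\<in>Basis. v (y b) * frechet_derivative ?f (at (\<phi> x)) b)"
    proof (rule sum.cong[OF refl])
      \<comment> \<open>The first factor vanishes at \<open>x\<close>, so the Leibniz rule keeps
        only the derivative of the coordinate, weighted by the value of \<open>G b\<close> at
        \<open>x\<close>, which is a partial derivative of \<open>f\<close>.\<close>
      fix b :: 'e
      have "v (?F b) = (y b x - \<phi> x \<bullet> b) * v (G b) + G b x * v (\<lambda>z. y b z - \<phi> x \<bullet> b)"
        by (rule tangent_space_mult[OF v D G])
      moreover have "y b x = \<phi> x \<bullet> b" by (rule y(2)[OF W(2)])
      moreover have "v (\<lambda>z. y b z - \<phi> x \<bullet> b) = v (y b)"
        using tangent_diff[OF v y(1) smooth_functions_const] tangent_const[OF v] by simp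
      moreover have "G b x = frechet_derivative ?f (at (\<phi> x)) b"
        using g(2) B(2) \<rho>(5)[OF \<rho>(3)] by (simp add: G_def)
      ultimately show "v (?F b) = v (y b) * frechet_derivative ?f (at (\<phi> x)) b" by simp
    qed
    also have "\<dots> = frechet_derivative ?f (at (\<phi> x)) e"
    proof -
      have "linear (frechet_derivative ?f (at (\<phi> x)))"
        using smooth_on_has_derivative[OF chart_open_image[OF U(1)] smooth_functions_chart[OF f U(1)]]
          U(2) has_derivative_linear by blast
      then show ?thesis by (simp add: e_def linear_sum linear_cmul)
    qed
    also have "\<dots> = chart_vector M (U, \<phi>) x e f"
      using f at_within_open[OF imageI[OF U(2)] chart_open_image[OF U(1)]]
      by (simp add: chart_vector_def)
    finally show ?thesis .
  qed
  then show ?thesis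
    using that tangent_space_eqI[OF v chart_vector_tangent[OF U]] by blast
qed

lemma tangent_eqI_coordinates:
  assumes U: "(U, \<phi>) \<in> charts M" and W: "openin (mtop M) W" "W \<subseteq> U" "z \<in> W"
    and y: "\<And>b. y b \<in> smooth_functions M" "\<And>b z. z \<in> W \<Longrightarrow> y b z = \<phi> z \<bullet> b"
    and vw: "v \<in> tangent_space M z" "w \<in> tangent_space M z"
    and eq: "\<And>b. b \<in> Basis \<Longrightarrow> v (y b) = w (y b)"
  shows "v = w"
proof -
  have z: "z \<in> U" using W by blast
  obtain e e' where e: "v = chart_vector M (U, \<phi>) z e" "w = chart_vector M (U, \<phi>) z e'"
    using tangent_eq_chart_vector[OF U z] vw by metis
  have "chart_vector M (U, \<phi>) z e (y b) = e \<bullet> b" for e b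
    by (rule chart_vector_coordinate[OF U W(3,1,2) y(1)]) (rule y(2))
  then have "e \<bullet> b = e' \<bullet> b" if "b \<in> Basis" for b
    using eq[OF that] unfolding e by simp
  then have "e = e'" by (rule euclidean_eqI)
  then show ?thesis using e by simp
qed

section \<open>The module of vector fields, brackets and extension of tangent vectors\<close>

lemma vector_fields_zero: "0 \<in> vector_fields M"
  by (simp add: vector_fields_def tangent_space_zero smooth_functions_const)

lemma vector_fields_add:
  "X \<in> vector_fields M \<Longrightarrow> Y \<in> vector_fields M \<Longrightarrow> X + Y \<in> vector_fields M"
  by (simp add: vector_fields_def tangent_space_plus smooth_functions_add)

lemma vector_fields_diff:
  "X \<in> vector_fields M \<Longrightarrow> Y \<in> vector_fields M \<Longrightarrow> X - Y \<in> vector_fields M"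
  by (simp add: vector_fields_def tangent_space_minus smooth_functions_diff)

lemma vector_fields_scale:
  "f \<in> smooth_functions M \<Longrightarrow> X \<in> vector_fields M \<Longrightarrow> vf_scale f X \<in> vector_fields M"
  by (auto simp: vector_fields_def vf_scale_def tangent_space_scale)
    (auto simp: tscale_def smooth_functions_mult)

lemma vector_fields_sum:
  "(\<And>i. i \<in> I \<Longrightarrow> X i \<in> vector_fields M) \<Longrightarrow> (\<Sum>i\<in>I. X i) \<in> vector_fields M"
  by (induction I rule: infinite_finite_induct) (auto intro: vector_fields_zero vector_fields_add)

lemma vector_fieldsI_local:
  assumes "\<And>x. x \<in> points M \<Longrightarrow>
      \<exists>Y\<in>vector_fields M. \<exists>W. openin (mtop M) W \<and> x \<in> W \<and> (\<forall>y\<in>W. X y = Y y)"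
    and "\<And>x. x \<notin> points M \<Longrightarrow> X x = 0"
  shows "X \<in> vector_fields M"
proof -
  have "X x \<in> tangent_space M x" if "x \<in> points M" for x
    using assms(1)[OF that] vector_fieldsD(1) that by metis
  moreover have "(\<lambda>x. X x f) \<in> smooth_functions M" if f: "f \<in> smooth_functions M" for f
  proof (rule smooth_functionsI_local)
    fix x assume "x \<in> points M"
    then obtain Y W where Y: "Y \<in> vector_fields M" "openin (mtop M) W" "x \<in> W" "\<forall>y\<in>W. X y = Y y"
      using assms(1) by blast
    then show "\<exists>g\<in>smooth_functions M. \<exists>W. openin (mtop M) W \<and> x \<in> W \<and> (\<forall>y\<in>W. X y f = g y)"
      using vector_fieldsD(3)[OF Y(1) f] by (intro bexI[of _ "vf_apply Y f"]) (auto simp: vf_apply_def)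
  qed
  ultimately show ?thesis using assms(2) by (simp add: vector_fields_def)
qed

text \<open>In the Leibniz rule for the commutator the products of first derivatives of
  \<open>f\<close> and \<open>g\<close> are symmetric in \<open>X\<close> and \<open>Y\<close> and
  cancel.\<close>

lemma lie_bracket_vector_fields:
  assumes X: "X \<in> vector_fields M" and Y: "Y \<in> vector_fields M"
  shows "lie_bracket X Y \<in> vector_fields M"
proof -
  note XD = vector_fieldsD[OF X] and YD = vector_fieldsD[OF Y]
  have "lie_bracket X Y x \<in> tangent_space M x" if x: "x \<in> points M" for x
  proof -
    note Xx = XD(1)[OF x] and Yx = YD(1)[OF x]
    have add: "vf_apply Z (\<lambda>y. f y + g y) = (\<lambda>y. vf_apply Z f y + vf_apply Z g y)"
      and mult: "vf_apply Z (\<lambda>y. f y * g y) = (\<lambda>y. f y * vf_apply Z g y + g y * vf_apply Z f y)"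
      and cmult: "vf_apply Z (\<lambda>y. c * f y) = (\<lambda>y. c * vf_apply Z f y)"
      if Z: "Z \<in> vector_fields M" and f: "f \<in> smooth_functions M" and g: "g \<in> smooth_functions M"
      for Z f g c
    proof -
      have "Z y (\<lambda>y. f y + g y) = Z y f + Z y g \<and>
          Z y (\<lambda>y. f y * g y) = f y * Z y g + g y * Z y f \<and> Z y (\<lambda>y. c * f y) = c * Z y f" for y
        using vector_fieldsD(1,2)[OF Z, of y] f g
        by (cases "y \<in> points M") (auto simp: tangent_space_def)
      then show "vf_apply Z (\<lambda>y. f y + g y) = (\<lambda>y. vf_apply Z f y + vf_apply Z g y)"
        "vf_apply Z (\<lambda>y. f y * g y) = (\<lambda>y. f y * vf_apply Z g y + g y * vf_apply Z f y)"
        "vf_apply Z (\<lambda>y. c * f y) = (\<lambda>y. c * vf_apply Z f y)"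
        by (auto simp: vf_apply_def)
    qed
    \<comment> \<open>On a nonsmooth argument both fields return the zero function, a constant, so
      the bracket obeys the convention that derivations are 0 there.\<close>
    have out: "lie_bracket X Y x f = 0" if "f \<notin> smooth_functions M" for f
    proof -
      have "vf_apply X f = (\<lambda>_. 0)" "vf_apply Y f = (\<lambda>_. 0)"
        using that X Y by (auto simp: vf_apply_def vector_fields_outside)
      then show ?thesis
        by (simp add: lie_bracket_def tangent_const[OF Xx] tangent_const[OF Yx])
    qed
    have "lie_bracket X Y x (\<lambda>y. f y + g y) = lie_bracket X Y x f + lie_bracket X Y x g"
      "lie_bracket X Y x (\<lambda>y. f y * g y) = f x * lie_bracket X Y x g + g x * lie_bracket X Y x f"
      "lie_bracket X Y x (\<lambda>y. c * f y) = c * lie_bracket X Y x f"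
      if f: "f \<in> smooth_functions M" and g: "g \<in> smooth_functions M" for f g c
    proof -
      have ap: "vf_apply Z h x = Z x h" for Z :: "'a vfield" and h by (simp add: vf_apply_def)
      note sm = f g XD(3)[OF f] XD(3)[OF g] YD(3)[OF f] YD(3)[OF g]
      show "lie_bracket X Y x (\<lambda>y. f y + g y) = lie_bracket X Y x f + lie_bracket X Y x g"
        using sm by (simp add: lie_bracket_def add[OF X] add[OF Y] tangent_space_add[OF Xx]
            tangent_space_add[OF Yx])
      show "lie_bracket X Y x (\<lambda>y. c * f y) = c * lie_bracket X Y x f"
        using sm by (simp add: lie_bracket_def cmult[OF X f f] cmult[OF Y f f] tangent_space_cmult[OF Xx]
            tangent_space_cmult[OF Yx] right_diff_distrib)
      show "lie_bracket X Y x (\<lambda>y. f y * g y)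
          = f x * lie_bracket X Y x g + g x * lie_bracket X Y x f"
        using sm by (simp add: lie_bracket_def mult[OF X] mult[OF Y] tangent_space_add[OF Xx]
            tangent_space_add[OF Yx] tangent_space_mult[OF Xx] tangent_space_mult[OF Yx]
            smooth_functions_mult ap algebra_simps)
    qed
    then show ?thesis
      unfolding tangent_space_def using out by simp
  qed
  moreover have "lie_bracket X Y x = 0" if "x \<notin> points M" for x
    using XD(2)[OF that] YD(2)[OF that] by (auto simp: lie_bracket_def)
  moreover have "(\<lambda>x. lie_bracket X Y x f) \<in> smooth_functions M" if f: "f \<in> smooth_functions M" for f
    using smooth_functions_diff[OF XD(3)[OF YD(3)[OF f]] YD(3)[OF XD(3)[OF f]]]
    by (simp add: lie_bracket_def vf_apply_def)
  ultimately show ?thesis by (simp add: vector_fields_def)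
qed

text \<open>A coordinate field multiplied by a bump function. The two final clauses describe it away
  from \<open>W\<close>: it stays a multiple of the same direction, so in a foliated chart with
  \<open>e\<close> along the leaves the field is tangential on all of \<open>M\<close>.\<close>

lemma chart_field:
  assumes U: "(U, \<phi>) \<in> charts M" "x \<in> U"
  obtains X W where "X \<in> vector_fields M" "openin (mtop M) W" "x \<in> W" "W \<subseteq> U"
    "\<And>y. y \<in> W \<Longrightarrow> X y = chart_vector M (U, \<phi>) y e"
    "\<And>y. y \<in> U \<Longrightarrow> \<exists>c. X y = chart_vector M (U, \<phi>) y (c *\<^sub>R e)"
    "\<And>y. y \<notin> U \<Longrightarrow> X y = 0"
proof -
  obtain \<rho> W C where \<rho>: "\<rho> \<in> smooth_functions M" "openin (mtop M) W" "x \<in> W" "W \<subseteq> C"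
    "\<And>y. y \<in> W \<Longrightarrow> \<rho> y = 1" "closedin (mtop M) C" "C \<subseteq> U" "\<And>y. y \<notin> C \<Longrightarrow> \<rho> y = (0::real)"
    using bump_exists[OF chart_openin[OF U(1)] U(2)] by metis
  define X where "X y = (if y \<in> U then chart_vector M (U, \<phi>) y (\<rho> y *\<^sub>R e) else 0)" for y
  have "X \<in> vector_fields M"
  proof -
    have "X y \<in> tangent_space M y" for y
      using chart_vector_tangent[OF U(1)] by (simp add: X_def tangent_space_zero)
    moreover have "X y = 0" if "y \<notin> points M" for y
      using that chart_subset[OF U(1)] by (auto simp: X_def)
    moreover have "(\<lambda>y. X y f) \<in> smooth_functions M" if f: "f \<in> smooth_functions M" for f
    proof -
      let ?g = "\<lambda>z. frechet_derivative (f \<circ> inv_into U \<phi>) (at z) e"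
      have "X y f = (if y \<in> U then \<rho> y * ?g (\<phi> y) else 0)" for y
      proof (cases "y \<in> U")
        case True
        have "chart_vector M (U, \<phi>) y e f = ?g (\<phi> y)"
          using f at_within_open[OF imageI[OF True] chart_open_image[OF U(1)]]
          by (simp add: chart_vector_def)
        then show ?thesis
          using True by (simp add: X_def chart_vector_linear(1)[OF U(1) True] tscale_def)
      qed (simp add: X_def)
      moreover have "(\<lambda>y. if y \<in> U then \<rho> y * ?g (\<phi> y) else 0) \<in> smooth_functions M"
        by (rule smooth_functions_extend[OF U(1) chart_openin[OF U(1)] order_refl _ \<rho>(1,6,7,8)])
          (intro smooth_on_frechet_derivative chart_open_image[OF U(1)] smooth_functions_chart[OF f U(1)])
      ultimately show ?thesis by simp
    qed
    ultimately show ?thesis by (simp add: vector_fields_def)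
  qed
  moreover have "W \<subseteq> U" using \<rho>(4,7) by blast
  moreover have "X y = chart_vector M (U, \<phi>) y e" if "y \<in> W" for y
    using that \<open>W \<subseteq> U\<close> \<rho>(5) by (auto simp: X_def)
  ultimately show ?thesis
    using \<rho>(2,3) by (intro that[of X W]) (auto simp: X_def)
qed

lemma tangent_extend:
  assumes "x \<in> points M" "v \<in> tangent_space M x"
  obtains X where "X \<in> vector_fields M" "X x = v"
proof -
  obtain U \<phi> where U: "(U, \<phi>) \<in> charts M" "x \<in> U"
    using atlas_cover[OF assms(1)] atlas_charts by blast
  obtain e where "v = chart_vector M (U, \<phi>) x e"
    using tangent_eq_chart_vector[OF U assms(2)] .
  then show ?thesis using chart_field[OF U, of e] that by metis
qed

end

section \<open>Lifting vector fields along submersions\<close>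

lemma sum_vfield_apply: "(\<Sum>i\<in>I. X i) z f = (\<Sum>i\<in>I. (X i :: 'a vfield) z f)"
  by (induction I rule: infinite_finite_induct) simp_all

lemma vf_scale_apply: "vf_scale f X z g = f z * X z g"
  by (simp add: vf_scale_def tscale_def)

text \<open>One step of Gauss--Jordan elimination over the ring of germs per new function.\<close>

lemma (in pos_manifold) dual_frame:
  assumes "finite I" "x \<in> points M" "\<And>i. i \<in> I \<Longrightarrow> f i \<in> smooth_functions M"
    "\<And>i. i \<in> I \<Longrightarrow> E i \<in> vector_fields M"
    "\<And>i j. i \<in> I \<Longrightarrow> j \<in> I \<Longrightarrow> E i x (f j) = (if i = j then 1 else 0)"
  obtains W D where "openin (mtop M) W" "x \<in> W" "\<And>i. i \<in> I \<Longrightarrow> D i \<in> vector_fields M"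
    "\<And>i j z. i \<in> I \<Longrightarrow> j \<in> I \<Longrightarrow> z \<in> W \<Longrightarrow> D i z (f j) = (if i = j then 1 else 0)"
proof -
  have "\<exists>D W. openin (mtop M) W \<and> x \<in> W \<and> (\<forall>i\<in>I. D i \<in> vector_fields M) \<and>
      (\<forall>i\<in>I. \<forall>j\<in>I. \<forall>z\<in>W. D i z (f j) = (if i = j then 1 else 0))"
    using assms(1,3-5)
  proof (induction I rule: finite_induct)
    case empty
    then show ?case using assms(2) openin_topspace by blast
  next
    case (insert k I)
    have "\<exists>D W. openin (mtop M) W \<and> x \<in> W \<and> (\<forall>i\<in>I. D i \<in> vector_fields M) \<and>
        (\<forall>i\<in>I. \<forall>j\<in>I. \<forall>z\<in>W. D i z (f j) = (if i = j then 1 else 0))"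
      by (rule insert.IH) (use insert.prems in auto)
    then obtain D W where W: "openin (mtop M) W" "x \<in> W"
      and D: "\<And>i. i \<in> I \<Longrightarrow> D i \<in> vector_fields M"
        "\<And>i j z. i \<in> I \<Longrightarrow> j \<in> I \<Longrightarrow> z \<in> W \<Longrightarrow> D i z (f j) = (if i = j then 1 else 0)"
      by blast
    have f: "f i \<in> smooth_functions M" and E: "E i \<in> vector_fields M" if "i \<in> insert k I" for i
      using insert.prems that by auto
    \<comment> \<open>Subtracting the components of \<open>E k\<close> along the old frame makes the
      new field annihilate all earlier functions \<open>f j\<close> on \<open>W\<close>.\<close>
    define G where "G = E k - (\<Sum>j\<in>I. vf_scale (vf_apply (E k) (f j)) (D j))"
    have G: "G \<in> vector_fields M"
      unfolding G_def using f E D(1)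
      by (intro vector_fields_diff vector_fields_sum vector_fields_scale vector_fieldsD(3)) auto
    have G_apply: "G z g = E k z g - (\<Sum>j\<in>I. E k z (f j) * D j z g)" for z g
      by (simp add: G_def sum_vfield_apply vf_scale_apply vf_apply_def)
    have G0: "G z (f j) = 0" if "j \<in> I" "z \<in> W" for j z
    proof -
      have "(\<Sum>i\<in>I. E k z (f i) * D i z (f j)) = (\<Sum>i\<in>I. if i = j then E k z (f i) else 0)"
        using D(2) that by (intro sum.cong) auto
      then show ?thesis using that insert.hyps(1) by (simp add: G_apply)
    qed
    \<comment> \<open>At \<open>x\<close> the correction terms vanish by the assumed duality, so
      \<open>G\<close> still takes the value 1 on \<open>f k\<close> there and can be normalised
      nearby.\<close>
    have "E k x (f j) = 0" if "j \<in> I" for j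
      using insert.prems(3)[of k j] insert.hyps(2) that by auto
    then have "vf_apply G (f k) x \<noteq> 0"
      using insert.prems(3)[of k k] by (simp add: vf_apply_def G_apply)
    then obtain h W2 where h: "h \<in> smooth_functions M" "openin (mtop M) W2" "x \<in> W2"
      "\<And>y. y \<in> W2 \<Longrightarrow> h y * vf_apply G (f k) y = 1"
      using smooth_functions_local_inverse[OF vector_fieldsD(3)[OF G f] assms(2)] by (metis insertI1)
    define K where "K = vf_scale h G"
    have K: "K \<in> vector_fields M" unfolding K_def by (intro vector_fields_scale h G)
    have K0: "K z (f j) = 0" if "j \<in> I" "z \<in> W" for j z
      using G0[OF that] by (simp add: K_def vf_scale_apply)
    have K1: "K z (f k) = 1" if "z \<in> W2" for z
      using h(4)[OF that] by (simp add: K_def vf_scale_apply vf_apply_def)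
    \<comment> \<open>Clearing the \<open>f k\<close> entries of the old fields does not disturb
      their duality, because \<open>K\<close> annihilates every earlier \<open>f j\<close>.\<close>
    define D' where "D' i = (if i = k then K else D i - vf_scale (vf_apply (D i) (f k)) K)" for i
    have "D' i \<in> vector_fields M" if "i \<in> insert k I" for i
    proof (cases "i = k")
      case False
      then have "D i \<in> vector_fields M" using that D(1) by blast
      then show ?thesis
        using False f[of k] K
        by (simp add: D'_def vector_fields_diff vector_fields_scale vector_fieldsD(3))
    qed (simp add: D'_def K)
    moreover have "D' i z (f j) = (if i = j then 1 else 0)"
      if "i \<in> insert k I" "j \<in> insert k I" "z \<in> W \<inter> W2" for i j z
      using that insert.hyps(2) K0 K1 D(2) by (auto simp: D'_def vf_scale_apply vf_apply_def)
    moreover have "openin (mtop M) (W \<inter> W2)" "x \<in> W \<inter> W2" using W h by auto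
    ultimately show ?case by blast
  qed
  then show ?thesis using that by blast
qed

lemma pushforward_add: "pushforward N F (u + v) = pushforward N F u + pushforward N F v"
  and pushforward_diff: "pushforward N F (u - v) = pushforward N F u - pushforward N F v"
  and pushforward_scale: "pushforward N F (tscale c v) = tscale c (pushforward N F v)"
  and pushforward_zero: "pushforward N F 0 = 0"
  by (auto simp: pushforward_def tscale_def fun_eq_iff)

lemma pushforward_apply: "f \<in> smooth_functions N \<Longrightarrow> pushforward N F v f = v (f \<circ> F)"
  by (simp add: pushforward_def)

section \<open>Submersions and lifts of vector fields\<close>

locale pos_submersion =
  M: pos_manifold M + Q: pos_manifold Q
  for M :: "('a, 'e::euclidean_space) mfd" and Q :: "('b, 'f::euclidean_space) mfd" +
  fixes \<pi> :: "'a \<Rightarrow> 'b"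
  assumes submersion: "submersion M Q \<pi>"
begin

lemma map_points: "x \<in> points M \<Longrightarrow> \<pi> x \<in> points Q"
  using submersion by (auto simp: submersion_def smooth_map_def continuous_map_def)

lemma map_open_vimage: "openin (mtop Q) V \<Longrightarrow> openin (mtop M) {x \<in> points M. \<pi> x \<in> V}"
  using submersion by (auto simp: submersion_def smooth_map_def continuous_map_def)

lemma local_representative:
  assumes "(U, \<phi>) \<in> atlas M" "(V, \<psi>) \<in> atlas Q"
  shows representative_open: "openin (mtop M) (U \<inter> \<pi> -` V)" "open (\<phi> ` (U \<inter> \<pi> -` V))"
    and representative_smooth: "smooth_on (\<phi> ` (U \<inter> \<pi> -` V)) (\<psi> \<circ> \<pi> \<circ> inv_into U \<phi>)"
proof -
  note U = M.atlas_charts[OF assms(1)] and V = Q.atlas_charts[OF assms(2)]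
  have "U \<inter> \<pi> -` V = U \<inter> {x \<in> points M. \<pi> x \<in> V}"
    using M.chart_subset[OF U] by auto
  then show W: "openin (mtop M) (U \<inter> \<pi> -` V)"
    using M.chart_openin[OF U] map_open_vimage[OF Q.chart_openin[OF V]] openin_Int by metis
  show "open (\<phi> ` (U \<inter> \<pi> -` V))" by (rule M.chart_open_map[OF U W]) simp
  have "\<forall>c\<in>atlas M. \<forall>d\<in>atlas Q.
      smooth_on (snd c ` (fst c \<inter> \<pi> -` fst d)) (snd d \<circ> \<pi> \<circ> inv_into (fst c) (snd c))"
    using submersion by (simp add: submersion_def smooth_map_def case_prod_beta)
  from bspec[OF bspec[OF this assms(1)] assms(2)]
  show "smooth_on (\<phi> ` (U \<inter> \<pi> -` V)) (\<psi> \<circ> \<pi> \<circ> inv_into U \<phi>)" by simp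
qed

lemma pullback_smooth:
  assumes "g \<in> smooth_functions Q"
  shows "g \<circ> \<pi> \<in> smooth_functions M"
proof (rule M.smooth_functionsI)
  fix x assume x: "x \<in> points M"
  obtain U \<phi> V \<psi> where U: "(U, \<phi>) \<in> atlas M" "x \<in> U" and V: "(V, \<psi>) \<in> atlas Q" "\<pi> x \<in> V"
    using M.atlas_cover[OF x] Q.atlas_cover[OF map_points[OF x]] by blast
  note U' = M.atlas_charts[OF U(1)] and V' = Q.atlas_charts[OF V(1)]
    and rep = representative_open[OF U(1) V(1)] representative_smooth[OF U(1) V(1)]
  let ?W = "U \<inter> \<pi> -` V"
  have "smooth_on (\<phi> ` ?W) (\<lambda>z. (g \<circ> inv_into V \<psi>) ((\<psi> \<circ> \<pi> \<circ> inv_into U \<phi>) z))"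
    by (rule smooth_on_compose[OF rep(2) Q.chart_open_image[OF V'] rep(3)
          Q.smooth_functions_chart[OF assms V']]) (auto simp: M.chart_inv[OF U'])
  then have "smooth_on (\<phi> ` ?W) ((g \<circ> \<pi>) \<circ> inv_into U \<phi>)"
    by (rule smooth_on_cong) (auto simp: M.chart_inv[OF U'] Q.chart_inv[OF V'])
  then show "M.smooth_at (g \<circ> \<pi>) x"
    unfolding M.smooth_at_def using U' U(2) V(2) rep(1) by blast
qed

lemma push_tangent: "x \<in> points M \<Longrightarrow> v \<in> tangent_space M x \<Longrightarrow> pushforward Q \<pi> v \<in> tangent_space Q (\<pi> x)"
  using submersion unfolding submersion_def by blast

lemma push_surj:
  assumes "x \<in> points M" "w \<in> tangent_space Q (\<pi> x)"
  obtains v where "v \<in> tangent_space M x" "pushforward Q \<pi> v = w"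
proof -
  have "w \<in> pushforward Q \<pi> ` tangent_space M x"
    using assms submersion unfolding submersion_def by simp
  then show ?thesis using that by blast
qed

lemma local_lift:
  assumes X': "X' \<in> vector_fields Q" and x: "x \<in> points M"
  obtains X W where "X \<in> vector_fields M" "openin (mtop M) W" "x \<in> W"
    "\<And>z. z \<in> W \<Longrightarrow> pushforward Q \<pi> (X z) = X' (\<pi> z)"
proof -
  obtain V \<psi> where V: "(V, \<psi>) \<in> charts Q" "\<pi> x \<in> V"
    using Q.atlas_cover[OF map_points[OF x]] Q.atlas_charts by blast
  obtain V0 y where V0: "openin (mtop Q) V0" "\<pi> x \<in> V0" "V0 \<subseteq> V"
    and y: "\<And>b. y b \<in> smooth_functions Q" "\<And>b z. z \<in> V0 \<Longrightarrow> y b z = \<psi> z \<bullet> b"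
    using Q.coordinate_functions[OF V] by blast
  have "\<exists>E\<in>vector_fields M. pushforward Q \<pi> (E x) = chart_vector Q (V, \<psi>) (\<pi> x) b" for b
  proof -
    obtain v where v: "v \<in> tangent_space M x" "pushforward Q \<pi> v = chart_vector Q (V, \<psi>) (\<pi> x) b"
      using push_surj[OF x Q.chart_vector_tangent[OF V]] by blast
    obtain E where "E \<in> vector_fields M" "E x = v"
      using M.tangent_extend[OF x v(1)] by blast
    then show ?thesis using v(2) by blast
  qed
  then obtain E where E: "\<And>b. E b \<in> vector_fields M"
    "\<And>b. pushforward Q \<pi> (E b x) = chart_vector Q (V, \<psi>) (\<pi> x) b"
    by metis
  have coord: "chart_vector Q (V, \<psi>) (\<pi> x) e (y b) = e \<bullet> b" for e b
    by (rule Q.chart_vector_coordinate[OF V(1) V0(2,1,3) y(1)]) (rule y(2))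
  have dual: "E b x (y c \<circ> \<pi>) = (if b = c then 1 else 0)" if "b \<in> Basis" "c \<in> Basis" for b c
    using coord[of b c] E(2)[of b] pushforward_apply[OF y(1), of \<pi> "E b x" c] that
    by (simp add: inner_Basis)
  have f: "y b \<circ> \<pi> \<in> smooth_functions M" for b by (rule pullback_smooth[OF y(1)])
  obtain W D where W: "openin (mtop M) W" "x \<in> W"
    and D: "\<And>b. b \<in> Basis \<Longrightarrow> D b \<in> vector_fields M"
    "\<And>b c z. b \<in> Basis \<Longrightarrow> c \<in> Basis \<Longrightarrow> z \<in> W \<Longrightarrow> D b z (y c \<circ> \<pi>) = (if b = c then 1 else 0)"
    using M.dual_frame[of Basis x "\<lambda>b. y b \<circ> \<pi>" E, OF finite_Basis x f E(1) dual] by metis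
  \<comment> \<open>The coefficients are the coordinate components of \<open>X'\<close>, pulled
    back. As the \<open>D b\<close> are dual to the pulled-back coordinates near \<open>x\<close>,
    the projection of \<open>X\<close> and \<open>X'\<close> agree on all coordinate
    functions.\<close>
  define X where "X = (\<Sum>b\<in>Basis. vf_scale (vf_apply X' (y b) \<circ> \<pi>) (D b))"
  have X: "X \<in> vector_fields M"
    unfolding X_def
    by (intro M.vector_fields_sum M.vector_fields_scale pullback_smooth vector_fieldsD(3)[OF X'] y(1) D(1))
  show ?thesis
  proof (rule that[OF X])
    show "openin (mtop M) (W \<inter> {z \<in> points M. \<pi> z \<in> V0})"
      using W(1) map_open_vimage[OF V0(1)] by blast
    show "x \<in> W \<inter> {z \<in> points M. \<pi> z \<in> V0}" using W(2) x V0(2) by blast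
    fix z assume "z \<in> W \<inter> {z \<in> points M. \<pi> z \<in> V0}"
    then have z: "z \<in> W" "z \<in> points M" "\<pi> z \<in> V0" by auto
    show "pushforward Q \<pi> (X z) = X' (\<pi> z)"
    proof (rule Q.tangent_eqI_coordinates[OF V(1) V0(1,3) z(3), of y])
      show "pushforward Q \<pi> (X z) \<in> tangent_space Q (\<pi> z)"
        by (rule push_tangent[OF z(2) vector_fieldsD(1)[OF X z(2)]])
      show "X' (\<pi> z) \<in> tangent_space Q (\<pi> z)"
        by (rule vector_fieldsD(1)[OF X' map_points[OF z(2)]])
      fix c :: 'f assume c: "c \<in> Basis"
      have "X z (y c \<circ> \<pi>) = (\<Sum>b\<in>Basis. X' (\<pi> z) (y b) * D b z (y c \<circ> \<pi>))"
        by (simp add: X_def sum_vfield_apply vf_scale_apply vf_apply_def)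
      also have "\<dots> = (\<Sum>b\<in>Basis. if b = c then X' (\<pi> z) (y b) else 0)"
        using D(2) c z(1) by (intro sum.cong) auto
      also have "\<dots> = X' (\<pi> z) (y c)" using c by simp
      finally show "pushforward Q \<pi> (X z) (y c) = X' (\<pi> z) (y c)"
        by (simp add: pushforward_apply[OF y(1)])
    qed (use y in auto)
  qed
qed

text \<open>Local lifts \<open>X\<^sub>n\<close> are glued with the weights \<open>\<rho>\<^sub>n * (1 - \<rho>\<^sub>0) * \<dots> * (1 - \<rho>\<^sub>n\<^sub>-\<^sub>1)\<close> for bump functions
  \<open>\<rho>\<^sub>n\<close> equal to \<open>1\<close> on sets \<open>A\<^sub>n\<close> that cover \<open>M\<close>.  The weights of index \<open>> j\<close> vanish on \<open>A\<^sub>j\<close>, and the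
  first \<open>n\<close> weights sum up to \<open>1 - (1 - \<rho>\<^sub>0) * \<dots> * (1 - \<rho>\<^sub>n\<^sub>-\<^sub>1)\<close>.\<close>

lemma global_lift:
  assumes X': "X' \<in> vector_fields Q"
  obtains X where "X \<in> vector_fields M" "vf_projects_to M Q \<pi> X X'"
proof -
  \<comment> \<open>The lifting condition is imposed only where the weight is nonzero, since
    elsewhere the weighted field does not contribute.\<close>
  define R where "R A \<rho> X \<longleftrightarrow> openin (mtop M) A \<and> \<rho> \<in> smooth_functions M \<and> (\<forall>y\<in>A. \<rho> y = 1) \<and>
      X \<in> vector_fields M \<and> (\<forall>y. \<rho> y \<noteq> 0 \<longrightarrow> pushforward Q \<pi> (X y) = X' (\<pi> y))" for A \<rho> X
  have cover: "\<exists>A \<rho> X. x \<in> A \<and> R A \<rho> X" if x: "x \<in> points M" for x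
  proof -
    obtain X W where X: "X \<in> vector_fields M" "openin (mtop M) W" "x \<in> W"
      "\<And>z. z \<in> W \<Longrightarrow> pushforward Q \<pi> (X z) = X' (\<pi> z)"
      using local_lift[OF X' x] by blast
    obtain \<rho> W' C where \<rho>: "\<rho> \<in> smooth_functions M" "openin (mtop M) W'" "x \<in> W'"
      "\<And>y. y \<in> W' \<Longrightarrow> \<rho> y = 1" "C \<subseteq> W" "\<And>y. y \<notin> C \<Longrightarrow> \<rho> y = (0::real)"
      using M.bump_exists[OF X(2,3)] by metis
    have "R W' \<rho> X"
      unfolding R_def using \<rho> X by blast
    then show ?thesis using \<rho>(3) by blast
  qed
  have empty: "R {} (\<lambda>_. 0) 0"
    by (simp add: R_def M.smooth_functions_const M.vector_fields_zero)
  let ?F = "{A. \<exists>\<rho> X. R A \<rho> X}"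
  have open_F: "openin (mtop M) A" if "A \<in> ?F" for A
    using that by (auto simp: R_def)
  have "\<Union>?F = points M"
  proof
    show "\<Union>?F \<subseteq> points M" using open_F openin_subset by blast
    show "points M \<subseteq> \<Union>?F" using cover by blast
  qed
  moreover have "Lindelof_space (mtop M)"
    using M.smooth_manifold second_countable_imp_Lindelof_space by (auto simp: smooth_manifold_def)
  ultimately obtain \<V> where \<V>: "countable \<V>" "\<V> \<subseteq> ?F" "\<Union>\<V> = points M"
    using open_F unfolding Lindelof_space_def by (metis (no_types, lifting))
  \<comment> \<open>Adjoining the empty set, with zero weight and zero field, makes the countable
    cover nonempty and hence enumerable by \<open>nat\<close> even if \<open>M\<close> has no
    points.\<close>
  define A where "A = from_nat_into (insert {} \<V>)"
  have range_A: "range A = insert {} \<V>"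
    unfolding A_def by (rule range_from_nat_into) (use \<V>(1) in auto)
  have "\<exists>\<rho> X. R (A n) \<rho> X" for n
  proof -
    have "A n \<in> insert {} \<V>" using range_A by blast
    then show ?thesis using \<V>(2) empty by (cases "A n = {}") auto
  qed
  then obtain \<rho> X where R: "\<And>n. R (A n) (\<rho> n) (X n)" by metis
  have A_open: "openin (mtop M) (A n)" and \<rho>: "\<rho> n \<in> smooth_functions M" and X: "X n \<in> vector_fields M"
    and \<rho>1: "y \<in> A n \<Longrightarrow> \<rho> n y = 1"
    and push: "\<rho> n y \<noteq> 0 \<Longrightarrow> pushforward Q \<pi> (X n y) = X' (\<pi> y)" for n y
    using R[of n] by (auto simp: R_def)
  define s where "s n y = (\<Prod>i<n. 1 - \<rho> i y)" for n y
  have s: "s n \<in> smooth_functions M" for n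
  proof (induction n)
    case 0
    then show ?case by (simp add: s_def[abs_def] M.smooth_functions_const)
  next
    case (Suc n)
    have "s (Suc n) = (\<lambda>y. s n y * (1 - \<rho> n y))" by (simp add: s_def[abs_def])
    then show ?case
      using Suc \<rho> by (simp add: M.smooth_functions_mult M.smooth_functions_diff M.smooth_functions_const)
  qed
  define Y where "Y n = (\<Sum>i<n. vf_scale (\<lambda>y. s i y * \<rho> i y) (X i))" for n
  have Y: "Y n \<in> vector_fields M" for n
    unfolding Y_def by (intro M.vector_fields_sum M.vector_fields_scale M.smooth_functions_mult s \<rho> X)
  have Y_Suc: "Y (Suc n) y = Y n y + tscale (s n y * \<rho> n y) (X n y)" for n y
    by (simp add: Y_def vf_scale_def)
  have s0: "s n y = 0" if "y \<in> A j" "j < n" for n j y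
    using that \<rho>1[of y j] by (auto simp: s_def)
  have stable: "Y n y = Y (Suc j) y" if "y \<in> A j" "Suc j \<le> n" for n j y
    using that(2)
  proof (induction n rule: dec_induct)
    case (step n)
    then show ?case using s0[OF that(1), of n] by (simp add: Y_Suc tscale_def fun_eq_iff)
  qed simp
  have push_Y: "pushforward Q \<pi> (Y n y) = tscale (1 - s n y) (X' (\<pi> y))" for n y
  proof (induction n)
    case 0
    then show ?case by (simp add: Y_def s_def pushforward_def tscale_def fun_eq_iff)
  next
    case (Suc n)
    have "tscale (s n y * \<rho> n y) (pushforward Q \<pi> (X n y)) = tscale (s n y * \<rho> n y) (X' (\<pi> y))"
      using push[of n y] by (cases "\<rho> n y = 0") (simp_all add: tscale_def fun_eq_iff)
    then have "pushforward Q \<pi> (Y (Suc n) y)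
        = tscale (1 - s n y) (X' (\<pi> y)) + tscale (s n y * \<rho> n y) (X' (\<pi> y))"
      unfolding Y_Suc pushforward_add pushforward_scale Suc by (rule arg_cong)
    also have "\<dots> = tscale (1 - s n y + s n y * \<rho> n y) (X' (\<pi> y))"
      by (simp only: tscale_def fun_eq_iff plus_fun_apply distrib_right) blast
    also have "1 - s n y + s n y * \<rho> n y = 1 - s (Suc n) y"
      by (simp add: s_def algebra_simps)
    finally show ?case .
  qed
  \<comment> \<open>By \<open>stable\<close> the least index may be replaced by any \<open>j\<close>
    with \<open>y\<close> in \<open>A j\<close>. So \<open>Z\<close> is one fixed finite sum on each
    open set \<open>A j\<close>, and smoothness is a local matter.\<close>
  define Z where "Z y = (if y \<in> points M then Y (Suc (LEAST j. y \<in> A j)) y else 0)" for y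
  have Z: "Z y = Y (Suc j) y" if "y \<in> A j" for j y
  proof -
    have "y \<in> points M" using that A_open openin_subset by blast
    moreover have "y \<in> A (LEAST j. y \<in> A j)" "(LEAST j. y \<in> A j) \<le> j"
      using that by (auto intro: LeastI Least_le)
    ultimately show ?thesis using stable[of y "LEAST j. y \<in> A j" "Suc j"] by (simp add: Z_def)
  qed
  have cover_A: "\<exists>j. x \<in> A j" if "x \<in> points M" for x
  proof -
    have "x \<in> \<Union>\<V>" using that \<V>(3) by simp
    then obtain B where "B \<in> \<V>" "x \<in> B" by (rule UnionE)
    then have "B \<in> range A" using range_A by blast
    then show ?thesis using \<open>x \<in> B\<close> by blast
  qed
  have "Z \<in> vector_fields M"
  proof (rule M.vector_fieldsI_local)
    show "\<exists>Y\<in>vector_fields M. \<exists>W. openin (mtop M) W \<and> x \<in> W \<and> (\<forall>y\<in>W. Z y = Y y)"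
      if "x \<in> points M" for x
      using cover_A[OF that] Y A_open Z by blast
  qed (simp add: Z_def)
  moreover have "vf_projects_to M Q \<pi> Z X'"
    unfolding vf_projects_to_def
  proof
    fix x assume "x \<in> points M"
    then obtain j where j: "x \<in> A j" using cover_A by blast
    have "pushforward Q \<pi> (Z x) = tscale (1 - s (Suc j) x) (X' (\<pi> x))"
      using Z[OF j] push_Y by simp
    then show "pushforward Q \<pi> (Z x) = X' (\<pi> x)"
      using s0[OF j, of "Suc j"] by (simp add: tscale_def)
  qed
  ultimately show ?thesis by (rule that)
qed

end

section \<open>Descending functions and vector fields to the leaf space\<close>

lemma (in pos_manifold) chart_vector_inject:
  assumes U: "(U, \<phi>) \<in> charts M" "x \<in> U"
    and eq: "chart_vector M (U, \<phi>) x e = chart_vector M (U, \<phi>) x e'"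
  shows "e = e'"
proof -
  obtain W y where W: "openin (mtop M) W" "x \<in> W" "W \<subseteq> U"
    and y: "\<And>b. y b \<in> smooth_functions M" "\<And>b z. z \<in> W \<Longrightarrow> y b z = \<phi> z \<bullet> b"
    using coordinate_functions[OF U] by blast
  have "chart_vector M (U, \<phi>) x e (y b) = e \<bullet> b" for e b
    by (rule chart_vector_coordinate[OF U(1) W(2,1,3) y(1)]) (rule y(2))
  then have "e \<bullet> b = e' \<bullet> b" for b using eq by metis
  then show ?thesis by (rule euclidean_eqI)
qed

context pos_submersion
begin

text \<open>The chain rule translates pushforward of derivations into the derivative of the local
  representative. It turns surjectivity in the sense of \<open>submersion\<close> into surjectivity
  of a linear map between coordinate spaces.\<close>

lemma push_chart_vector:
  assumes U: "(U, \<phi>) \<in> atlas M" "x \<in> U" and V: "(V, \<psi>) \<in> atlas Q" "\<pi> x \<in> V"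
  shows "pushforward Q \<pi> (chart_vector M (U, \<phi>) x e) =
    chart_vector Q (V, \<psi>) (\<pi> x) (frechet_derivative (\<psi> \<circ> \<pi> \<circ> inv_into U \<phi>) (at (\<phi> x)) e)"
    (is "_ = chart_vector Q _ _ (?D e)")
proof -
  note U' = M.atlas_charts[OF U(1)] and V' = Q.atlas_charts[OF V(1)]
  let ?F = "\<psi> \<circ> \<pi> \<circ> inv_into U \<phi>" and ?W = "U \<inter> \<pi> -` V"
  have x: "x \<in> points M" using M.chart_subset[OF U'] U(2) by blast
  have xW: "\<phi> x \<in> \<phi> ` ?W" using U V by blast
  have F: "(?F has_derivative ?D) (at (\<phi> x))"
    by (rule smooth_on_has_derivative[OF representative_open(2)[OF U(1) V(1)]
          representative_smooth[OF U(1) V(1)] xW])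
  have Fx: "?F (\<phi> x) = \<psi> (\<pi> x)" by (simp add: M.chart_inv[OF U' U(2)])
  show ?thesis
  proof (rule tangent_space_eqI)
    show "pushforward Q \<pi> (chart_vector M (U, \<phi>) x e) \<in> tangent_space Q (\<pi> x)"
      by (rule push_tangent[OF x M.chart_vector_tangent[OF U' U(2)]])
    show "chart_vector Q (V, \<psi>) (\<pi> x) (?D e) \<in> tangent_space Q (\<pi> x)"
      by (rule Q.chart_vector_tangent[OF V' V(2)])
    fix g assume g: "g \<in> smooth_functions Q"
    let ?G = "\<lambda>e. chart_vector Q (V, \<psi>) (\<pi> x) e g"
    have "((g \<circ> inv_into V \<psi>) has_derivative ?G) (at (?F (\<phi> x)))"
      unfolding Fx by (rule Q.chart_vector_derivative[OF V' V(2) g])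
    then have "((\<lambda>z. (g \<circ> inv_into V \<psi>) (?F z)) has_derivative (\<lambda>e. ?G (?D e))) (at (\<phi> x))"
      by (rule has_derivative_compose[OF F])
    then have "(((g \<circ> \<pi>) \<circ> inv_into U \<phi>) has_derivative (\<lambda>e. ?G (?D e))) (at (\<phi> x))"
      by (rule has_derivative_transform_within_open[OF _ representative_open(2)[OF U(1) V(1)] xW])
        (auto simp: M.chart_inv[OF U'] Q.chart_inv[OF V'])
    then show "pushforward Q \<pi> (chart_vector M (U, \<phi>) x e) g = ?G (?D e)"
      using M.chart_vector_eqI[OF U' U(2) pullback_smooth[OF g]] by (simp add: pushforward_apply[OF g])
  qed
qed

text \<open>Near \<open>\<pi> x\<close> the inverse function theorem provides a local section of \<open>\<pi>\<close> that is
  differentiable at \<open>\<pi> x\<close>: invert \<open>\<pi>\<close> along the image of a right inverse of its derivative at \<open>x\<close>.\<close>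

lemma descent_differentiable:
  assumes V: "(V, \<psi>) \<in> atlas Q" "\<pi> x \<in> V" and x: "x \<in> points M"
    and h: "h \<in> smooth_functions M" "\<And>y. y \<in> points M \<Longrightarrow> h' (\<pi> y) = h y"
  shows "(h' \<circ> inv_into V \<psi>) differentiable (at (\<psi> (\<pi> x)))"
proof -
  obtain U \<phi> where U: "(U, \<phi>) \<in> atlas M" "x \<in> U" using M.atlas_cover[OF x] by blast
  note U' = M.atlas_charts[OF U(1)] and V' = Q.atlas_charts[OF V(1)]
  define F where "F = \<psi> \<circ> \<pi> \<circ> inv_into U \<phi>"
  define S where "S = \<phi> ` (U \<inter> \<pi> -` V)"
  define p where "p = \<phi> x"
  define q where "q = \<psi> (\<pi> x)"
  have S: "open S" and F: "smooth_on S F"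
    using representative_open(2)[OF U(1) V(1)] representative_smooth[OF U(1) V(1)]
    by (simp_all add: S_def F_def)
  have pS: "p \<in> S" using U V by (simp add: p_def S_def)
  have Fp: "F p = q" by (simp add: F_def p_def q_def M.chart_inv[OF U' U(2)])
  let ?D = "frechet_derivative F (at p)"
  have D: "(F has_derivative ?D) (at p)" by (rule smooth_on_has_derivative[OF S F pS])
  have "surj ?D"
    unfolding surj_def
  proof
    fix v :: 'f
    obtain u where u: "u \<in> tangent_space M x" "pushforward Q \<pi> u = chart_vector Q (V, \<psi>) (\<pi> x) v"
      using push_surj[OF x Q.chart_vector_tangent[OF V' V(2)]] by blast
    obtain e where "u = chart_vector M (U, \<phi>) x e"
      using M.tangent_eq_chart_vector[OF U' U(2) u(1)] by blast
    then have "chart_vector Q (V, \<psi>) (\<pi> x) (?D e) = chart_vector Q (V, \<psi>) (\<pi> x) v"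
      using push_chart_vector[OF U V] u(2) by (simp add: F_def p_def)
    then have "?D e = v" by (rule Q.chart_vector_inject[OF V' V(2)])
    then show "\<exists>e. v = ?D e" by blast
  qed
  then obtain A where A: "linear A" "?D \<circ> A = id"
    using linear_surjective_right_inverse[OF has_derivative_linear[OF D]] by blast
  note A_bl = A(1)[unfolded linear_conv_bounded_linear]
  \<comment> \<open>An affine slice through \<open>p\<close> along a right inverse of the
    derivative: restricted to it, \<open>F\<close> has derivative \<open>id\<close> at
    \<open>q\<close> and is locally invertible.\<close>
  define a where "a t = p + A (t - q)" for t
  have a: "smooth_on T a" if "open T" for T
  proof -
    have "smooth_on T (\<lambda>t. p + A (t + (- q)))"
      by (intro smooth_on_add smooth_on_const that smooth_on_bounded_linear[OF that A_bl]
          smooth_on_id)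
    then show ?thesis by (simp add: a_def[abs_def])
  qed
  have a_D: "(a has_derivative A) (at t)" for t
    unfolding a_def[abs_def]
    by (auto intro!: derivative_eq_intros bounded_linear.has_derivative[OF A_bl])
  have aq: "a q = p" using linear_0[OF A(1)] by (simp add: a_def)
  define T where "T = a -` S"
  have T: "open T"
    unfolding T_def
    by (rule open_vimage[OF S smooth_on_imp_continuous_on[OF a[OF open_UNIV]]])
  define G where "G t = F (a t)" for t
  have G: "smooth_on T G"
    unfolding G_def[abs_def] by (rule smooth_on_compose[OF T S a[OF T] F]) (simp add: T_def)
  have qT: "q \<in> T" using pS by (simp add: T_def aq)
  have Gq: "G q = q" by (simp add: G_def aq Fp)
  have "(G has_derivative (\<lambda>t. ?D (A t))) (at q)"
    unfolding G_def[abs_def] using has_derivative_compose[OF a_D, of F ?D q] D by (simp add: aq)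
  then have "(G has_derivative id) (at q)" using A(2) by (simp add: o_def)
  then have Gid: "frechet_derivative G (at q) = id"
    by (rule frechet_derivative_at[symmetric])
  have bl: "blinfun_apply (Blinfun (frechet_derivative G (at t))) = frechet_derivative G (at t)"
    if "t \<in> T" for t
    by (rule bounded_linear_Blinfun_apply[OF has_derivative_bounded_linear[OF
            smooth_on_has_derivative[OF T G that]]])
  have inv: "id_blinfun o\<^sub>L Blinfun (frechet_derivative G (at q)) = id_blinfun"
    by (rule blinfun_eqI) (simp only: blinfun_compose.rep_eq o_apply bl[OF qT], simp add: Gid)
  obtain T' N g g' where "open T'" and T': "T' \<subseteq> T" "q \<in> T'" and N: "open N" "G q \<in> N"
    and hom: "homeomorphism T' N G g" and g: "\<And>z. z \<in> N \<Longrightarrow> (g has_derivative (g' z)) (at z)"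
    using inverse_function_theorem[OF T _ continuous_on_frechet_derivative_blinfun[OF T G] qT inv]
      bl smooth_on_has_derivative[OF T G] by metis
  have gq: "g q = q" using homeomorphism_apply1[OF hom T'(2)] by (simp add: Gq)
  have hD: "((h \<circ> inv_into U \<phi>) has_derivative (\<lambda>e. chart_vector M (U, \<phi>) x e h)) (at (a (g q)))"
    unfolding gq aq p_def by (rule M.chart_vector_derivative[OF U' U(2) h(1)])
  have "((\<lambda>z. a (g z)) has_derivative (\<lambda>v. A (g' q v))) (at q)"
    using has_derivative_compose[OF g a_D] N(2) by (simp add: Gq)
  then have "((\<lambda>z. (h \<circ> inv_into U \<phi>) (a (g z))) has_derivative
      (\<lambda>v. chart_vector M (U, \<phi>) x (A (g' q v)) h)) (at q)"
    by (rule has_derivative_compose[where f = "\<lambda>z. a (g z)", OF _ hD])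
  \<comment> \<open>Following the local inverse \<open>g\<close> by the slice \<open>a\<close> gives
    the section; along it \<open>h'\<close> read in the chart equals \<open>h\<close>, because
    \<open>h\<close> is the pullback of \<open>h'\<close>.\<close>
  then have "((h' \<circ> inv_into V \<psi>) has_derivative
      (\<lambda>v. chart_vector M (U, \<phi>) x (A (g' q v)) h)) (at q)"
  proof (rule has_derivative_transform_within_open[OF _ N(1)])
    show "q \<in> N" using N(2) by (simp add: Gq)
    fix z assume "z \<in> N"
    then have "g z \<in> T'" "G (g z) = z"
      using homeomorphism_image2[OF hom] homeomorphism_apply2[OF hom] by auto
    then have "a (g z) \<in> S" "F (a (g z)) = z" using T'(1) by (auto simp: T_def G_def)
    then obtain y where y: "y \<in> U" "\<pi> y \<in> V" "a (g z) = \<phi> y" "F (\<phi> y) = z"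
      by (auto simp: S_def)
    then have "z = \<psi> (\<pi> y)" by (simp add: F_def M.chart_inv[OF U'])
    then have "(h' \<circ> inv_into V \<psi>) z = h' (\<pi> y)" using y(2) by (simp add: Q.chart_inv[OF V'])
    also have "\<dots> = h y" using h(2) y(1) M.chart_subset[OF U'] by blast
    finally show "(h \<circ> inv_into U \<phi>) (a (g z)) = (h' \<circ> inv_into V \<psi>) z"
      using y(1,3) by (simp add: M.chart_inv[OF U'])
  qed
  then show ?thesis unfolding q_def by (rule differentiableI)
qed

text \<open>Now that \<open>h'\<close> is known to be differentiable, the chain rule for its
  pullback \<open>h\<close> computes its derivative from any tangent vector above the given
  one.\<close>

lemma descent_derivative:
  assumes V: "(V, \<psi>) \<in> atlas Q" "\<pi> x \<in> V" and x: "x \<in> points M"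
    and h: "h \<in> smooth_functions M" "\<And>y. y \<in> points M \<Longrightarrow> h' (\<pi> y) = h y"
    and u: "u \<in> tangent_space M x" "pushforward Q \<pi> u = chart_vector Q (V, \<psi>) (\<pi> x) v"
  shows "frechet_derivative (h' \<circ> inv_into V \<psi>) (at (\<psi> (\<pi> x))) v = u h"
proof -
  obtain U \<phi> where U: "(U, \<phi>) \<in> atlas M" "x \<in> U" using M.atlas_cover[OF x] by blast
  note U' = M.atlas_charts[OF U(1)] and V' = Q.atlas_charts[OF V(1)]
  let ?F = "\<psi> \<circ> \<pi> \<circ> inv_into U \<phi>" and ?W = "U \<inter> \<pi> -` V"
  let ?D = "frechet_derivative ?F (at (\<phi> x))"
    and ?H = "frechet_derivative (h' \<circ> inv_into V \<psi>) (at (\<psi> (\<pi> x)))"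
  have xW: "\<phi> x \<in> \<phi> ` ?W" using U V by blast
  have F: "(?F has_derivative ?D) (at (\<phi> x))"
    by (rule smooth_on_has_derivative[OF representative_open(2)[OF U(1) V(1)]
          representative_smooth[OF U(1) V(1)] xW])
  obtain e where e: "u = chart_vector M (U, \<phi>) x e"
    using M.tangent_eq_chart_vector[OF U' U(2) u(1)] by blast
  then have "chart_vector Q (V, \<psi>) (\<pi> x) (?D e) = chart_vector Q (V, \<psi>) (\<pi> x) v"
    using push_chart_vector[OF U V] u(2) by simp
  then have De: "?D e = v" by (rule Q.chart_vector_inject[OF V' V(2)])
  have "((h' \<circ> inv_into V \<psi>) has_derivative ?H) (at (?F (\<phi> x)))"
    using iffD1[OF frechet_derivative_works descent_differentiable[OF V x h]]
    by (simp add: M.chart_inv[OF U' U(2)])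
  then have "((\<lambda>z. (h' \<circ> inv_into V \<psi>) (?F z)) has_derivative (\<lambda>e. ?H (?D e))) (at (\<phi> x))"
    by (rule has_derivative_compose[OF F])
  then have "((h \<circ> inv_into U \<phi>) has_derivative (\<lambda>e. ?H (?D e))) (at (\<phi> x))"
    by (rule has_derivative_transform_within_open[OF _ representative_open(2)[OF U(1) V(1)] xW])
      (use h(2) M.chart_subset[OF U'] in
        \<open>auto simp: M.chart_inv[OF U'] Q.chart_inv[OF V'] subset_iff\<close>)
  then show ?thesis
    unfolding e using M.chart_vector_eqI[OF U' U(2) h(1)] De by simp
qed

section \<open>Fields related by the projection\<close>

lemma projects_apply:
  assumes "vf_projects_to M Q \<pi> X X'" "g \<in> smooth_functions Q" "x \<in> points M"
  shows "X x (g \<circ> \<pi>) = X' (\<pi> x) g"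
  using assms by (metis vf_projects_to_def pushforward_apply)

text \<open>For related fields, differentiating a pullback gives the pullback of the derivative on
  \<open>points M\<close>; applying this twice handles both terms of the bracket.\<close>

lemma projects_lie_bracket:
  assumes X: "X \<in> vector_fields M" "X' \<in> vector_fields Q" "vf_projects_to M Q \<pi> X X'"
    and Y: "Y \<in> vector_fields M" "Y' \<in> vector_fields Q" "vf_projects_to M Q \<pi> Y Y'"
  shows "vf_projects_to M Q \<pi> (lie_bracket X Y) (lie_bracket X' Y')"
  unfolding vf_projects_to_def
proof
  fix x assume x: "x \<in> points M"
  have swap: "Z x (vf_apply W (g \<circ> \<pi>)) = Z' (\<pi> x) (vf_apply W' g)"
    if Z: "Z \<in> vector_fields M" "vf_projects_to M Q \<pi> Z Z'"
      and W: "W \<in> vector_fields M" "W' \<in> vector_fields Q" "vf_projects_to M Q \<pi> W W'"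
      and g: "g \<in> smooth_functions Q" for Z Z' W W' g
  proof -
    have "Z x (vf_apply W (g \<circ> \<pi>)) = Z x (vf_apply W' g \<circ> \<pi>)"
      using projects_apply[OF W(3) g]
      by (intro M.tangent_cong[OF vector_fieldsD(1)[OF Z(1) x] x]
          vector_fieldsD(3)[OF W(1) pullback_smooth[OF g]]) (simp add: vf_apply_def)
    then show ?thesis
      using projects_apply[OF Z(2) vector_fieldsD(3)[OF W(2) g] x] by simp
  qed
  show "pushforward Q \<pi> (lie_bracket X Y x) = lie_bracket X' Y' (\<pi> x)"
  proof (rule tangent_space_eqI)
    show "pushforward Q \<pi> (lie_bracket X Y x) \<in> tangent_space Q (\<pi> x)"
      by (rule push_tangent[OF x vector_fieldsD(1)[OF M.lie_bracket_vector_fields[OF X(1) Y(1)] x]])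
    show "lie_bracket X' Y' (\<pi> x) \<in> tangent_space Q (\<pi> x)"
      by (rule vector_fieldsD(1)[OF Q.lie_bracket_vector_fields[OF X(2) Y(2)] map_points[OF x]])
    show "pushforward Q \<pi> (lie_bracket X Y x) g = lie_bracket X' Y' (\<pi> x) g"
      if g: "g \<in> smooth_functions Q" for g
      using swap[OF X(1,3) Y g] swap[OF Y(1,3) X g]
      by (simp add: pushforward_apply[OF g] lie_bracket_def)
  qed
qed

end

section \<open>Foliations whose leaves are the fibres of a submersion\<close>

lemma span_subset_Basis:
  fixes B :: "'e::euclidean_space set"
  assumes "B \<subseteq> Basis"
  shows "e \<in> span B \<longleftrightarrow> (\<forall>b\<in>Basis - B. e \<bullet> b = 0)"
proof
  assume "e \<in> span B"
  then show "\<forall>b\<in>Basis - B. e \<bullet> b = 0"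
  proof (induction rule: span_induct_alt)
    case (step c b e)
    then show ?case using assms by (auto simp: inner_add_left inner_Basis)
  qed simp
next
  assume *: "\<forall>b\<in>Basis - B. e \<bullet> b = 0"
  have "(\<Sum>b\<in>Basis. (e \<bullet> b) *\<^sub>R b) \<in> span B"
  proof (rule span_sum)
    show "(e \<bullet> b) *\<^sub>R b \<in> span B" if "b \<in> Basis" for b
      using * that by (cases "b \<in> B") (auto intro: span_scale span_base span_zero)
  qed
  then show "e \<in> span B" by (simp add: euclidean_representation)
qed

text \<open>The forms are absent here: \<open>leaf_tangent\<close> is what nondegeneracy of the
  reduced form contributes, and \<open>fibres\<close> says that the points of \<open>Q\<close> are
  leaves.\<close>

locale foliated_submersion =
  pos_submersion M Q \<pi>
  for M :: "('a, 'e::euclidean_space) mfd" and Q :: "('b, 'f::euclidean_space) mfd" and \<pi> +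
  fixes k :: nat and \<F> :: "('a, 'e) fchart set"
  assumes foliation: "foliation M k \<F>"
    and leaf_tangent: "x \<in> points M \<Longrightarrow>
      leaf_tangent_space M \<F> x = {v \<in> tangent_space M x. pushforward Q \<pi> v = 0}"
    and fibres: "x \<in> points M \<Longrightarrow> y \<in> points M \<Longrightarrow> \<pi> x = \<pi> y \<longleftrightarrow> (same_plaque \<F>)\<^sup>*\<^sup>* x y"
    and surjective: "\<pi> ` points M = points Q"
begin

lemma foliation_chart:
  assumes "(U, \<phi>, B) \<in> \<F>"
  shows "(U, \<phi>) \<in> charts M" "convex (\<phi> ` U)" "B \<subseteq> Basis"
  using foliation assms by (auto simp: foliation_def)

lemma tangential_fields_iff:
  "Z \<in> tangential_fields M \<F> \<longleftrightarrow> Z \<in> vector_fields M \<and> vf_projects_to M Q \<pi> Z 0"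
  using vector_fieldsD(1) by (auto simp: tangential_fields_def vf_projects_to_def leaf_tangent)

text \<open>A tangential field is one related to 0, so its bracket with a lift of \<open>X'\<close>
  is related to the bracket of 0 with \<open>X'\<close>, which is 0.\<close>

lemma lift_projectable:
  assumes X: "X \<in> vector_fields M" "X' \<in> vector_fields Q" "vf_projects_to M Q \<pi> X X'"
  shows "X \<in> projectable_fields M \<F>"
  unfolding projectable_fields_def
proof (intro CollectI conjI ballI X(1))
  fix Z assume "Z \<in> tangential_fields M \<F>"
  then have Z: "Z \<in> vector_fields M" "vf_projects_to M Q \<pi> Z 0"
    by (simp_all add: tangential_fields_iff)
  have "lie_bracket 0 X' = 0"
  proof (rule vector_fields_eqI)
    show "lie_bracket 0 X' \<in> vector_fields Q" "0 \<in> vector_fields Q"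
      using X(2) by (auto intro: Q.lie_bracket_vector_fields Q.vector_fields_zero)
    show "lie_bracket 0 X' x = 0 x" if "x \<in> points Q" for x
      using Q.tangent_const[OF vector_fieldsD(1)[OF X(2) that]]
      by (simp add: lie_bracket_def vf_apply_def fun_eq_iff)
  qed
  then show "lie_bracket Z X \<in> tangential_fields M \<F>"
    using projects_lie_bracket[OF Z(1) Q.vector_fields_zero Z(2) X]
      M.lie_bracket_vector_fields[OF Z(1) X(1)]
    by (simp add: tangential_fields_iff)
qed

text \<open>The basic functions of the foliation. By \<open>basic_tangential\<close> and
  \<open>basicI\<close> they are the smooth functions annihilated by all tangential fields, the form
  in which projectable fields act on them.\<close>

definition basic :: "('a \<Rightarrow> real) \<Rightarrow> bool" where
  "basic h \<longleftrightarrow> h \<in> smooth_functions M \<and> (\<forall>x\<in>points M. \<forall>y\<in>points M. \<pi> x = \<pi> y \<longrightarrow> h x = h y)"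

text \<open>Moving from \<open>x\<close> along a straight line in a direction from
  \<open>span B\<close> leaves the transverse coordinates fixed. The line stays in one plaque, where
  \<open>h\<close> is constant, and its derivative at time 0 is the value of
  \<open>Z\<close>.\<close>

lemma basic_tangential:
  assumes h: "basic h" and Z: "Z \<in> tangential_fields M \<F>"
  shows "Z x h = 0"
proof (cases "x \<in> points M")
  case True
  then have "Z x \<in> leaf_tangent_space M \<F> x"
    using Z by (simp add: tangential_fields_def)
  then obtain U \<phi> B e where U: "(U, \<phi>, B) \<in> \<F>" "x \<in> U" and e: "e \<in> span B"
    and Zx: "Z x = chart_vector M (U, \<phi>) x e"
    by (auto simp: leaf_tangent_space_def)
  note U' = foliation_chart[OF U(1)]
  have hs: "h \<in> smooth_functions M" using h by (simp add: basic_def)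
  let ?h = "h \<circ> inv_into U \<phi>" and ?l = "\<lambda>t. \<phi> x + t *\<^sub>R e"
  have cont: "continuous_on UNIV ?l" by (intro continuous_intros)
  let ?T = "?l -` (\<phi> ` U)"
  have op: "open ?T"
    by (rule open_vimage[OF M.chart_open_image[OF U'(1)] cont])
  have T0: "0 \<in> ?T" using U(2) by simp
  have const: "h x = ?h (?l t)" if "t \<in> ?T" for t
  proof -
    obtain y where y: "y \<in> U" "?l t = \<phi> y" using \<open>t \<in> _\<close> by auto
    have "\<phi> x \<bullet> b = \<phi> y \<bullet> b" if "b \<in> Basis - B" for b
      using e that unfolding y(2)[symmetric] span_subset_Basis[OF U'(3)] by (simp add: inner_add_left)
    then have "same_plaque \<F> x y"
      using U y(1) unfolding same_plaque_def same_transverse_def by blast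
    moreover have "y \<in> points M" using M.chart_subset[OF U'(1)] y(1) by blast
    moreover have "\<pi> x = \<pi> y"
      using fibres[OF True] calculation r_into_rtranclp[of "same_plaque \<F>"] by blast
    ultimately have "h x = h y" using h True unfolding basic_def by blast
    then show ?thesis using y by (simp add: M.chart_inv[OF U'(1)])
  qed
  have "((\<lambda>t. ?h (?l t)) has_derivative (\<lambda>t. 0)) (at 0)"
    by (rule has_derivative_transform_within_open[OF has_derivative_const[of "h x"] op T0 const])
  moreover have "((\<lambda>t. ?h (?l t)) has_derivative
      (\<lambda>t. chart_vector M (U, \<phi>) x (t *\<^sub>R e) h)) (at 0)"
  proof (rule has_derivative_compose[of ?l "\<lambda>t. t *\<^sub>R e"])
    show "(?l has_derivative (\<lambda>t. t *\<^sub>R e)) (at 0)" by (auto intro!: derivative_eq_intros)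
    show "(?h has_derivative (\<lambda>e. chart_vector M (U, \<phi>) x e h)) (at (?l 0))"
      using M.chart_vector_derivative[OF U'(1) U(2) hs] by simp
  qed
  ultimately have "(\<lambda>t. 0) = (\<lambda>t. chart_vector M (U, \<phi>) x (t *\<^sub>R e) h)"
    by (rule has_derivative_unique)
  then show ?thesis unfolding Zx by (metis scaleR_one)
next
  case False
  then show ?thesis using Z vector_fieldsD(2) by (fastforce simp: tangential_fields_def)
qed

text \<open>Cut-off coordinate fields along the leaves are tangential, so all derivatives of
  \<open>h\<close> in directions of \<open>span B\<close> vanish. Convexity of the chart image
  provides a segment between two points of a plaque, on which \<open>h\<close> is constant; chains
  of plaques give the whole leaf.\<close>

lemma basicI:
  assumes h: "h \<in> smooth_functions M"
    and Z: "\<And>Z x. Z \<in> tangential_fields M \<F> \<Longrightarrow> x \<in> points M \<Longrightarrow> Z x h = 0"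
  shows "basic h"
proof -
  have zero: "chart_vector M (U, \<phi>) x e h = 0"
    if U: "(U, \<phi>, B) \<in> \<F>" "x \<in> U" and e: "e \<in> span B" for U \<phi> B x e
  proof -
    note U' = foliation_chart(1)[OF U(1)]
    obtain X W where X: "X \<in> vector_fields M" "x \<in> W"
      "\<And>y. y \<in> W \<Longrightarrow> X y = chart_vector M (U, \<phi>) y e"
      "\<And>y. y \<in> U \<Longrightarrow> \<exists>c. X y = chart_vector M (U, \<phi>) y (c *\<^sub>R e)"
      "\<And>y. y \<notin> U \<Longrightarrow> X y = 0"
      using M.chart_field[OF U' U(2), of e] by metis
    have "X y \<in> leaf_tangent_space M \<F> y" if y: "y \<in> points M" for y
    proof (cases "y \<in> U")
      case True
      then obtain c where "X y = chart_vector M (U, \<phi>) y (c *\<^sub>R e)" using X(4) by blast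
      then show ?thesis
        unfolding leaf_tangent_space_def using U(1) True span_scale[OF e] by blast
    next
      case False
      then show ?thesis
        using X(5) leaf_tangent[OF y] by (simp add: tangent_space_zero pushforward_zero)
    qed
    then have "X \<in> tangential_fields M \<F>" using X(1) by (simp add: tangential_fields_def)
    moreover have "x \<in> points M" using M.chart_subset[OF U'] U(2) by blast
    ultimately show ?thesis using Z X(2,3) by metis
  qed
  have plaque: "h x = h y" if "same_plaque \<F> x y" for x y
  proof -
    obtain U \<phi> B where U: "(U, \<phi>, B) \<in> \<F>" "x \<in> U" "y \<in> U" "same_transverse \<phi> B x y"
      using \<open>same_plaque \<F> x y\<close> by (auto simp: same_plaque_def)
    note U' = foliation_chart[OF U(1)]
    define e where "e = \<phi> y - \<phi> x"
    have e: "e \<in> span B"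
      unfolding span_subset_Basis[OF U'(3)] using U(4)
      by (auto simp: e_def same_transverse_def inner_diff_left)
    let ?h = "h \<circ> inv_into U \<phi>" and ?l = "\<lambda>t. \<phi> x + t *\<^sub>R e"
    have "((\<lambda>t. ?h (?l t)) has_field_derivative 0) (at t within {0..1})" if "t \<in> {0..1}" for t
    proof -
      have "?l t = (1 - t) *\<^sub>R \<phi> x + t *\<^sub>R \<phi> y" by (simp add: e_def algebra_simps)
      then have "?l t \<in> \<phi> ` U"
        using convexD_alt[OF U'(2), of "\<phi> x" "\<phi> y" t] U(2,3) that by auto
      then obtain z where z: "z \<in> U" "?l t = \<phi> z" by auto
      have "((\<lambda>t. ?h (?l t)) has_derivative (\<lambda>s. chart_vector M (U, \<phi>) z (s *\<^sub>R e) h)) (at t)"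
      proof (rule has_derivative_compose[of ?l "\<lambda>s. s *\<^sub>R e"])
        show "(?l has_derivative (\<lambda>s. s *\<^sub>R e)) (at t)" by (auto intro!: derivative_eq_intros)
        show "(?h has_derivative (\<lambda>e. chart_vector M (U, \<phi>) z e h)) (at (?l t))"
          unfolding z(2) by (rule M.chart_vector_derivative[OF U'(1) z(1) h])
      qed
      moreover have "chart_vector M (U, \<phi>) z (s *\<^sub>R e) h = 0" for s
        by (rule zero[OF U(1) z(1) span_scale[OF e]])
      ultimately have "((\<lambda>t. ?h (?l t)) has_derivative (\<lambda>s. 0)) (at t)" by simp
      then show ?thesis
        by (simp add: has_field_derivative_def lambda_zero[symmetric] has_derivative_at_withinI)
    qed
    then obtain c where "\<And>t. t \<in> {0..1} \<Longrightarrow> ?h (?l t) = c"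
      using has_field_derivative_zero_constant[of "{0..1}" "\<lambda>t. ?h (?l t)"] by auto
    from this[of 0] this[of 1] have "?h (?l 0) = ?h (?l 1)" by simp
    then show ?thesis using U(2,3) by (simp add: e_def M.chart_inv[OF U'(1)])
  qed
  have "h x = h y" if "(same_plaque \<F>)\<^sup>*\<^sup>* x y" for x y
    using that by induction (auto dest: plaque)
  then show ?thesis using h fibres unfolding basic_def by blast
qed

lemma basic_pullback: "g \<in> smooth_functions Q \<Longrightarrow> basic (g \<circ> \<pi>)"
  by (simp add: basic_def pullback_smooth)

text \<open>For tangential \<open>Z\<close>, Z(W h) = [Z, W] h + W(Z h); both terms vanish because
  the bracket is tangential and \<open>h\<close> is basic.\<close>

lemma basic_apply:
  assumes h: "basic h" and W: "W \<in> projectable_fields M \<F>"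
  shows "basic (vf_apply W h)"
proof (rule basicI)
  have WM: "W \<in> vector_fields M" using W by (simp add: projectable_fields_def)
  show "vf_apply W h \<in> smooth_functions M"
    using vector_fieldsD(3)[OF WM] h by (simp add: basic_def)
  fix Z x assume Z: "Z \<in> tangential_fields M \<F>" and x: "x \<in> points M"
  have "lie_bracket Z W \<in> tangential_fields M \<F>" using W Z by (simp add: projectable_fields_def)
  then have "lie_bracket Z W x h = 0" by (rule basic_tangential[OF h])
  moreover have "vf_apply Z h = (\<lambda>_. 0)"
    using basic_tangential[OF h Z] by (simp add: vf_apply_def)
  ultimately show "Z x (vf_apply W h) = 0"
    using M.tangent_const[OF vector_fieldsD(1)[OF WM x]] by (simp add: lie_bracket_def)
qed

text \<open>An arbitrary set-theoretic section of the projection, used only to evaluate data that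
  are constant on fibres.\<close>

definition point_over :: "'b \<Rightarrow> 'a" where
  "point_over q = (SOME x. x \<in> points M \<and> \<pi> x = q)"

lemma point_over:
  assumes "q \<in> points Q"
  shows "point_over q \<in> points M" "\<pi> (point_over q) = q"
proof -
  have "\<exists>x. x \<in> points M \<and> \<pi> x = q" using assms unfolding surjective[symmetric] by blast
  then have "point_over q \<in> points M \<and> \<pi> (point_over q) = q"
    unfolding point_over_def by (rule someI_ex)
  then show "point_over q \<in> points M" "\<pi> (point_over q) = q" by blast+
qed

lemma basic_point_over:
  assumes "basic h" "x \<in> points M"
  shows "h (point_over (\<pi> x)) = h x"
  using assms point_over[OF map_points[OF assms(2)]] unfolding basic_def by blast

text \<open>The derivative of the descended function along a coordinate field of \<open>Q\<close> is the descent of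
  the derivative along a lift of that field.\<close>

lemma basic_descends_Ck:
  assumes "basic h" "\<And>y. y \<in> points M \<Longrightarrow> h' (\<pi> y) = h y" "(V, \<psi>) \<in> atlas Q"
  shows "Ck_on n (\<psi> ` V) (h' \<circ> inv_into V \<psi>)"
  using assms(1,2)
proof (induction n arbitrary: h h')
  case 0
  note V = assms(3) and V' = Q.atlas_charts[OF assms(3)]
  have "isCont (h' \<circ> inv_into V \<psi>) z" if z: "z \<in> \<psi> ` V" for z
  proof -
    obtain q where q: "q \<in> V" "z = \<psi> q" using z by blast
    obtain x where x: "x \<in> points M" "q = \<pi> x"
      using Q.chart_subset[OF V'] surjective q(1) by blast
    have "h \<in> smooth_functions M" using 0(1) by (simp add: basic_def)
    then have "(h' \<circ> inv_into V \<psi>) differentiable (at z)"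
      unfolding q(2) x(2) using q(1) x
      by (intro descent_differentiable[of V \<psi> x h h'] V x(1) 0(2)) auto
    then show ?thesis by (rule differentiable_imp_continuous_within)
  qed
  then show ?case unfolding Ck_on.simps by (intro continuous_at_imp_continuous_on ballI)
next
  case (Suc n)
  note V = assms(3) and V' = Q.atlas_charts[OF assms(3)]
  have h: "h \<in> smooth_functions M" using Suc.prems(1) by (simp add: basic_def)
  have lift_pt: "\<exists>x\<in>points M. q = \<pi> x" if "q \<in> V" for q
    using Q.chart_subset[OF V'] surjective that by blast
  let ?h = "h' \<circ> inv_into V \<psi>"
  show ?case
  proof (rule Ck_on_SucI[OF Q.chart_open_image[OF V']])
    fix z assume "z \<in> \<psi> ` V"
    then obtain q where q: "q \<in> V" "z = \<psi> q" by blast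
    then obtain x where x: "x \<in> points M" "q = \<pi> x" using lift_pt by blast
    have "?h differentiable (at z)"
      unfolding q(2) x(2) using q(1) x
      by (intro descent_differentiable[of V \<psi> x h h'] V x(1) h Suc.prems(2)) auto
    then show "(?h has_derivative frechet_derivative ?h (at z)) (at z)"
      by (simp only: frechet_derivative_works)
  next
    fix v
    show "Ck_on n (\<psi> ` V) (\<lambda>z. frechet_derivative ?h (at z) v)"
    proof (rule Ck_on_local[OF Q.chart_open_image[OF V']])
      fix z assume "z \<in> \<psi> ` V"
      then obtain q where q: "q \<in> V" "z = \<psi> q" by blast
      \<comment> \<open>\<open>X'\<close> equals the coordinate field only near \<open>q\<close>, so
        the lift \<open>X\<close> and the descended derivative \<open>h1\<close> depend on
        \<open>q\<close> and the class is checked locally.\<close>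
      obtain X' W where X': "X' \<in> vector_fields Q" and W: "openin (mtop Q) W" "q \<in> W" "W \<subseteq> V"
        and X'W: "\<And>y. y \<in> W \<Longrightarrow> X' y = chart_vector Q (V, \<psi>) y v"
        using Q.chart_field[OF V' q(1), of v] by metis
      obtain X where X: "X \<in> vector_fields M" "vf_projects_to M Q \<pi> X X'"
        using global_lift[OF X'] by blast
      have basic: "basic (vf_apply X h)"
        by (rule basic_apply[OF Suc.prems(1) lift_projectable[OF X(1) X' X(2)]])
      define h1 where "h1 q = vf_apply X h (point_over q)" for q
      have h1: "h1 (\<pi> y) = vf_apply X h y" if "y \<in> points M" for y
        unfolding h1_def by (rule basic_point_over[OF basic that])
      have op: "open (\<psi> ` W)" by (rule Q.chart_open_map[OF V' W(1,3)])
      have "Ck_on n (\<psi> ` W) (h1 \<circ> inv_into V \<psi>)"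
        by (rule Ck_on_subset[OF Suc.IH[OF basic h1] Q.chart_open_image[OF V'] op])
          (use W(3) in auto)
      then have "Ck_on n (\<psi> ` W) (\<lambda>z. frechet_derivative ?h (at z) v)"
      proof (rule Ck_on_cong)
        fix z assume "z \<in> \<psi> ` W"
        then obtain y where y: "y \<in> W" "z = \<psi> y" by blast
        then have yV: "y \<in> V" using W(3) by blast
        then obtain x where x: "x \<in> points M" "y = \<pi> x" using lift_pt by blast
        have "frechet_derivative ?h (at (\<psi> (\<pi> x))) v = X x h"
        proof (rule descent_derivative[OF V _ x(1) h Suc.prems(2) vector_fieldsD(1)[OF X(1) x(1)]])
          show "\<pi> x \<in> V" using yV x(2) by simp
          show "pushforward Q \<pi> (X x) = chart_vector Q (V, \<psi>) (\<pi> x) v"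
            using X(2) x X'W[OF y(1)] by (simp add: vf_projects_to_def)
        qed
        then show "(h1 \<circ> inv_into V \<psi>) z = frechet_derivative ?h (at z) v"
          using h1[OF x(1)] x(2) y(2) Q.chart_inv[OF V' yV] by (simp add: vf_apply_def)
      qed
      then show "\<exists>T. open T \<and> z \<in> T \<and> Ck_on n T (\<lambda>z. frechet_derivative ?h (at z) v)"
        using op W(2) q(2) by blast
    qed
  qed
qed

lemma basic_descends:
  assumes "basic h" "\<And>y. y \<in> points M \<Longrightarrow> h' (\<pi> y) = h y"
  shows "h' \<in> smooth_functions Q"
  unfolding smooth_functions_def smooth_on_def using basic_descends_Ck[OF assms] by blast

text \<open>For smooth \<open>g\<close> on \<open>Q\<close>, the derivative of its pullback along
  \<open>W\<close> is basic. Hence the projected vectors agree along each fibre, and the resulting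
  field maps smooth functions to smooth functions.\<close>

lemma projectable_descends:
  assumes W: "W \<in> projectable_fields M \<F>"
  obtains W' where "W' \<in> vector_fields Q" "vf_projects_to M Q \<pi> W W'"
proof -
  have WM: "W \<in> vector_fields M" using W by (simp add: projectable_fields_def)
  define W' where "W' q = (if q \<in> points Q then pushforward Q \<pi> (W (point_over q)) else 0)" for q
  have basic: "basic (vf_apply W (g \<circ> \<pi>))" if "g \<in> smooth_functions Q" for g
    by (rule basic_apply[OF basic_pullback[OF that] W])
  have T: "pushforward Q \<pi> (W x) \<in> tangent_space Q (\<pi> x)" if "x \<in> points M" for x
    by (rule push_tangent[OF that vector_fieldsD(1)[OF WM that]])
  have W'T: "W' q \<in> tangent_space Q q" if "q \<in> points Q" for q
    using T[of "point_over q"] point_over[OF that] that by (simp add: W'_def)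
  have eq: "pushforward Q \<pi> (W x) = W' (\<pi> x)" if x: "x \<in> points M" for x
  proof (rule tangent_space_eqI[OF T[OF x] W'T[OF map_points[OF x]]])
    fix g assume g: "g \<in> smooth_functions Q"
    show "pushforward Q \<pi> (W x) g = W' (\<pi> x) g"
      using basic_point_over[OF basic[OF g] x] map_points[OF x]
      by (simp add: W'_def pushforward_apply[OF g] vf_apply_def)
  qed
  have "(\<lambda>q. W' q g) \<in> smooth_functions Q" if g: "g \<in> smooth_functions Q" for g
  proof (rule basic_descends[OF basic[OF g]])
    show "W' (\<pi> y) g = vf_apply W (g \<circ> \<pi>) y" if "y \<in> points M" for y
      using eq[OF that] by (simp add: pushforward_apply[OF g, symmetric] vf_apply_def)
  qed
  then have "W' \<in> vector_fields Q"
    using W'T by (simp add: vector_fields_def) (simp add: W'_def)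
  then show ?thesis using that eq by (simp add: vf_projects_to_def)
qed

end

section \<open>The induced connection\<close>

lemma projects_add:
  "vf_projects_to M Q \<pi> X X' \<Longrightarrow> vf_projects_to M Q \<pi> Y Y' \<Longrightarrow> vf_projects_to M Q \<pi> (X + Y) (X' + Y')"
  by (simp add: vf_projects_to_def pushforward_add)

lemma projects_diff:
  "vf_projects_to M Q \<pi> X X' \<Longrightarrow> vf_projects_to M Q \<pi> Y Y' \<Longrightarrow> vf_projects_to M Q \<pi> (X - Y) (X' - Y')"
  by (simp add: vf_projects_to_def pushforward_diff)

lemma projects_scale:
  "vf_projects_to M Q \<pi> X X' \<Longrightarrow> (\<And>x. x \<in> points M \<Longrightarrow> f x = f' (\<pi> x)) \<Longrightarrow>
    vf_projects_to M Q \<pi> (vf_scale f X) (vf_scale f' X')"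
  by (simp add: vf_projects_to_def vf_scale_def pushforward_scale)

lemma (in pos_manifold) lie_bracket_zero:
  assumes "X \<in> vector_fields M"
  shows "lie_bracket X 0 = 0"
proof (rule vector_fields_eqI[OF lie_bracket_vector_fields[OF assms vector_fields_zero] vector_fields_zero])
  show "lie_bracket X 0 x = 0 x" if "x \<in> points M" for x
    using tangent_const[OF vector_fieldsD(1)[OF assms that]]
    by (simp add: lie_bracket_def vf_apply_def fun_eq_iff)
qed

locale foliated_connection =
  foliated_submersion M Q \<pi> k \<F>
  for M :: "('a, 'e::euclidean_space) mfd" and Q :: "('b, 'f::euclidean_space) mfd" and \<pi> k \<F> +
  fixes nab :: "'a connection"
  assumes projectable: "projectable_connection M \<F> nab"
    and torsion: "X \<in> vector_fields M \<Longrightarrow> Y \<in> vector_fields M \<Longrightarrow> vf_projects_to M Q \<pi> (torsion nab X Y) 0"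
begin

lemma linear_connection: "linear_connection M nab"
  using projectable by (simp add: projectable_connection_def adapted_connection_def)

lemma nab_vector_fields: "X \<in> vector_fields M \<Longrightarrow> Y \<in> vector_fields M \<Longrightarrow> nab X Y \<in> vector_fields M"
  and nab_add_left: "X \<in> vector_fields M \<Longrightarrow> Y \<in> vector_fields M \<Longrightarrow> Z \<in> vector_fields M \<Longrightarrow>
    nab (X + Y) Z = nab X Z + nab Y Z"
  and nab_add_right: "X \<in> vector_fields M \<Longrightarrow> Y \<in> vector_fields M \<Longrightarrow> Z \<in> vector_fields M \<Longrightarrow>
    nab X (Y + Z) = nab X Y + nab X Z"
  and nab_scale: "f \<in> smooth_functions M \<Longrightarrow> X \<in> vector_fields M \<Longrightarrow> Y \<in> vector_fields M \<Longrightarrow>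
    nab (vf_scale f X) Y = vf_scale f (nab X Y)"
  and nab_leibniz: "f \<in> smooth_functions M \<Longrightarrow> X \<in> vector_fields M \<Longrightarrow> Y \<in> vector_fields M \<Longrightarrow>
    nab X (vf_scale f Y) = vf_scale (vf_apply X f) Y + vf_scale f (nab X Y)"
  using linear_connection unfolding linear_connection_def by blast+

text \<open>Including membership in the field spaces makes the relation determine \<open>X'\<close>
  (\<open>lifts_unique\<close>) and compatible with sums, multiples and brackets. Identities on
  \<open>Q\<close> are then proved by exhibiting a common lift of both sides.\<close>

definition lifts :: "'a vfield \<Rightarrow> 'b vfield \<Rightarrow> bool" where
  "lifts X X' \<longleftrightarrow> X \<in> vector_fields M \<and> X' \<in> vector_fields Q \<and> vf_projects_to M Q \<pi> X X'"

lemma lifts_unique: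
  assumes "lifts X X'" "lifts X Y'"
  shows "X' = Y'"
proof (rule vector_fields_eqI)
  show "X' \<in> vector_fields Q" "Y' \<in> vector_fields Q" using assms by (simp_all add: lifts_def)
  show "X' q = Y' q" if "q \<in> points Q" for q
  proof -
    have "q \<in> \<pi> ` points M" using that surjective by simp
    then obtain x where x: "q = \<pi> x" "x \<in> points M" by (rule imageE)
    have "pushforward Q \<pi> (X x) = X' (\<pi> x)" "pushforward Q \<pi> (X x) = Y' (\<pi> x)"
      using assms x(2) by (simp_all add: lifts_def vf_projects_to_def)
    then show ?thesis unfolding x(1) by simp
  qed
qed

lemma lifts_exists: "X' \<in> vector_fields Q \<Longrightarrow> \<exists>X. lifts X X'"
  using global_lift unfolding lifts_def by blast

lemma lifts_add: "lifts X X' \<Longrightarrow> lifts Y Y' \<Longrightarrow> lifts (X + Y) (X' + Y')"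
  by (simp add: lifts_def M.vector_fields_add Q.vector_fields_add projects_add)

lemma lifts_diff: "lifts X X' \<Longrightarrow> lifts Y Y' \<Longrightarrow> lifts (X - Y) (X' - Y')"
  by (simp add: lifts_def M.vector_fields_diff Q.vector_fields_diff projects_diff)

lemma lifts_scale:
  "lifts X X' \<Longrightarrow> f \<in> smooth_functions M \<Longrightarrow> f' \<in> smooth_functions Q \<Longrightarrow>
    (\<And>x. x \<in> points M \<Longrightarrow> f x = f' (\<pi> x)) \<Longrightarrow> lifts (vf_scale f X) (vf_scale f' X')"
  by (simp add: lifts_def M.vector_fields_scale Q.vector_fields_scale projects_scale)

lemma lifts_lie_bracket: "lifts X X' \<Longrightarrow> lifts Y Y' \<Longrightarrow> lifts (lie_bracket X Y) (lie_bracket X' Y')"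
  by (simp add: lifts_def M.lie_bracket_vector_fields Q.lie_bracket_vector_fields projects_lie_bracket)

lemma lifts_zero_iff: "lifts Z 0 \<longleftrightarrow> Z \<in> tangential_fields M \<F>"
  by (simp add: lifts_def tangential_fields_iff Q.vector_fields_zero)

lemma lifts_projectable: "lifts X X' \<Longrightarrow> X \<in> projectable_fields M \<F>"
  unfolding lifts_def using lift_projectable by blast

lemma nab_tangential_left:
  "lifts Z 0 \<Longrightarrow> lifts Y Y' \<Longrightarrow> lifts (nab Z Y) 0"
  using projectable lifts_projectable
  by (simp add: lifts_zero_iff projectable_connection_def adapted_connection_def)

text \<open>Adaptedness only controls \<open>nab Z X\<close> for tangential \<open>Z\<close>; the torsion takes care of \<open>nab X Z\<close>.\<close>

lemma nab_tangential_right: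
  assumes X: "lifts X X'" and Z: "lifts Z 0"
  shows "lifts (nab X Z) 0"
proof -
  have XZ: "X \<in> vector_fields M" "Z \<in> vector_fields M" and X': "X' \<in> vector_fields Q"
    using assms by (simp_all add: lifts_def)
  have "torsion nab X Z \<in> vector_fields M"
    unfolding torsion_def
    by (intro M.vector_fields_diff nab_vector_fields M.lie_bracket_vector_fields XZ)
  then have T: "lifts (torsion nab X Z) 0"
    using torsion[OF XZ] by (simp add: lifts_def Q.vector_fields_zero)
  have "lifts (lie_bracket X Z) 0"
    using lifts_lie_bracket[OF X Z] by (simp add: Q.lie_bracket_zero[OF X'])
  from lifts_add[OF lifts_add[OF T nab_tangential_left[OF Z X]] this]
  show ?thesis by (simp add: torsion_def)
qed

lemma nab_lifts_exists:
  assumes "lifts X X'" "lifts Y Y'"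
  shows "\<exists>W'. lifts (nab X Y) W'"
proof -
  have "nab X Y \<in> projectable_fields M \<F>"
    using projectable lifts_projectable[OF assms(1)] lifts_projectable[OF assms(2)]
    by (simp add: projectable_connection_def)
  then show ?thesis
    using projectable_descends[of "nab X Y"] unfolding lifts_def projectable_fields_def by blast
qed

text \<open>Two lifts of one field differ by a tangential field. Changing the arguments one at a
  time adds a term with a tangential left argument and one with a tangential right argument, and
  both project to 0.\<close>

lemma nab_lifts_cong:
  assumes X: "lifts X X'" "lifts X1 X'" and Y: "lifts Y Y'" "lifts Y1 Y'" and W: "lifts (nab X1 Y1) W'"
  shows "lifts (nab X Y) W'"
proof -
  have vf: "X \<in> vector_fields M" "X1 \<in> vector_fields M" "Y \<in> vector_fields M" "Y1 \<in> vector_fields M"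
    using X Y by (simp_all add: lifts_def)
  have X0: "lifts (X - X1) 0" and Y0: "lifts (Y - Y1) 0"
    using lifts_diff[OF X] lifts_diff[OF Y] by simp_all
  have "nab X Y = nab (X - X1) Y + nab X1 Y"
    using nab_add_left[OF M.vector_fields_diff[OF vf(1,2)] vf(2,3)] by simp
  also have "nab X1 Y = nab X1 (Y - Y1) + nab X1 Y1"
    using nab_add_right[OF vf(2) M.vector_fields_diff[OF vf(3,4)] vf(4)] by simp
  finally have eq: "nab X Y = nab (X - X1) Y + (nab X1 (Y - Y1) + nab X1 Y1)" .
  show ?thesis
    unfolding eq
    using lifts_add[OF nab_tangential_left[OF X0 Y(1)] lifts_add[OF nab_tangential_right[OF X(2) Y0] W]]
    by simp
qed

definition induced :: "'b connection" where
  "induced X' Y' = (SOME W'. \<exists>X Y. lifts X X' \<and> lifts Y Y' \<and> lifts (nab X Y) W')"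

lemma lifts_induced:
  assumes "lifts X X'" "lifts Y Y'"
  shows "lifts (nab X Y) (induced X' Y')"
proof -
  have "\<exists>W' X Y. lifts X X' \<and> lifts Y Y' \<and> lifts (nab X Y) W'"
    using nab_lifts_exists[OF assms] assms by blast
  from someI_ex[OF this]
  have "\<exists>X Y. lifts X X' \<and> lifts Y Y' \<and> lifts (nab X Y) (induced X' Y')"
    unfolding induced_def .
  then show ?thesis using nab_lifts_cong assms by blast
qed

lemma lifts_vf_apply:
  assumes "lifts X X'" "f \<in> smooth_functions Q" "x \<in> points M"
  shows "vf_apply X (f \<circ> \<pi>) x = vf_apply X' f (\<pi> x)"
  using assms projects_apply by (simp add: lifts_def vf_apply_def)

lemma induced_linear_connection: "linear_connection Q induced"
  unfolding linear_connection_def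
proof (intro conjI ballI)
  fix X' Y' assume X': "X' \<in> vector_fields Q" and Y': "Y' \<in> vector_fields Q"
  obtain X Y where X: "lifts X X'" and Y: "lifts Y Y'" using lifts_exists X' Y' by blast
  have vf: "X \<in> vector_fields M" "Y \<in> vector_fields M" using X Y by (simp_all add: lifts_def)
  note XY = lifts_induced[OF X Y]
  show "induced X' Y' \<in> vector_fields Q" using XY by (simp add: lifts_def)
  {
    fix Z' assume Z': "Z' \<in> vector_fields Q"
    then obtain Z where Z: "lifts Z Z'" using lifts_exists by blast
    have vZ: "Z \<in> vector_fields M" using Z by (simp add: lifts_def)
    show "induced (X' + Y') Z' = induced X' Z' + induced Y' Z'"
      using lifts_induced[OF lifts_add[OF X Y] Z]
        lifts_add[OF lifts_induced[OF X Z] lifts_induced[OF Y Z]]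
      by (simp add: nab_add_left[OF vf vZ] lifts_unique)
    show "induced X' (Y' + Z') = induced X' Y' + induced X' Z'"
      using lifts_induced[OF X lifts_add[OF Y Z]] lifts_add[OF XY lifts_induced[OF X Z]]
      by (simp add: nab_add_right[OF vf vZ] lifts_unique)
  }
  fix f assume f: "f \<in> smooth_functions Q"
  note fM = pullback_smooth[OF f]
  have scale: "lifts (vf_scale (f \<circ> \<pi>) Z) (vf_scale f Z')" if "lifts Z Z'" for Z Z'
    by (rule lifts_scale[OF that fM f]) simp
  show "induced (vf_scale f X') Y' = vf_scale f (induced X' Y')"
    using lifts_induced[OF scale[OF X] Y] scale[OF XY]
    by (simp add: nab_scale[OF fM vf] lifts_unique)
  \<comment> \<open>The coefficient on \<open>M\<close> agrees with a pullback on
    \<open>points M\<close> only, which is all that \<open>lifts_scale\<close> asks for.\<close>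
  have "lifts (vf_scale (vf_apply X (f \<circ> \<pi>)) Y) (vf_scale (vf_apply X' f) Y')"
    by (rule lifts_scale[OF Y vector_fieldsD(3)[OF vf(1) fM] vector_fieldsD(3)[OF X' f]])
      (rule lifts_vf_apply[OF X f])
  from lifts_add[OF this scale[OF XY]] lifts_induced[OF X scale[OF Y]]
  show "induced X' (vf_scale f Y') = vf_scale (vf_apply X' f) Y' + vf_scale f (induced X' Y')"
    by (simp add: nab_leibniz[OF fM vf] lifts_unique)
qed

lemma induces_connection: "induces_connection M \<F> Q \<pi> nab induced"
  unfolding induces_connection_def
proof (intro conjI ballI impI induced_linear_connection)
  fix X' assume "X' \<in> vector_fields Q"
  then obtain X where "lifts X X'" using lifts_exists by blast
  then show "\<exists>X\<in>projectable_fields M \<F>. vf_projects_to M Q \<pi> X X'"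
    using lifts_projectable by (auto simp: lifts_def)
next
  fix X' Y' X Y
  assume "X' \<in> vector_fields Q" "Y' \<in> vector_fields Q"
    "X \<in> projectable_fields M \<F>" "Y \<in> projectable_fields M \<F>"
    "vf_projects_to M Q \<pi> X X' \<and> vf_projects_to M Q \<pi> Y Y'"
  then have "lifts X X'" "lifts Y Y'" by (auto simp: lifts_def projectable_fields_def)
  then show "vf_projects_to M Q \<pi> (nab X Y) (induced X' Y')"
    using lifts_induced by (simp add: lifts_def)
qed

text \<open>The torsion of \<open>nab\<close> lifts the torsion of \<open>induced\<close>, and being
  tangential it also lifts 0.\<close>

lemma induced_torsion_free:
  assumes "X' \<in> vector_fields Q" "Y' \<in> vector_fields Q"
  shows "torsion induced X' Y' = 0"
proof -
  obtain X Y where X: "lifts X X'" and Y: "lifts Y Y'" using lifts_exists assms by blast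
  have vf: "X \<in> vector_fields M" "Y \<in> vector_fields M" using X Y by (simp_all add: lifts_def)
  have T: "lifts (torsion nab X Y) (torsion induced X' Y')"
    unfolding torsion_def
    by (intro lifts_diff lifts_induced lifts_lie_bracket X Y)
  then have "lifts (torsion nab X Y) 0"
    using torsion[OF vf] by (simp add: lifts_def Q.vector_fields_zero)
  with T show ?thesis by (rule lifts_unique)
qed

text \<open>Evaluated on lifts, each of the three terms of the covariant derivative of
  \<open>\<omega>\<close> at \<open>x\<close> equals the corresponding term for
  \<open>\<omega>'\<close> at the image point, because \<open>\<omega>\<close> is the
  pullback.\<close>

lemma induced_parallel:
  assumes \<omega>: "parallel_form2 M nab \<omega>" "smooth_form2 M \<omega>" and \<omega>': "smooth_form2 Q \<omega>'"
    and pullback: "\<And>x u v. x \<in> points M \<Longrightarrow> u \<in> tangent_space M x \<Longrightarrow> v \<in> tangent_space M x \<Longrightarrow>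
      \<omega>' (\<pi> x) (pushforward Q \<pi> u) (pushforward Q \<pi> v) = \<omega> x u v"
  shows "parallel_form2 Q induced \<omega>'"
  unfolding parallel_form2_def
proof (intro ballI)
  fix X' Y' Z' q
  assume vf': "X' \<in> vector_fields Q" "Y' \<in> vector_fields Q" "Z' \<in> vector_fields Q"
    and "q \<in> points Q"
  then obtain x where x: "x \<in> points M" "q = \<pi> x" using surjective by blast
  obtain X Y Z where l: "lifts X X'" "lifts Y Y'" "lifts Z Z'"
    using lifts_exists[OF vf'(1)] lifts_exists[OF vf'(2)] lifts_exists[OF vf'(3)] by blast
  have vf: "X \<in> vector_fields M" "Y \<in> vector_fields M" "Z \<in> vector_fields M"
    using l by (simp_all add: lifts_def)
  have form_eq: "form2_apply \<omega>' A' B' (\<pi> y) = form2_apply \<omega> A B y"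
    if "lifts A A'" "lifts B B'" "y \<in> points M" for A A' B B' y
  proof -
    have "A y \<in> tangent_space M y" "B y \<in> tangent_space M y"
      "pushforward Q \<pi> (A y) = A' (\<pi> y)" "pushforward Q \<pi> (B y) = B' (\<pi> y)"
      using that vector_fieldsD(1) by (auto simp: lifts_def vf_projects_to_def)
    then show ?thesis using pullback[OF that(3), of "A y" "B y"] by (simp add: form2_apply_def)
  qed
  have sm: "form2_apply \<omega>' Y' Z' \<in> smooth_functions Q" "form2_apply \<omega> Y Z \<in> smooth_functions M"
    using \<omega>(2) \<omega>' vf vf' unfolding smooth_form2_def by blast+
  have "X' (\<pi> x) (form2_apply \<omega>' Y' Z') = X x (form2_apply \<omega>' Y' Z' \<circ> \<pi>)"
    using lifts_vf_apply[OF l(1) sm(1) x(1)] by (simp add: vf_apply_def)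
  also have "\<dots> = X x (form2_apply \<omega> Y Z)"
    using form_eq[OF l(2,3)]
    by (intro M.tangent_cong[OF vector_fieldsD(1)[OF vf(1) x(1)] x(1)] pullback_smooth[OF sm(1)]) simp
  finally have "cov_deriv_form2 induced \<omega>' X' Y' Z' (\<pi> x) = cov_deriv_form2 nab \<omega> X Y Z x"
    using form_eq[OF lifts_induced[OF l(1,2)] l(3) x(1)] form_eq[OF l(2) lifts_induced[OF l(1,3)] x(1)]
    by (simp add: cov_deriv_form2_def)
  then show "cov_deriv_form2 induced \<omega>' X' Y' Z' q = 0"
    using \<omega>(1) vf x by (simp add: parallel_form2_def)
qed

end

section \<open>Manifolds with trivial tangent spaces\<close>

text \<open>The filter \<open>at 0 within {0}\<close> is trivial, so every map is differentiable
  there, and so is every choice of its derivative.\<close>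

lemma smooth_on_zero:
  assumes "S \<subseteq> {0}"
  shows "smooth_on S f"
proof -
  have S: "S = {} \<or> S = {0}" using assms by blast
  have "Ck_on k S f" for k
  proof (induction k arbitrary: f)
    case 0
    then show ?case using S by auto
  next
    case (Suc k)
    have "(f has_derivative (\<lambda>_. 0)) (at 0 within {0})"
      by (simp add: has_derivative_def at_within_def)
    then have "f differentiable_on S"
      using S by (auto simp: differentiable_on_def intro: differentiableI)
    then show ?case using Suc by simp
  qed
  then show ?thesis by (simp add: smooth_on_def)
qed

lemma smooth_functions_zero_dim:
  assumes "smooth_manifold M" "mdim M = 0"
  shows "f \<in> smooth_functions M"
proof -
  have "\<phi> ` U \<subseteq> {0}" if "(U, \<phi>) \<in> atlas M" for U \<phi>
  proof -
    have "(U, \<phi>) \<in> charts M" using assms(1) that by (auto simp: smooth_manifold_def)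
    then have "openin (top_of_set (model_space (mdim M))) (\<phi> ` U)"
      unfolding charts_def by blast
    then show ?thesis using openin_imp_subset assms(2) by (fastforce simp: model_space_def)
  qed
  then show ?thesis unfolding smooth_functions_def using smooth_on_zero by blast
qed

text \<open>In dimension 0 every function is smooth, including the indicator \<open>d\<close> of
  \<open>x\<close>. Since f d = f(x) d, the Leibniz rule and homogeneity evaluate the same function
  in two ways and leave \<open>v f = 0\<close>.\<close>

lemma tangent_space_zero_dim:
  assumes "smooth_manifold M" "mdim M = 0" "v \<in> tangent_space M x"
  shows "v = 0"
proof
  fix f
  note sm = smooth_functions_zero_dim[OF assms(1,2)]
  define d where "d y = (if y = x then 1 else 0 :: real)" for y
  have "(\<lambda>y. f y * d y) = (\<lambda>y. f x * d y)" by (auto simp: d_def)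
  then show "v f = 0 f"
    using tangent_space_mult[OF assms(3) sm sm, of f d] tangent_space_cmult[OF assms(3) sm, of "f x" d]
    by (simp add: d_def)
qed

lemma zero_in_vector_fields:
  assumes "smooth_manifold M"
  shows "0 \<in> vector_fields M"
proof (cases "mdim M = 0")
  case True
  then show ?thesis
    using smooth_functions_zero_dim[OF assms] by (simp add: vector_fields_def tangent_space_zero)
next
  case False
  then show ?thesis using pos_manifold.vector_fields_zero pos_manifold.intro assms by blast
qed

lemma tangent_zero_function: "v \<in> tangent_space M x \<Longrightarrow> v (\<lambda>_. 0) = 0"
  using tangent_space_cmult[of v M x "\<lambda>_. 0" 0] tangent_space_outside[of v M x "\<lambda>_. 0"] by auto

lemma vf_scale_zero: "vf_scale f 0 = 0"
  by (simp add: vf_scale_def tscale_def fun_eq_iff)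

lemma torsion_zero: "torsion (\<lambda>_ _. 0) 0 0 = 0"
  by (simp add: torsion_def lie_bracket_def fun_eq_iff)

text \<open>This serves the cases outside \<open>pos_manifold\<close>. If all tangent spaces of
  \<open>Q\<close> are trivial, 0 is its only vector field, every field on \<open>M\<close> lifts
  it, and every condition on the connection reduces to one about 0.\<close>

lemma induces_zero_connection:
  assumes M: "smooth_manifold M" and Q: "smooth_manifold Q" "smooth_form2 Q \<omega>'"
    and sub: "submersion M Q \<pi>" and nab: "linear_connection M nab"
    and leaf: "\<And>x. x \<in> points M \<Longrightarrow> 0 \<in> leaf_tangent_space M \<F> x"
    and pts: "\<And>x. x \<in> points M \<Longrightarrow> \<pi> x \<in> points Q"
    and trivial: "\<And>q v. q \<in> points Q \<Longrightarrow> v \<in> tangent_space Q q \<Longrightarrow> v = 0"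
  shows "induces_connection M \<F> Q \<pi> nab (\<lambda>_ _. 0) \<and> symplectic_connection Q \<omega>' (\<lambda>_ _. 0)"
proof -
  have zero: "X' = 0" if "X' \<in> vector_fields Q" for X'
  proof
    show "X' q = 0 q" for q
      using vector_fieldsD(1,2)[OF that, of q] trivial[of q] by (cases "q \<in> points Q") auto
  qed
  have lin: "linear_connection Q (\<lambda>_ _. 0)"
    unfolding linear_connection_def
    using zero_in_vector_fields[OF Q(1)] by (auto dest!: zero simp: vf_scale_zero)
  have lb: "lie_bracket Z 0 = 0" if "Z \<in> vector_fields M" for Z
  proof (intro ext)
    fix x f
    show "lie_bracket Z 0 x f = 0 x f"
      using vector_fieldsD(1,2)[OF that, of x] tangent_zero_function[of "Z x" M x]
      by (cases "x \<in> points M") (simp_all add: lie_bracket_def vf_apply_def)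
  qed
  have zM: "0 \<in> vector_fields M" by (rule zero_in_vector_fields[OF M])
  then have "0 \<in> tangential_fields M \<F>" using leaf by (simp add: tangential_fields_def)
  then have z: "0 \<in> projectable_fields M \<F>"
    using zM lb by (simp add: projectable_fields_def) (simp add: tangential_fields_def)
  have proj: "vf_projects_to M Q \<pi> X 0" if X: "X \<in> vector_fields M" for X
    unfolding vf_projects_to_def
  proof
    fix x assume x: "x \<in> points M"
    have "pushforward Q \<pi> (X x) \<in> tangent_space Q (\<pi> x)"
      using sub x vector_fieldsD(1)[OF X x] unfolding submersion_def by blast
    then show "pushforward Q \<pi> (X x) = 0 (\<pi> x)" using trivial[OF pts[OF x]] by simp
  qed
  have "induces_connection M \<F> Q \<pi> nab (\<lambda>_ _. 0)"
    unfolding induces_connection_def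
  proof (intro conjI lin ballI impI)
    show "\<exists>X\<in>projectable_fields M \<F>. vf_projects_to M Q \<pi> X X'" if "X' \<in> vector_fields Q" for X'
      using z proj[OF zM] zero[OF that] by blast
    show "vf_projects_to M Q \<pi> (nab X Y) 0"
      if "X \<in> projectable_fields M \<F>" "Y \<in> projectable_fields M \<F>" for X Y
      using that nab by (intro proj) (simp add: projectable_fields_def linear_connection_def)
  qed
  moreover have "symplectic_connection Q \<omega>' (\<lambda>_ _. 0)"
  proof -
    \<comment> \<open>Additivity of the form in its first argument, applied to
      \<open>0 + 0\<close>.\<close>
    have "\<omega>' q 0 0 = 0" if "q \<in> points Q" for q
      using Q(2) that tangent_space_zero[of Q q] unfolding smooth_form2_def
      by (metis add.right_neutral add_left_cancel)
    then have "parallel_form2 Q (\<lambda>_ _. 0) \<omega>'"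
      unfolding parallel_form2_def by (auto dest!: zero simp: cov_deriv_form2_def form2_apply_def)
    then show ?thesis
      unfolding symplectic_connection_def using lin by (auto dest!: zero simp: torsion_zero)
  qed
  ultimately show ?thesis ..
qed

section \<open>Symplectic reduction\<close>

text \<open>\<open>same_plaque\<close> is symmetric, so its reflexive transitive closure is an
  equivalence relation with the leaves as classes.\<close>

lemma leaf_eq_iff: "leaf \<F> x = leaf \<F> y \<longleftrightarrow> (same_plaque \<F>)\<^sup>*\<^sup>* x y"
proof
  show "(same_plaque \<F>)\<^sup>*\<^sup>* x y" if "leaf \<F> x = leaf \<F> y"
    using that unfolding leaf_def by blast
  have "symp (same_plaque \<F>)"
  proof (rule sympI)
    fix x y assume "same_plaque \<F> x y"
    then obtain U \<phi> B where "(U, \<phi>, B) \<in> \<F>" "x \<in> U" "y \<in> U" "same_transverse \<phi> B x y"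
      by (auto simp: same_plaque_def)
    moreover have "same_transverse \<phi> B y x"
      using calculation(4) unfolding same_transverse_def by simp
    ultimately show "same_plaque \<F> y x" unfolding same_plaque_def by blast
  qed
  then have "symp (same_plaque \<F>)\<^sup>*\<^sup>*" by (rule symp_rtranclp)
  then show "leaf \<F> x = leaf \<F> y" if "(same_plaque \<F>)\<^sup>*\<^sup>* x y"
    using that unfolding leaf_def by (blast intro: rtranclp_trans dest: sympD)
qed

text \<open>Pushforward is onto the tangent space of \<open>Q\<close>, so \<open>v\<close> pairs to
  0 with everything upstairs iff its image does so downstairs; nondegeneracy then forces the image
  to be 0.\<close>

lemma form2_kernel_reduced:
  assumes nondeg: "form2_kernel Q \<omega>' (\<pi> x) = {0}"
    and sub: "submersion M Q \<pi>" and x: "x \<in> points M"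
    and pullback: "\<And>u v. u \<in> tangent_space M x \<Longrightarrow> v \<in> tangent_space M x \<Longrightarrow>
      \<omega>' (\<pi> x) (pushforward Q \<pi> u) (pushforward Q \<pi> v) = \<omega> x u v"
  shows "form2_kernel M \<omega> x = {v \<in> tangent_space M x. pushforward Q \<pi> v = 0}"
proof -
  have im: "pushforward Q \<pi> ` tangent_space M x = tangent_space Q (\<pi> x)"
    using sub x by (simp add: submersion_def)
  have "v \<in> form2_kernel M \<omega> x \<longleftrightarrow> pushforward Q \<pi> v \<in> form2_kernel Q \<omega>' (\<pi> x)"
    if v: "v \<in> tangent_space M x" for v
    using v pullback[OF v] by (simp add: form2_kernel_def im[symmetric])
  moreover have "form2_kernel M \<omega> x \<subseteq> tangent_space M x" by (auto simp: form2_kernel_def)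
  ultimately show ?thesis unfolding nondeg by blast
qed

theorem proposition3p3:
  fixes M :: "('a, 'e::euclidean_space) mfd"
    and \<omega> :: "'a form2"
    and n p :: nat
    and \<I> :: "('a, 'e) fchart set"
    and Q :: "('a set, 'f::euclidean_space) mfd"
    and \<omega>' :: "'a set form2"
    and nab :: "'a connection"
  assumes "presymplectic_manifold M \<omega> n p"
    and "characteristic_foliation M \<omega> p \<I>"
    and "reduced_symplectic_manifold M \<omega> \<I> Q \<omega>'"
    and "presymplectic_connection M \<omega> nab"
    and "projectable_connection M \<I> nab"
  shows "\<exists>nab'. induces_connection M \<I> Q (leaf \<I>) nab nab' \<and> symplectic_connection Q \<omega>' nab'"
proof -
  let ?\<pi> = "leaf \<I>"
  have M: "smooth_manifold M" "smooth_form2 M \<omega>"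
    using assms(1) by (auto simp: presymplectic_manifold_def)
  have Q: "smooth_manifold Q" "smooth_form2 Q \<omega>'" and sub: "submersion M Q ?\<pi>"
    and nondeg: "\<And>q. q \<in> points Q \<Longrightarrow> form2_kernel Q \<omega>' q = {0}"
    and surj: "?\<pi> ` points M = points Q"
    and pullback: "\<And>x u v. x \<in> points M \<Longrightarrow> u \<in> tangent_space M x \<Longrightarrow> v \<in> tangent_space M x \<Longrightarrow>
      \<omega>' (?\<pi> x) (pushforward Q ?\<pi> u) (pushforward Q ?\<pi> v) = \<omega> x u v"
    using assms(3) by (auto simp: reduced_symplectic_manifold_def symplectic_manifold_def leaves_def)
  have nab: "linear_connection M nab" "parallel_form2 M nab \<omega>"
    and torsion: "\<And>X Y x. X \<in> vector_fields M \<Longrightarrow> Y \<in> vector_fields M \<Longrightarrow> x \<in> points M \<Longrightarrow>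
      torsion nab X Y x \<in> form2_kernel M \<omega> x"
    using assms(4) by (auto simp: presymplectic_connection_def)
  have pts: "?\<pi> x \<in> points Q" if "x \<in> points M" for x using that surj by blast
  have kernel: "form2_kernel M \<omega> x = {v \<in> tangent_space M x. pushforward Q ?\<pi> v = 0}"
    if x: "x \<in> points M" for x
    by (rule form2_kernel_reduced[where \<pi> = ?\<pi> and \<omega> = \<omega> and \<omega>' = \<omega>',
          OF nondeg[OF pts[OF x]] sub x pullback[OF x]])
  have leaf: "leaf_tangent_space M \<I> x = {v \<in> tangent_space M x. pushforward Q ?\<pi> v = 0}"
    if "x \<in> points M" for x
    using assms(2) kernel[OF that] that by (simp add: characteristic_foliation_def)
  show ?thesis
  proof (cases "mdim M = 0 \<or> mdim Q = 0")
    case dim: True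
    \<comment> \<open>If \<open>M\<close> has dimension 0, the tangent spaces of \<open>Q\<close>
      are trivial as images of trivial ones under the submersion.\<close>
    have "v = 0" if q: "q \<in> points Q" "v \<in> tangent_space Q q" for q v
    proof (cases "mdim Q = 0")
      case True
      then show ?thesis using tangent_space_zero_dim[OF Q(1)] q(2) by blast
    next
      case False
      then have "mdim M = 0" using dim by simp
      obtain x where x: "x \<in> points M" "q = ?\<pi> x" using q(1) surj by blast
      then have "v \<in> pushforward Q ?\<pi> ` tangent_space M x"
        using sub q(2) by (simp add: submersion_def)
      then show ?thesis
        using tangent_space_zero_dim[OF M(1) \<open>mdim M = 0\<close>] pushforward_zero by blast
    qed
    then have "induces_connection M \<I> Q ?\<pi> nab (\<lambda>_ _. 0) \<and> symplectic_connection Q \<omega>' (\<lambda>_ _. 0)"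
      by (intro induces_zero_connection M Q sub nab pts)
        (simp_all add: leaf tangent_space_zero pushforward_zero)
    then show ?thesis by blast
  next
    case False
    interpret foliated_connection M Q ?\<pi> p \<I> nab
    proof unfold_locales
      show "smooth_manifold M" "smooth_manifold Q" "mdim M \<noteq> 0" "mdim Q \<noteq> 0" "submersion M Q ?\<pi>"
        "?\<pi> ` points M = points Q" "projectable_connection M \<I> nab"
        using M Q False sub surj assms(5) by auto
      show "foliation M p \<I>" using assms(2) by (simp add: characteristic_foliation_def)
      show "leaf_tangent_space M \<I> x = {v \<in> tangent_space M x. pushforward Q ?\<pi> v = 0}"
        if "x \<in> points M" for x
        by (rule leaf[OF that])
      show "?\<pi> x = ?\<pi> y \<longleftrightarrow> (same_plaque \<I>)\<^sup>*\<^sup>* x y" for x y by (rule leaf_eq_iff)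
      show "vf_projects_to M Q ?\<pi> (torsion nab X Y) 0"
        if "X \<in> vector_fields M" "Y \<in> vector_fields M" for X Y
        using torsion[OF that] kernel by (auto simp: vf_projects_to_def)
    qed
    have "symplectic_connection Q \<omega>' induced"
      unfolding symplectic_connection_def
      using induced_linear_connection induced_parallel[OF nab(2) M(2) Q(2) pullback]
        induced_torsion_free by blast
    then show ?thesis using induces_connection by blast
  qed
qed

end
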